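(* For all integers $k \geq 4$ and $n \geq k+2$, every list $k$-critical graph on $n$ vertices has more than $\left(k-1+\frac{1}{28}\right)\frac n2$ edges, and every correspondence $k$-critical graph on $n$ vertices has more than $\left(k-1+\frac{1}{28}\right)\frac n2$ edges. Consequently $g_\ell(k)\ge \frac{1}{28}$ and $g_{DP}(k)\geq \frac{1}{28}$ for all $k\ge 4$. Moreover, $g_\ell(k)\geq \frac{1}{24}$ and $g_{DP}(k)\ge\frac1{24}$ for all $k\geq 352$.
   Context: Graphs are finite, with no loops or parallel edges. List coloring: a list assignment $L$ on $G$ assigns a set $L(v)\subseteq\mathbb N$ to each $v \in V(G)$; an $L$-coloring is a proper coloring $\phi$ of $G$ with $\phi(v)\in L(v)$ for all $v$. $G$ is $k$-list-colorable if it has an $L$-coloring for every list assignment $L$ with $|L(v)|\ge k$ for all $v$. $G$ is list $k$-critical if $G$ is not $(k-1)$-list-colorable but every proper subgraph of $G$ is. Correspondence coloring: a correspondence cover of $G$ is a pair $(H,L)$ where $H$ is a graph, $L: V(G)\to 2^{V(H)}$, each $L(v)$ is independent in $H$, the sets $L(v)$ partition $V(H)$, and for distinct $u,v\in V(G)$ the edges of $H$ between $L(u)$ and $L(v)$ form a (possibly empty) matching if $uv\in E(G)$, and there are no such edges if $uv\notin E(G)$. An $(H,L)$-coloring of $G$ is a function $\phi: V(G)\to V(H)$ with $\phi(v)\in L(v)$ for every $v$ whose image is independent in $H$. $G$ is correspondence $k$-colorable if it has an $(H,L)$-coloring for every correspondence cover with $|L(v)|\ge k$ for all $v$. $G$ is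 correspondence $k$-critical if $G$ is not correspondence $(k-1)$-colorable but every proper subgraph of $G$ is. $f_\ell(n,k)$ (respectively $f_{DP}(n,k)$) is the minimum number of edges in a list $k$-critical (respectively correspondence $k$-critical simple) graph on $n$ vertices, interpreted as $+\infty$ if there is none. Define $g_\ell(k)=\liminf_{n\to\infty}\left(\frac{2}{n}f_\ell(n,k)-k+1\right)$ and $g_{DP}(k)=\liminf_{n\to\infty}\left(\frac{2}{n}f_{DP}(n,k)-k+1\right)$. *)

theory Defs
  imports Complex_Main "HOL-Library.Extended_Real" "HOL-Library.Disjoint_Sets"
begin

record 'a graph =
  verts :: "'a set"
  edges :: "'a set set"

definition simple_graph :: "'a graph \<Rightarrow> bool" where
  "simple_graph G \<longleftrightarrow>
     finite (verts G) \<and> (\<forall>e \<in> edges G. e \<subseteq> verts G \<and> card e = 2)"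

definition proper_subgraph :: "'a graph \<Rightarrow> 'a graph \<Rightarrow> bool" where
  "proper_subgraph G' G \<longleftrightarrow>
     simple_graph G' \<and> verts G' \<subseteq> verts G \<and> edges G' \<subseteq> edges G \<and> G' \<noteq> G"

definition independent_in :: "'a graph \<Rightarrow> 'a set \<Rightarrow> bool" where
  "independent_in G S \<longleftrightarrow> S \<subseteq> verts G \<and> (\<forall>x \<in> S. \<forall>y \<in> S. {x, y} \<notin> edges G)"


section \<open>List coloring\<close>

definition proper_coloring :: "'a graph \<Rightarrow> ('a \<Rightarrow> nat) \<Rightarrow> bool" where
  "proper_coloring G \<phi> \<longleftrightarrow>
     (\<forall>u \<in> verts G. \<forall>v \<in> verts G. {u, v} \<in> edges G \<longrightarrow> \<phi> u \<noteq> \<phi> v)"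

definition list_coloring :: "'a graph \<Rightarrow> ('a \<Rightarrow> nat set) \<Rightarrow> ('a \<Rightarrow> nat) \<Rightarrow> bool" where
  "list_coloring G L \<phi> \<longleftrightarrow> proper_coloring G \<phi> \<and> (\<forall>v \<in> verts G. \<phi> v \<in> L v)"

text \<open>Lists may be infinite, and \<^const>\<open>card\<close> is 0 on infinite sets, so these are admitted
  separately.\<close>

definition list_colorable :: "nat \<Rightarrow> 'a graph \<Rightarrow> bool" where
  "list_colorable k G \<longleftrightarrow>
     (\<forall>L :: 'a \<Rightarrow> nat set.
        (\<forall>v \<in> verts G. infinite (L v) \<or> card (L v) \<ge> k) \<longrightarrow> (\<exists>\<phi>. list_coloring G L \<phi>))"

definition list_critical :: "nat \<Rightarrow> 'a graph \<Rightarrow> bool" where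
  "list_critical k G \<longleftrightarrow>
     simple_graph G \<and> \<not> list_colorable (k - 1) G \<and>
     (\<forall>G'. proper_subgraph G' G \<longrightarrow> list_colorable (k - 1) G')"


section \<open>Correspondence coloring\<close>

definition edges_between :: "'a graph \<Rightarrow> 'a set \<Rightarrow> 'a set \<Rightarrow> 'a set set" where
  "edges_between H A B = {e \<in> edges H. \<exists>x \<in> A. \<exists>y \<in> B. e = {x, y}}"

definition matching :: "'a set set \<Rightarrow> bool" where
  "matching M \<longleftrightarrow> disjoint M"

definition correspondence_cover :: "'a graph \<Rightarrow> 'b graph \<Rightarrow> ('a \<Rightarrow> 'b set) \<Rightarrow> bool" where
  "correspondence_cover G H L \<longleftrightarrow>
     simple_graph H \<and>
     (\<forall>v \<in> verts G. independent_in H (L v)) \<and>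
     disjoint_family_on L (verts G) \<and> (\<Union>v \<in> verts G. L v) = verts H \<and>
     (\<forall>u \<in> verts G. \<forall>v \<in> verts G. u \<noteq> v \<longrightarrow>
        (if {u, v} \<in> edges G then matching (edges_between H (L u) (L v))
         else edges_between H (L u) (L v) = {}))"

definition cover_coloring ::
    "'a graph \<Rightarrow> 'b graph \<Rightarrow> ('a \<Rightarrow> 'b set) \<Rightarrow> ('a \<Rightarrow> 'b) \<Rightarrow> bool" where
  "cover_coloring G H L \<phi> \<longleftrightarrow>
     (\<forall>v \<in> verts G. \<phi> v \<in> L v) \<and> independent_in H (\<phi> ` verts G)"

text \<open>Cover graphs are finite, so taking their vertices in \<^typ>\<open>nat\<close> loses no generality up to
  isomorphism; finiteness also makes \<^const>\<open>card\<close> adequate here.\<close>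

definition correspondence_colorable :: "nat \<Rightarrow> 'a graph \<Rightarrow> bool" where
  "correspondence_colorable k G \<longleftrightarrow>
     (\<forall>(H :: nat graph) L.
        correspondence_cover G H L \<and> (\<forall>v \<in> verts G. card (L v) \<ge> k) \<longrightarrow>
        (\<exists>\<phi>. cover_coloring G H L \<phi>))"

definition correspondence_critical :: "nat \<Rightarrow> 'a graph \<Rightarrow> bool" where
  "correspondence_critical k G \<longleftrightarrow>
     simple_graph G \<and> \<not> correspondence_colorable (k - 1) G \<and>
     (\<forall>G'. proper_subgraph G' G \<longrightarrow> correspondence_colorable (k - 1) G')"


section \<open>Minimum number of edges and average degree excess\<close>

text \<open>On \<^typ>\<open>enat\<close>, the infimum of a nonempty set is its least element and that of the
  empty set is \<open>\<infinity>\<close>. Graphs on vertex set within \<^typ>\<open>nat\<close> represent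
  all finite graphs up to isomorphism.\<close>

definition f_list :: "nat \<Rightarrow> nat \<Rightarrow> enat" where
  "f_list n k =
     Inf {enat (card (edges G)) | G :: nat graph. list_critical k G \<and> card (verts G) = n}"

definition f_DP :: "nat \<Rightarrow> nat \<Rightarrow> enat" where
  "f_DP n k =
     Inf {enat (card (edges G)) | G :: nat graph.
            correspondence_critical k G \<and> card (verts G) = n}"

definition g_list :: "nat \<Rightarrow> ereal" where
  "g_list k =
     liminf (\<lambda>n. ereal (2 / real n) * ereal_of_enat (f_list n k) - ereal (real k) + 1)"

definition g_DP :: "nat \<Rightarrow> ereal" where
  "g_DP k =
     liminf (\<lambda>n. ereal (2 / real n) * ereal_of_enat (f_DP n k) - ereal (real k) + 1)"

end

theory Submission
  imports Defs
begin

text \<open>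
  Put \<open>d = k - 1\<close>. For a \<open>k\<close>-critical graph fix a list assignment or cover with \<open>d\<close> colors at
  each vertex that admits no coloring; every proper induced subgraph is colorable from it. All
  degrees are at least \<open>d\<close>. Call the difference the excess of the vertex and a vertex low if its
  excess is \<open>0\<close>. Twice the number of edges is \<open>d n\<close> plus the total excess \<open>X\<close>, so the claim is
  \<open>n < 28 X\<close>, and \<open>n < 24 X\<close> for large \<open>k\<close>. Both list and correspondence coloring satisfy the axioms
  of the locale \<open>critical_cover\<close>, where this is proved.

  Low vertices are rigid: when everything outside a connected low set is colored, each of its
  vertices has exactly as many colors left as uncolored neighbors (\<open>tight\<close>). Hence connected low sets
  end in cliques or cycles (\<open>low_piece\<close>), and stripping these off bounds the number of edges inside
  the low set. For \<open>d \<le> 23\<close> this classical bound of Gallai suffices (\<open>excess_small_degree\<close>).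

  For \<open>d \<ge> 24\<close> the inequality \<open>n < 24 X\<close> is proved (\<open>excess_large_degree\<close>). Assume the contrary.
  Then nearly all vertices lie in disjoint low cliques of size more than \<open>5d/8 + 1\<close>, and these send
  about \<open>n\<close> edges to the high vertices, that is, at least about \<open>24\<close> edges per unit of excess
  (\<open>decomposition\<close>). By \<open>peeling\<close> there are a set \<open>S\<close> of high vertices and a nonempty family \<open>F\<close> of
  cliques such that each vertex of \<open>S\<close> has at least \<open>9\<close> times its excess of neighbors in the cliques
  of \<open>F\<close>, and in each of these cliques more than a third of the vertices have all their outside
  neighbors in \<open>S\<close>. Color all other vertices by criticality. Now every vertex of \<open>S\<close> can be colored
  with a choice of many colors, and the cliques of \<open>F\<close> come last.

  A clique cannot be completed only if the lists left at its vertices are perfectly aligned by the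
  conflicts. For two vertices of the clique with different neighborhoods, the last vertex of \<open>S\<close>
  adjacent to only one of them can break the alignment by avoiding a single color, and each later
  common neighbor can keep it broken by avoiding a single color (\<open>bad_unique_one\<close>,
  \<open>bad_unique_both\<close>). It remains to choose the order on \<open>S\<close> and the pairs such that no vertex has to
  avoid all its colors. Vertices that are joined to cliques by bundles of edges meet few cliques and
  can serve all of them; the others share the work by an orientation argument
  (\<open>balanced_orientation\<close>). The one configuration without a suitable pair, a clique all of whose
  vertices have the same outside neighbors, would contain a clique on \<open>d + 1\<close> vertices or contradict
  \<open>two_nonadjacent\<close>.
\<close>

section \<open>Covers and greedy coloring\<close>

text \<open>A list assignment and a correspondence cover differ only in which colors conflict along an edge.
The argument uses one property of conflicts: a color at one end of an edge excludes at most one color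
at the other end. The lists have exactly \<open>d = k - 1\<close> colors.\<close>

locale cover =
  fixes V :: "'a set" and adj :: "'a \<Rightarrow> 'a \<Rightarrow> bool"
    and Lst :: "'a \<Rightarrow> 'c set" and cf :: "'a \<Rightarrow> 'c \<Rightarrow> 'a \<Rightarrow> 'c \<Rightarrow> bool" and d :: nat
  assumes fin_V: "finite V"
    and adj_sym: "adj u v \<Longrightarrow> adj v u"
    and adj_irrefl: "\<not> adj v v"
    and adj_V: "adj u v \<Longrightarrow> u \<in> V"
    and fin_Lst: "v \<in> V \<Longrightarrow> finite (Lst v)"
    and card_Lst: "v \<in> V \<Longrightarrow> card (Lst v) = d"
    and cf_sym: "cf u a v b \<Longrightarrow> cf v b u a"
    and cf_unique: "\<lbrakk>adj u v; a \<in> Lst u; b \<in> Lst v; b' \<in> Lst v; cf u a v b; cf u a v b'\<rbrakk> \<Longrightarrow> b = b'"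
begin

definition nbrs :: "'a set \<Rightarrow> 'a \<Rightarrow> 'a set" where
  "nbrs X v = {u \<in> X. adj v u}"

definition colors :: "'a set \<Rightarrow> ('a \<Rightarrow> 'c) \<Rightarrow> bool" where
  "colors A \<phi> \<longleftrightarrow> (\<forall>v\<in>A. \<phi> v \<in> Lst v) \<and> (\<forall>u\<in>A. \<forall>v\<in>A. adj u v \<longrightarrow> \<not> cf u (\<phi> u) v (\<phi> v))"

definition avail :: "'a set \<Rightarrow> ('a \<Rightarrow> 'c) \<Rightarrow> 'a \<Rightarrow> 'c set" where
  "avail A \<phi> v = {b \<in> Lst v. \<forall>u\<in>A. adj u v \<longrightarrow> \<not> cf u (\<phi> u) v b}"

definition clique :: "'a set \<Rightarrow> bool" where
  "clique K \<longleftrightarrow> K \<subseteq> V \<and> (\<forall>u\<in>K. \<forall>v\<in>K. u \<noteq> v \<longrightarrow> adj u v)"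

text \<open>Connectedness of the induced subgraph, by cuts: this is the form in which greedy coloring uses it
(some vertex of \<open>Y\<close> still has an uncolored neighbor outside \<open>Y\<close>).\<close>

definition linked :: "'a set \<Rightarrow> bool" where
  "linked X \<longleftrightarrow> (\<forall>Y. Y \<subseteq> X \<and> Y \<noteq> {} \<and> Y \<noteq> X \<longrightarrow> (\<exists>y\<in>Y. \<exists>z\<in>X - Y. adj y z))"

lemma adj_V2: "adj u v \<Longrightarrow> v \<in> V"
  using adj_sym adj_V by blast

lemma finite_nbrs [simp]: "finite (nbrs X v)"
proof -
  have "nbrs X v \<subseteq> V" using adj_V2 by (auto simp: nbrs_def)
  then show ?thesis using fin_V finite_subset by blast
qed

lemma finite_avail: "v \<in> V \<Longrightarrow> finite (avail A \<phi> v)"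
  using fin_Lst by (auto simp: avail_def)

lemma finite_in_V: "A \<subseteq> V \<Longrightarrow> finite A"
  using fin_V finite_subset by blast

lemma nbrs_mono: "X \<subseteq> Y \<Longrightarrow> nbrs X v \<subseteq> nbrs Y v"
  by (auto simp: nbrs_def)

lemma card_nbrs_mono: "X \<subseteq> Y \<Longrightarrow> card (nbrs X v) \<le> card (nbrs Y v)"
  by (intro card_mono nbrs_mono) auto

lemma card_nbrs_Un: "X \<inter> Y = {} \<Longrightarrow> card (nbrs (X \<union> Y) v) = card (nbrs X v) + card (nbrs Y v)"
proof -
  assume "X \<inter> Y = {}"
  then have "nbrs X v \<inter> nbrs Y v = {}" "nbrs (X \<union> Y) v = nbrs X v \<union> nbrs Y v" by (auto simp: nbrs_def)
  then show ?thesis by (simp add: card_Un_disjoint)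
qed

lemma card_nbrs_split: "Y \<subseteq> X \<Longrightarrow> card (nbrs X v) = card (nbrs Y v) + card (nbrs (X - Y) v)"
  using card_nbrs_Un[of Y "X - Y" v] by (simp add: Un_absorb1)

lemma card_conflict_le: 
  assumes "b \<in> Lst v" "adj v w"
  shows "card {c \<in> Lst w. cf v b w c} \<le> 1"
proof -
  have "\<forall>c\<in>{c \<in> Lst w. cf v b w c}. \<forall>c'\<in>{c \<in> Lst w. cf v b w c}. c = c'"
    using cf_unique assms by blast
  moreover have "finite {c \<in> Lst w. cf v b w c}" using fin_Lst[OF adj_V2[OF assms(2)]] by simp
  ultimately show ?thesis by (simp only: One_nat_def card_le_Suc0_iff_eq)
qed

lemma card_avail_Un:
  assumes "y \<in> V" "\<And>b. b \<in> B \<Longrightarrow> \<psi> b \<in> Lst b" "\<And>a. a \<in> A \<Longrightarrow> \<psi> a = \<phi> a"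
  shows "card (avail A \<phi> y) \<le> card (avail (A \<union> B) \<psi> y) + card (nbrs B y)"
proof -
  let ?U = "\<Union>u\<in>nbrs B y. {c \<in> Lst y. cf u (\<psi> u) y c}"
  have fU: "finite ?U" using fin_Lst[OF assms(1)] by auto
  have "avail A \<phi> y \<subseteq> avail (A \<union> B) \<psi> y \<union> ?U"
    using assms adj_sym by (auto simp: avail_def nbrs_def)
  then have "card (avail A \<phi> y) \<le> card (avail (A \<union> B) \<psi> y \<union> ?U)"
    using finite_avail[OF assms(1)] fU by (intro card_mono) auto
  also have "\<dots> \<le> card (avail (A \<union> B) \<psi> y) + card ?U" by (rule card_Un_le)
  also have "card ?U \<le> (\<Sum>u\<in>nbrs B y. card {c \<in> Lst y. cf u (\<psi> u) y c})"
    by (rule card_UN_le) simp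
  also have "\<dots> \<le> (\<Sum>u\<in>nbrs B y. 1)"
    using assms adj_sym by (intro sum_mono card_conflict_le) (auto simp: nbrs_def)
  finally show ?thesis by simp
qed

lemma card_avail_ge:
  assumes "y \<in> V" "\<And>b. b \<in> B \<Longrightarrow> \<psi> b \<in> Lst b"
  shows "d \<le> card (avail B \<psi> y) + card (nbrs B y)"
  using card_avail_Un[of y B \<psi> "{}" \<psi>] assms card_Lst[of y] by (simp add: avail_def)

lemma avail_insert:
  "v \<notin> A \<Longrightarrow> avail (insert v A) (\<phi>(v := b)) w = avail A \<phi> w - {c. adj v w \<and> cf v b w c}"
  by (auto simp: avail_def)

lemma colors_insert:
  assumes "colors A \<phi>" "v \<notin> A" "b \<in> avail A \<phi> v"
  shows "colors (insert v A) (\<phi>(v := b))"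
proof -
  have "\<not> cf u (\<phi> u) v b" "\<not> cf v b u (\<phi> u)" if "u \<in> A" "adj u v \<or> adj v u" for u
    using assms(3) that cf_sym adj_sym unfolding avail_def by blast+
  then show ?thesis using assms adj_irrefl unfolding colors_def avail_def by auto
qed

text \<open>Color the vertices of \<open>X\<close> so that the vertex promised for \<open>Y = X\<close> comes last, and recurse on the
others: at most as many of its colors are lost as it has neighbors in \<open>X\<close>.\<close>

lemma greedy_degenerate:
  assumes "X \<subseteq> V" "A \<inter> X = {}" "colors A \<phi>"
    and "\<And>Y. Y \<subseteq> X \<Longrightarrow> Y \<noteq> {} \<Longrightarrow> \<exists>y\<in>Y. card (nbrs Y y) < card (avail A \<phi> y)"
  shows "\<exists>\<psi>. colors (A \<union> X) \<psi> \<and> (\<forall>a\<in>A. \<psi> a = \<phi> a)"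
  using assms
proof (induction "card X" arbitrary: X)
  case 0
  then have "X = {}" using finite_in_V by (metis card_0_eq)
  with 0 show ?case by auto
next
  case (Suc n)
  then have "X \<noteq> {}" by auto
  then obtain y where y: "y \<in> X" "card (nbrs X y) < card (avail A \<phi> y)" using Suc.prems(4) by blast
  let ?X = "X - {y}"
  have "card ?X = n" using Suc.hyps(2) y(1) finite_in_V[OF Suc.prems(1)] by simp
  then have "\<exists>\<psi>. colors (A \<union> ?X) \<psi> \<and> (\<forall>a\<in>A. \<psi> a = \<phi> a)"
    using Suc.prems by (intro Suc.hyps(1)) auto
  then obtain \<psi> where \<psi>: "colors (A \<union> ?X) \<psi>" "\<forall>a\<in>A. \<psi> a = \<phi> a" by blast
  have "card (avail A \<phi> y) \<le> card (avail (A \<union> ?X) \<psi> y) + card (nbrs ?X y)"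
    using \<psi> y(1) Suc.prems(1) by (intro card_avail_Un) (auto simp: colors_def)
  moreover have "card (nbrs ?X y) \<le> card (nbrs X y)" by (intro card_nbrs_mono) auto
  ultimately have "card (avail (A \<union> ?X) \<psi> y) > 0" using y by linarith
  then obtain b where b: "b \<in> avail (A \<union> ?X) \<psi> y" by (metis card_gt_0_iff all_not_in_conv)
  have yn: "y \<notin> A \<union> ?X" using Suc.prems(2) y(1) by auto
  have "colors (insert y (A \<union> ?X)) (\<psi>(y := b))" by (rule colors_insert[OF \<psi>(1) yn b])
  moreover have "insert y (A \<union> ?X) = A \<union> X" using y(1) by auto
  ultimately show ?case using \<psi>(2) yn by (metis UnI1 fun_upd_apply)
qed

lemma linkedD: "linked X \<Longrightarrow> Y \<subseteq> X \<Longrightarrow> Y \<noteq> {} \<Longrightarrow> Y \<noteq> X \<Longrightarrow> \<exists>y\<in>Y. \<exists>z\<in>X - Y. adj y z"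
  unfolding linked_def by simp

lemma linkedI: "(\<And>Y. Y \<subseteq> X \<Longrightarrow> Y \<noteq> {} \<Longrightarrow> Y \<noteq> X \<Longrightarrow> \<exists>y\<in>Y. \<exists>z\<in>X - Y. adj y z) \<Longrightarrow> linked X"
  unfolding linked_def by simp

text \<open>One vertex with more colors than neighbors is enough when \<open>X\<close> is connected: it is colored last, and
every other vertex while it still has an uncolored neighbor.\<close>

lemma greedy_linked:
  assumes "X \<subseteq> V" "A \<inter> X = {}" "colors A \<phi>" "linked X"
    and ge: "\<And>v. v \<in> X \<Longrightarrow> card (nbrs X v) \<le> card (avail A \<phi> v)"
    and "z \<in> X" "card (nbrs X z) < card (avail A \<phi> z)"
  shows "\<exists>\<psi>. colors (A \<union> X) \<psi> \<and> (\<forall>a\<in>A. \<psi> a = \<phi> a)"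
proof (rule greedy_degenerate[OF assms(1-3)])
  fix Y assume Y: "Y \<subseteq> X" "Y \<noteq> {}"
  show "\<exists>y\<in>Y. card (nbrs Y y) < card (avail A \<phi> y)"
  proof (cases "z \<in> Y")
    case True
    then show ?thesis using le_less_trans[OF card_nbrs_mono[OF Y(1)] assms(7)] by blast
  next
    case False
    then have "Y \<noteq> X" using \<open>z \<in> X\<close> by metis
    then obtain y u where yu: "y \<in> Y" "u \<in> X - Y" "adj y u"
      using linkedD[OF \<open>linked X\<close> Y] by metis
    have "card (nbrs X y) = card (nbrs Y y) + card (nbrs (X - Y) y)" by (rule card_nbrs_split[OF Y(1)])
    moreover have "card (nbrs (X - Y) y) > 0" using yu finite_nbrs[of "X - Y" y] by (auto simp: card_gt_0_iff nbrs_def)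
    moreover have "card (nbrs X y) \<le> card (avail A \<phi> y)" using ge[of y] yu(1) Y(1) by blast
    ultimately have "card (nbrs Y y) < card (avail A \<phi> y)" by linarith
    then show ?thesis using yu(1) by blast
  qed
qed

lemma clique_linked:
  assumes "clique K"
  shows "linked K"
proof (rule linkedI)
  fix Y assume Y: "Y \<subseteq> K" "Y \<noteq> {}" "Y \<noteq> K"
  then obtain y z where "y \<in> Y" "z \<in> K - Y" by auto
  then show "\<exists>y\<in>Y. \<exists>z\<in>K - Y. adj y z"
    using assms Y(1) unfolding clique_def by (metis DiffD1 DiffD2 subsetD)
qed

lemma clique_subset: "clique K \<Longrightarrow> J \<subseteq> K \<Longrightarrow> clique J"
  unfolding clique_def by blast

lemma clique_nbrs: "clique K \<Longrightarrow> v \<in> K \<Longrightarrow> nbrs K v = K - {v}"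
  using adj_irrefl unfolding clique_def nbrs_def by auto

lemma clique_finite: "clique K \<Longrightarrow> finite K"
  unfolding clique_def using finite_in_V by blast

end

text \<open>What remains of criticality after a bad cover has been fixed. The clique bound holds because
\<open>K\<^sub>k\<close> is not \<open>(k - 1)\<close>-colorable, hence is no proper subgraph of a \<open>k\<close>-critical graph.\<close>

locale critical_cover = cover +
  assumes uncolorable: "\<not> colors V \<phi>"
    and critical: "A \<subset> V \<Longrightarrow> \<exists>\<phi>. colors A \<phi>"
    and clique_bound: "clique K \<Longrightarrow> card K \<le> d"
begin

definition excess :: "'a \<Rightarrow> nat" where "excess v = card (nbrs V v) - d"

definition Low :: "'a set" where "Low = {v \<in> V. card (nbrs V v) = d}"

lemma Low_V: "Low \<subseteq> V" by (auto simp: Low_def)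

lemma critical_rest:
  assumes "X \<subseteq> V" "v \<in> X"
  obtains \<phi> where "colors (V - X) \<phi>"
proof -
  have "V - X \<subset> V" using assms by auto
  then obtain \<phi> where "colors (V - X) \<phi>" using critical by blast
  then show ?thesis by (rule that)
qed

lemma deg_eq:
  assumes "v \<in> V" shows "card (nbrs V v) = d + excess v"
proof -
  obtain \<phi> where \<phi>: "colors (V - {v}) \<phi>" by (rule critical_rest[of "{v}" v]) (use assms in auto)
  have "avail (V - {v}) \<phi> v = {}"
  proof (rule ccontr)
    assume "avail (V - {v}) \<phi> v \<noteq> {}"
    then obtain b where b: "b \<in> avail (V - {v}) \<phi> v" by blast
    have "colors (insert v (V - {v})) (\<phi>(v := b))" by (rule colors_insert[OF \<phi> _ b]) simp
    then show False using uncolorable assms by (simp add: insert_absorb)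
  qed
  then have "d \<le> card (nbrs (V - {v}) v)"
    using card_avail_ge[of v "V - {v}" \<phi>] \<phi> assms by (auto simp: colors_def)
  also have "\<dots> \<le> card (nbrs V v)" by (intro card_nbrs_mono) auto
  finally show ?thesis by (simp add: excess_def)
qed

lemma excess_low: "v \<in> Low \<Longrightarrow> excess v = 0" by (simp add: Low_def excess_def)

lemma excess_high: "v \<in> V - Low \<Longrightarrow> excess v \<ge> 1" using deg_eq[of v] by (auto simp: Low_def)

lemma card_avail_rest:
  assumes "X \<subseteq> V" "colors (V - X) \<phi>" "v \<in> V"
  shows "card (nbrs X v) \<le> card (avail (V - X) \<phi> v) + excess v"
  using card_avail_ge[of v "V - X" \<phi>] card_nbrs_split[of X V v] deg_eq[of v] assms
  by (auto simp: colors_def)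

lemma card_avail_low:
  assumes "X \<subseteq> V" "colors (V - X) \<phi>" "v \<in> Low"
  shows "card (nbrs X v) \<le> card (avail (V - X) \<phi> v)"
  using card_avail_rest[OF assms(1,2), of v] excess_low[OF assms(3)] assms(3) Low_V by auto

text \<open>A low vertex never has fewer colors than uncolored neighbors. In a connected low set a single
vertex with more would let the greedy coloring succeed.\<close>

lemma tight:
  assumes "X \<subseteq> Low" "linked X" "colors (V - X) \<phi>" "v \<in> X"
  shows "card (avail (V - X) \<phi> v) = card (nbrs X v)"
proof (rule ccontr)
  have XV: "X \<subseteq> V" using assms(1) Low_V by blast
  have ge: "card (nbrs X u) \<le> card (avail (V - X) \<phi> u)" if "u \<in> X" for u
    using card_avail_low[OF XV assms(3)] that assms(1) by blast
  assume "card (avail (V - X) \<phi> v) \<noteq> card (nbrs X v)"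
  then have "card (nbrs X v) < card (avail (V - X) \<phi> v)" using ge[OF assms(4)] by linarith
  then obtain \<psi> where "colors (V - X \<union> X) \<psi>"
    using greedy_linked[OF XV _ assms(3,2) ge assms(4)] by blast
  then show False using uncolorable XV by (simp add: Un_absorb2)
qed

text \<open>Color \<open>v\<close> with any of its remaining colors. The rest of \<open>X\<close> is connected and again cannot be
completed, hence is tight, so \<open>w\<close> has lost a color. This maps the colors of \<open>v\<close> injectively to
those of \<open>w\<close>.\<close>

lemma noncut_degree_le:
  assumes X: "X \<subseteq> Low" "linked X" and v: "v \<in> X" "linked (X - {v})" and w: "w \<in> X" "adj v w"
  shows "card (nbrs X v) \<le> card (nbrs X w)"
proof -
  have XV: "X \<subseteq> V" using X Low_V by blast
  obtain \<phi> where \<phi>: "colors (V - X) \<phi>" by (rule critical_rest[OF XV v(1)])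
  let ?P = "avail (V - X) \<phi> v" and ?R = "avail (V - X) \<phi> w"
  have wv: "w \<noteq> v" using w adj_irrefl by blast
  have "\<exists>c\<in>?R. cf v b w c" if b: "b \<in> ?P" for b
  proof (rule ccontr)
    assume no: "\<not> (\<exists>c\<in>?R. cf v b w c)"
    have vn: "v \<notin> V - X" using v by auto
    have e: "insert v (V - X) = V - (X - {v})" using v XV by auto
    have c: "colors (V - (X - {v})) (\<phi>(v := b))" using colors_insert[OF \<phi> vn b] e by simp
    have "card (avail (V - (X - {v})) (\<phi>(v := b)) w) = card (nbrs (X - {v}) w)"
      using X v w wv by (intro tight c) auto
    moreover have "avail (V - (X - {v})) (\<phi>(v := b)) w = ?R"
      using avail_insert[OF vn, of \<phi> b w] e no by auto
    moreover have "card ?R = card (nbrs X w)" by (rule tight[OF X \<phi> w(1)])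
    moreover have "nbrs (X - {v}) w \<subset> nbrs X w" using w v adj_sym by (auto simp: nbrs_def)
    then have "card (nbrs (X - {v}) w) < card (nbrs X w)" by (intro psubset_card_mono) auto
    ultimately show False by simp
  qed
  then obtain f where f: "\<And>b. b \<in> ?P \<Longrightarrow> f b \<in> ?R \<and> cf v b w (f b)" by metis
  have "inj_on f ?P"
  proof (rule inj_onI)
    fix b b' assume b: "b \<in> ?P" "b' \<in> ?P" "f b = f b'"
    have "cf w (f b) v b" "cf w (f b) v b'" using cf_sym f b by metis+
    moreover have "b \<in> Lst v" "b' \<in> Lst v" "f b \<in> Lst w" using b f by (auto simp: avail_def)
    ultimately show "b = b'" using cf_unique[OF adj_sym[OF w(2)]] by blast
  qed
  then have "card ?P \<le> card ?R"
    using f finite_avail[of w] w(1) XV by (intro card_inj_on_le[of f]) auto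
  then show ?thesis using tight[OF X \<phi> v(1)] tight[OF X \<phi> w(1)] by simp
qed

end

section \<open>Two nonadjacent vertices attached to a low clique\<close>

context critical_cover begin

text \<open>If \<open>w1\<close> and \<open>w2\<close> had more edges to \<open>K\<close>, then after coloring everything else they could
be given colors that exclude together only one color of their common neighbor \<open>q\<close> (or \<open>q\<close>
has a color to spare anyway). Then \<open>q\<close> keeps \<open>card K\<close> colors and \<open>K\<close> can be completed.
This is the substitute for the Brooks-Lovasz configuration of a path with nonadjacent ends.\<close>

lemma two_nonadjacent:
  assumes K: "K \<subseteq> Low" "clique K" and q: "q \<in> K" "adj w1 q" "adj w2 q"
    and w: "w1 \<notin> K" "w2 \<notin> K" "w1 \<noteq> w2" "\<not> adj w1 w2"
    and pos: "excess w1 < card (nbrs K w1)" "excess w2 < card (nbrs K w2)"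
  shows "card (nbrs K w1) + card (nbrs K w2) \<le> card K + 1 + excess w1 + excess w2"
proof (rule ccontr)
  assume big: "\<not> ?thesis"
  have wV: "w1 \<in> V" "w2 \<in> V" "q \<in> V" using q adj_V adj_V2 by auto
  let ?X = "K \<union> {w1, w2}"
  let ?A = "V - ?X"
  have KV: "K \<subseteq> V" and finK: "finite K" using K clique_finite by (auto simp: clique_def)
  have XV: "?X \<subseteq> V" using KV wV by auto
  obtain \<phi> where \<phi>: "colors ?A \<phi>" by (rule critical_rest[OF XV, of q]) (use q in auto)
  have w21: "\<not> adj w2 w1" using w adj_sym by blast
  let ?P1 = "avail ?A \<phi> w1" and ?P2 = "avail ?A \<phi> w2" and ?R = "avail ?A \<phi> q"
  have "nbrs ?X w1 = nbrs K w1" "nbrs ?X w2 = nbrs K w2" using w w21 adj_irrefl by (auto simp: nbrs_def)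
  then have c1: "card (nbrs K w1) \<le> card ?P1 + excess w1" and c2: "card (nbrs K w2) \<le> card ?P2 + excess w2"
    using card_avail_rest[OF XV \<phi>] wV by metis+
  have "nbrs ?X q = (K - {q}) \<union> {w1, w2}"
    using clique_nbrs[OF K(2) q(1)] q adj_sym by (auto simp: nbrs_def)
  then have "card (nbrs ?X q) = (card K - 1) + 2"
    using w finK q by (subst \<open>nbrs ?X q = _\<close>, subst card_Un_disjoint) auto
  moreover have "card K \<ge> 1" using q(1) finK by (metis One_nat_def Suc_leI card_gt_0_iff empty_iff)
  moreover have "card (nbrs ?X q) \<le> card ?R" using card_avail_low[OF XV \<phi>, of q] q K by blast
  ultimately have Rge: "card K + 1 \<le> card ?R" by linarith
  have finR: "finite ?R" "finite ?P1" "finite ?P2" using finite_avail wV by auto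
  have ex: "\<exists>b1\<in>?P1. \<exists>b2\<in>?P2. card K \<le> card (?R - {c. cf w1 b1 q c} - {c. cf w2 b2 q c})"
  proof -
    have n1: "card (?R \<inter> {c. cf w1 b q c}) \<le> 1" if "b \<in> ?P1" for b
    proof -
      have "card (?R \<inter> {c. cf w1 b q c}) \<le> card {c \<in> Lst q. cf w1 b q c}"
        using fin_Lst wV by (intro card_mono) (auto simp: avail_def)
      also have "\<dots> \<le> 1" using that q by (intro card_conflict_le) (auto simp: avail_def)
      finally show ?thesis .
    qed
    have n2: "card (?R \<inter> {c. cf w2 b q c}) \<le> 1" if "b \<in> ?P2" for b
    proof -
      have "card (?R \<inter> {c. cf w2 b q c}) \<le> card {c \<in> Lst q. cf w2 b q c}"
        using fin_Lst wV by (intro card_mono) (auto simp: avail_def)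
      also have "\<dots> \<le> 1" using that q by (intro card_conflict_le) (auto simp: avail_def)
      finally show ?thesis .
    qed
    have removed: "card ?R \<le> card (?R - {c. cf w1 b1 q c} - {c. cf w2 b2 q c})
        + card (?R \<inter> {c. cf w1 b1 q c} \<union> ?R \<inter> {c. cf w2 b2 q c})" for b1 b2
    proof -
      have "card ?R \<le> card ((?R - {c. cf w1 b1 q c} - {c. cf w2 b2 q c}) \<union>
        (?R \<inter> {c. cf w1 b1 q c} \<union> ?R \<inter> {c. cf w2 b2 q c}))"
        using finR by (intro card_mono) auto
      also have "\<dots> \<le> card (?R - {c. cf w1 b1 q c} - {c. cf w2 b2 q c})
        + card (?R \<inter> {c. cf w1 b1 q c} \<union> ?R \<inter> {c. cf w2 b2 q c})" by (rule card_Un_le)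
      finally show ?thesis .
    qed
    have ne: "?P1 \<noteq> {}" "?P2 \<noteq> {}" using c1 c2 pos by auto
    \<comment> \<open>Either a spare color exists, or the colors of both vertices inject into the
      \<open>card K + 1\<close> colors of \<open>q\<close>, and the images meet.\<close>
    have cases4: "card K + 2 \<le> card ?R \<or> (\<exists>b\<in>?P1. ?R \<inter> {c. cf w1 b q c} = {})
      \<or> (\<exists>b\<in>?P2. ?R \<inter> {c. cf w2 b q c} = {})
      \<or> (card ?R = card K + 1 \<and> (\<forall>b\<in>?P1. \<exists>c\<in>?R. cf w1 b q c) \<and> (\<forall>b\<in>?P2. \<exists>c\<in>?R. cf w2 b q c))"
    proof (cases "card K + 2 \<le> card ?R")
      case False
      then have "card ?R = card K + 1" using Rge by linarith
      then show ?thesis by blast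
    qed simp
    then consider (a) "card K + 2 \<le> card ?R" | (b) b where "b \<in> ?P1" "?R \<inter> {c. cf w1 b q c} = {}"
      | (c) b where "b \<in> ?P2" "?R \<inter> {c. cf w2 b q c} = {}"
      | (e) "card ?R = card K + 1" "\<forall>b\<in>?P1. \<exists>c\<in>?R. cf w1 b q c" "\<forall>b\<in>?P2. \<exists>c\<in>?R. cf w2 b q c"
      by (elim disjE bexE conjE)
    then show ?thesis
    proof cases
      case a
      obtain b1 b2 where b: "b1 \<in> ?P1" "b2 \<in> ?P2" using ne by blast
      have "card (?R \<inter> {c. cf w1 b1 q c} \<union> ?R \<inter> {c. cf w2 b2 q c}) \<le> 2"
        using n1[OF b(1)] n2[OF b(2)] card_Un_le[of "?R \<inter> {c. cf w1 b1 q c}" "?R \<inter> {c. cf w2 b2 q c}"]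
        by linarith
      then show ?thesis using removed[of b1 b2] a b by (intro bexI) auto
    next
      case b
      obtain b2 where b2: "b2 \<in> ?P2" using ne by blast
      then show ?thesis using removed[of b b2] b n2[OF b2] Rge by (intro bexI[of _ b] bexI[of _ b2]) auto
    next
      case c
      obtain b1 where b1: "b1 \<in> ?P1" using ne by blast
      then show ?thesis using removed[of b1 b] c n1[OF b1] Rge by (intro bexI[of _ b1] bexI[of _ b]) auto
    next
      case e
      then obtain f g where f: "\<And>b. b \<in> ?P1 \<Longrightarrow> f b \<in> ?R \<and> cf w1 b q (f b)"
        and g: "\<And>b. b \<in> ?P2 \<Longrightarrow> g b \<in> ?R \<and> cf w2 b q (g b)" by metis
      have "inj_on f ?P1"
      proof (rule inj_onI)
        fix b b' assume b: "b \<in> ?P1" "b' \<in> ?P1" "f b = f b'"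
        have "cf q (f b) w1 b" "cf q (f b) w1 b'" using cf_sym f b by metis+
        moreover have "b \<in> Lst w1" "b' \<in> Lst w1" "f b \<in> Lst q" using b f by (auto simp: avail_def)
        ultimately show "b = b'" using cf_unique[OF adj_sym[OF q(2)]] by blast
      qed
      moreover have "inj_on g ?P2"
      proof (rule inj_onI)
        fix b b' assume b: "b \<in> ?P2" "b' \<in> ?P2" "g b = g b'"
        have "cf q (g b) w2 b" "cf q (g b) w2 b'" using cf_sym g b by metis+
        moreover have "b \<in> Lst w2" "b' \<in> Lst w2" "g b \<in> Lst q" using b g by (auto simp: avail_def)
        ultimately show "b = b'" using cf_unique[OF adj_sym[OF q(3)]] by blast
      qed
      ultimately have cc: "card (f ` ?P1) = card ?P1" "card (g ` ?P2) = card ?P2"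
        by (simp_all add: card_image)
      have "f ` ?P1 \<inter> g ` ?P2 \<noteq> {}"
      proof
        assume "f ` ?P1 \<inter> g ` ?P2 = {}"
        then have "card ?P1 + card ?P2 = card (f ` ?P1 \<union> g ` ?P2)"
          using cc finR by (subst card_Un_disjoint) auto
        also have "\<dots> \<le> card ?R" using f g finR by (intro card_mono) auto
        finally show False using big c1 c2 e(1) by linarith
      qed
      then obtain b1 b2 where b: "b1 \<in> ?P1" "b2 \<in> ?P2" "f b1 = g b2" by blast
      have "?R \<inter> {c. cf w1 b1 q c} \<union> ?R \<inter> {c. cf w2 b2 q c} \<subseteq> {f b1}"
        using f[OF b(1)] g[OF b(2)] b(3) cf_unique[OF q(2), of b1] cf_unique[OF q(3), of b2] b(1,2)
        unfolding avail_def by auto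
      then have "card (?R \<inter> {c. cf w1 b1 q c} \<union> ?R \<inter> {c. cf w2 b2 q c}) \<le> 1"
        by (metis card_mono finite.emptyI finite_insert is_singletonI is_singleton_altdef)
      then show ?thesis using removed[of b1 b2] e(1) b by (intro bexI[of _ b1] bexI[of _ b2]) auto
    qed
  qed
  then obtain b1 b2 where b: "b1 \<in> ?P1" "b2 \<in> ?P2"
    "card K \<le> card (?R - {c. cf w1 b1 q c} - {c. cf w2 b2 q c})" by blast
  let ?\<phi>1 = "\<phi>(w1 := b1)" let ?\<phi>2 = "?\<phi>1(w2 := b2)"
  have col1: "colors (insert w1 ?A) ?\<phi>1" by (intro colors_insert[OF \<phi>] b) auto
  have b2': "b2 \<in> avail (insert w1 ?A) ?\<phi>1 w2" using b(2) w by (subst avail_insert) auto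
  have "colors (insert w2 (insert w1 ?A)) ?\<phi>2" using w by (intro colors_insert[OF col1] b2') auto
  moreover have eA: "insert w2 (insert w1 ?A) = V - K" using wV w by auto
  ultimately have col2: "colors (V - K) ?\<phi>2" by simp
  have "avail (insert w2 (insert w1 ?A)) ?\<phi>2 q = ?R - {c. cf w1 b1 q c} - {c. cf w2 b2 q c}"
    using w q by (subst avail_insert, force, subst avail_insert) auto
  then have "card K \<le> card (avail (V - K) ?\<phi>2 q)" using b(3) eA by simp
  moreover have "card (avail (V - K) ?\<phi>2 q) = card (nbrs K q)"
    by (intro tight K col2 clique_linked q)
  moreover have "card (nbrs K q) < card K" using clique_nbrs[OF K(2) q(1)] finK q(1)
    by (metis card_Diff1_less)
  ultimately show False by simp
qed

end

section \<open>End pieces of connected low sets\<close>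

context cover begin

text \<open>\<open>C\<close> hangs on the rest of \<open>X\<close> by the vertex \<open>w\<close> alone. The minimal such sets (leaves)
are the end blocks without their cut vertices.\<close>

definition pendant :: "'a set \<Rightarrow> 'a \<Rightarrow> 'a set \<Rightarrow> bool" where
  "pendant X w C \<longleftrightarrow> C \<subseteq> X \<and> C \<noteq> {} \<and> w \<in> X \<and> w \<notin> C \<and> (\<forall>c\<in>C. nbrs X c \<subseteq> insert w C)"

definition leaf :: "'a set \<Rightarrow> 'a \<Rightarrow> 'a set \<Rightarrow> bool" where
  "leaf X w C \<longleftrightarrow> pendant X w C \<and> (\<forall>w' C'. C' \<subset> C \<longrightarrow> \<not> pendant X w' C')"

definition degsum :: "'a set \<Rightarrow> nat" where
  "degsum X = (\<Sum>v\<in>X. card (nbrs X v))"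

lemma mem_nbrs [simp]: "u \<in> nbrs X v \<longleftrightarrow> u \<in> X \<and> adj v u"
  by (simp add: nbrs_def)

lemma nbrsD: "nbrs X c \<subseteq> B \<Longrightarrow> z \<in> X \<Longrightarrow> adj c z \<Longrightarrow> z \<in> B"
  by (auto simp: subset_iff)

lemma card_exchange:
  assumes "finite C" "y \<in> C" "w \<notin> C"
  shows "card (insert w (C - {y})) = card C"
proof -
  have "card (insert w (C - {y})) = Suc (card (C - {y}))" using assms by (intro card_insert_disjoint) auto
  then show ?thesis using card_Suc_Diff1[OF assms(1,2)] by simp
qed

lemma ex_leaf:
  assumes "X \<subseteq> V" "pendant X w C"
  shows "\<exists>w' C'. C' \<subseteq> C \<and> leaf X w' C'"
  using assms(2)
proof (induction "card C" arbitrary: w C rule: less_induct)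
  case less
  show ?case
  proof (cases "leaf X w C")
    case False
    then obtain w' C' where C': "C' \<subset> C" "pendant X w' C'" using less.prems unfolding leaf_def by metis
    have "finite C" using less.prems assms(1) finite_in_V unfolding pendant_def by (metis subset_trans)
    then have "card C' < card C" using C'(1) by (rule psubset_card_mono)
    then show ?thesis using less.hyps C' by (metis psubset_imp_subset subset_trans)
  qed blast
qed

text \<open>A component of \<open>X - {u}\<close> that avoids \<open>w\<close> would lie inside \<open>C\<close> and hang on \<open>u\<close>, against the
minimality of \<open>C\<close>.\<close>

lemma leaf_noncut:
  assumes "linked X" "leaf X w C" "u \<in> C"
  shows "linked (X - {u})"
proof (rule linkedI, rule ccontr)
  fix Y assume Y: "Y \<subseteq> X - {u}" "Y \<noteq> {}" "Y \<noteq> X - {u}"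
    and no: "\<not> (\<exists>y\<in>Y. \<exists>z\<in>X - {u} - Y. adj y z)"
  have C: "C \<subseteq> X" "w \<in> X" "w \<notin> C" "\<And>c. c \<in> C \<Longrightarrow> nbrs X c \<subseteq> insert w C"
    using assms(2) unfolding leaf_def pendant_def by auto
  define Z where "Z = (if w \<in> Y then X - {u} - Y else Y)"
  have Z: "Z \<subseteq> X - {u}" "Z \<noteq> {}" "w \<notin> Z" using Y unfolding Z_def by auto
  have noZ: "z \<in> Z" if "y \<in> Z" "z \<in> X - {u}" "adj y z" for y z
  proof (cases "w \<in> Y")
    case True
    have "z \<notin> Y" using no that adj_sym True unfolding Z_def by (metis DiffI DiffD1 DiffD2)
    then show ?thesis using that True unfolding Z_def by auto
  next
    case False
    then show ?thesis using no that unfolding Z_def by auto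
  qed
  have ZC: "Z \<subseteq> C"
  proof (rule ccontr)
    assume "\<not> Z \<subseteq> C"
    then have "Z - C \<noteq> {}" by auto
    moreover have "Z - C \<subseteq> X" "Z - C \<noteq> X" using Z C by auto
    ultimately obtain y z where yz: "y \<in> Z - C" "z \<in> X - (Z - C)" "adj y z"
      using linkedD[OF assms(1)] by metis
    show False
    proof (cases "z \<in> C")
      case True
      then have "y \<in> insert w C" using nbrsD[OF C(4)[OF True], of y] yz Z(1) adj_sym by auto
      then show False using yz Z by auto
    next
      case False
      then have "z \<in> X - {u}" using yz assms(3) by auto
      then show False using noZ[of y z] yz False by auto
    qed
  qed
  have "pendant X u Z"
    unfolding pendant_def using Z ZC C assms(3) noZ by auto
  moreover have "Z \<subset> C" using ZC Z assms(3) by auto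
  ultimately show False using assms(2) unfolding leaf_def by metis
qed

lemma leaf_linked:
  assumes "leaf X w C"
  shows "linked C"
proof (rule linkedI, rule ccontr)
  fix Y assume Y: "Y \<subseteq> C" "Y \<noteq> {}" "Y \<noteq> C" and no: "\<not> (\<exists>y\<in>Y. \<exists>z\<in>C - Y. adj y z)"
  have C: "C \<subseteq> X" "w \<in> X" "w \<notin> C" "\<And>c. c \<in> C \<Longrightarrow> nbrs X c \<subseteq> insert w C"
    using assms unfolding leaf_def pendant_def by auto
  have "nbrs X c \<subseteq> insert w Y" if c: "c \<in> Y" for c
  proof
    fix z assume z: "z \<in> nbrs X c"
    then have "z \<in> insert w C" using C(4)[of c] c Y(1) by blast
    then show "z \<in> insert w Y" using no c z by auto
  qed
  then have "pendant X w Y" unfolding pendant_def using Y C by auto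
  moreover have "Y \<subset> C" using Y by auto
  ultimately show False using assms unfolding leaf_def by metis
qed

lemma pendant_attached:
  assumes "linked X" "pendant X w C"
  shows "\<exists>u\<in>C. adj u w"
proof -
  have C: "C \<subseteq> X" "C \<noteq> {}" "w \<in> X" "w \<notin> C" "\<And>c. c \<in> C \<Longrightarrow> nbrs X c \<subseteq> insert w C"
    using assms unfolding pendant_def by auto
  then have "C \<noteq> X" by auto
  then obtain y z where yz: "y \<in> C" "z \<in> X - C" "adj y z" using linkedD[OF assms(1) C(1,2)] by metis
  then have "z \<in> nbrs X y" by simp
  then have "z = w" using C(5)[OF yz(1)] yz by auto
  then show ?thesis using yz by auto
qed

lemma sum_nbrs_swap:
  assumes "finite A" "finite B"
  shows "(\<Sum>a\<in>A. card (nbrs B a)) = (\<Sum>b\<in>B. card (nbrs A b))"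
proof -
  have e: "card (nbrs Y v) = (\<Sum>u\<in>Y. if adj v u then 1 else 0)" if "finite Y" for Y v
    using that by (simp add: nbrs_def sum.If_cases Int_def)
  have "(\<Sum>a\<in>A. card (nbrs B a)) = (\<Sum>a\<in>A. \<Sum>b\<in>B. if adj a b then 1 else 0)" using e assms by simp
  also have "\<dots> = (\<Sum>b\<in>B. \<Sum>a\<in>A. if adj a b then 1 else 0)" by (rule sum.swap)
  also have "\<dots> = (\<Sum>b\<in>B. \<Sum>a\<in>A. if adj b a then 1 else 0)"
    using adj_sym by (intro sum.cong refl) (metis (full_types))
  finally show ?thesis using e assms by simp
qed

lemma degsum_split:
  assumes "C \<subseteq> X" "X \<subseteq> V"
  shows "degsum X = degsum (X - C) + (\<Sum>c\<in>C. card (nbrs X c)) + (\<Sum>c\<in>C. card (nbrs (X - C) c))"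
proof -
  have fin: "finite X" "finite C" using assms finite_in_V by auto
  have "degsum X = (\<Sum>v\<in>X - C. card (nbrs X v)) + (\<Sum>c\<in>C. card (nbrs X c))"
    unfolding degsum_def using fin(1) assms(1) by (simp add: sum.subset_diff)
  also have "(\<Sum>v\<in>X - C. card (nbrs X v)) = (\<Sum>v\<in>X - C. card (nbrs (X - C) v) + card (nbrs C v))"
    using card_nbrs_split[OF assms(1)] by (intro sum.cong) auto
  also have "\<dots> = degsum (X - C) + (\<Sum>v\<in>X - C. card (nbrs C v))"
    by (simp add: sum.distrib degsum_def)
  also have "(\<Sum>v\<in>X - C. card (nbrs C v)) = (\<Sum>c\<in>C. card (nbrs (X - C) c))"
    using fin by (intro sum_nbrs_swap) auto
  finally show ?thesis by simp
qed

lemma pendant_cross: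
  assumes "pendant X w C" "X \<subseteq> V"
  shows "(\<Sum>c\<in>C. card (nbrs (X - C) c)) = card (nbrs C w)"
proof -
  have C: "C \<subseteq> X" "w \<in> X" "w \<notin> C" "\<And>c. c \<in> C \<Longrightarrow> nbrs X c \<subseteq> insert w C"
    using assms unfolding pendant_def by auto
  have "nbrs (X - C) c = nbrs {w} c" if "c \<in> C" for c
  proof
    show "nbrs (X - C) c \<subseteq> nbrs {w} c" using C(4)[OF that] by auto
    show "nbrs {w} c \<subseteq> nbrs (X - C) c" using C by auto
  qed
  then have "(\<Sum>c\<in>C. card (nbrs (X - C) c)) = (\<Sum>c\<in>C. card (nbrs {w} c))" by simp
  also have "\<dots> = (\<Sum>v\<in>{w}. card (nbrs C v))"
    using C(1) assms(2) finite_in_V by (intro sum_nbrs_swap) auto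
  finally show ?thesis by simp
qed

text \<open>Remove noncut vertices one at a time; each of them has a neighbor among those that remain.\<close>

lemma linked_degsum:
  assumes "X \<subseteq> V" "linked X" "X \<noteq> {}"
  shows "2 * card X \<le> degsum X + 2"
  using assms
proof (induction "card X" arbitrary: X rule: less_induct)
  case less
  have finX: "finite X" using less.prems finite_in_V by auto
  obtain w where w: "w \<in> X" using less.prems by auto
  show ?case
  proof (cases "X = {w}")
    case False
    then have "pendant X w (X - {w})" using w by (auto simp: pendant_def)
    then obtain w' C where lf: "leaf X w' C" using ex_leaf[OF less.prems(1)] by metis
    then have C: "C \<subseteq> X" "C \<noteq> {}" "w' \<in> X" "w' \<notin> C" unfolding leaf_def pendant_def by auto
    then obtain u where u: "u \<in> C" by auto
    have uX: "u \<in> X" and ne: "X - {u} \<noteq> {}" using u C by auto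
    have "linked (X - {u})" by (rule leaf_noncut[OF less.prems(2) lf u])
    moreover have "card (X - {u}) < card X" using uX finX by (metis card_Diff1_less)
    ultimately have IH: "2 * card (X - {u}) \<le> degsum (X - {u}) + 2"
      using less.hyps[of "X - {u}"] less.prems(1) ne by auto
    have "\<exists>z\<in>X - {u}. adj u z" using linkedD[OF less.prems(2), of "{u}"] uX ne by auto
    then have "nbrs X u \<noteq> {}" by auto
    then have "card (nbrs X u) \<ge> 1" by (simp add: Suc_le_eq card_gt_0_iff)
    moreover have "nbrs (X - {u}) u = nbrs X u" using adj_irrefl by (auto simp: nbrs_def)
    ultimately have "degsum X \<ge> degsum (X - {u}) + 2"
      using degsum_split[of "{u}" X] uX less.prems(1) by simp
    moreover have "card X = Suc (card (X - {u}))" using uX finX by (metis card_Suc_Diff1)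
    ultimately show ?thesis using IH by linarith
  qed simp
qed

end

context critical_cover begin

text \<open>Adjacent noncut vertices have equal degrees by \<open>noncut_degree_le\<close>, and \<open>C\<close> is connected.\<close>

lemma leaf_regular:
  assumes X: "X \<subseteq> Low" "linked X" and lf: "leaf X w C" and c: "c \<in> C" "c' \<in> C"
  shows "card (nbrs X c) = card (nbrs X c')"
proof -
  have CX: "C \<subseteq> X" using lf unfolding leaf_def pendant_def by auto
  let ?Y = "{y \<in> C. card (nbrs X y) = card (nbrs X c)}"
  have "?Y = C"
  proof (rule ccontr)
    assume "?Y \<noteq> C"
    then obtain y z where yz: "y \<in> ?Y" "z \<in> C - ?Y" "adj y z"
      using linkedD[OF leaf_linked[OF lf], of ?Y] c(1) by auto
    have yC: "y \<in> C" and zC: "z \<in> C" using yz by auto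
    have "card (nbrs X y) \<le> card (nbrs X z)"
      by (rule noncut_degree_le[OF X _ leaf_noncut[OF X(2) lf yC]]) (use yC zC CX yz in auto)
    moreover have "card (nbrs X z) \<le> card (nbrs X y)"
      by (rule noncut_degree_le[OF X _ leaf_noncut[OF X(2) lf zC]]) (use yC zC CX adj_sym[OF yz(3)] in auto)
    ultimately show False using yz by auto
  qed
  then have "c' \<in> ?Y" using c(2) by simp
  then show ?thesis by simp
qed

text \<open>Remove a vertex \<open>u\<close> of \<open>C\<close> adjacent to \<open>w\<close> and take a leaf \<open>C1\<close> of the rest inside \<open>C\<close>. By
minimality of \<open>C\<close> it meets the neighborhood of \<open>u\<close>; by regularity of \<open>C\<close> and of \<open>C1\<close> all of
\<open>C1\<close> is adjacent to \<open>u\<close>. Counting degrees makes \<open>C1\<close> together with its attaching vertex \<open>w1\<close> a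
clique. If \<open>w1 = w\<close>, then \<open>C\<close> is \<open>C1\<close> with \<open>u\<close>; otherwise \<open>u\<close> and \<open>w1\<close> are nonadjacent and
complete to \<open>C1\<close>, which \<open>two_nonadjacent\<close> forbids.\<close>

lemma leaf_clique:
  assumes X: "X \<subseteq> Low" "linked X" and lf: "leaf X w C" and c: "c \<in> C" "card (nbrs X c) \<ge> 3"
  shows "clique (insert w C)"
proof -
  have XV: "X \<subseteq> V" using X Low_V by auto
  have pe: "pendant X w C" using lf by (simp add: leaf_def)
  then have C: "C \<subseteq> X" "w \<in> X" "w \<notin> C" "\<And>c. c \<in> C \<Longrightarrow> nbrs X c \<subseteq> insert w C"
    unfolding pendant_def by auto
  obtain u where u: "u \<in> C" "adj u w" using pendant_attached[OF X(2) pe] by auto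
  define s where "s = card (nbrs X u)"
  have sC: "card (nbrs X y) = s" if "y \<in> C" for y
    unfolding s_def by (rule leaf_regular[OF X lf that u(1)])
  have s3: "s \<ge> 3" using sC[OF c(1)] c(2) by simp
  have uX: "u \<in> X" using u C by auto
  have "C - {u} \<noteq> {}"
  proof
    assume "C - {u} = {}"
    then have "nbrs X u \<subseteq> {w}" using C(4)[OF u(1)] adj_irrefl by auto
    then have "s \<le> 1" unfolding s_def using card_mono[of "{w}" "nbrs X u"] by simp
    then show False using s3 by simp
  qed
  moreover have "nbrs (X - {u}) y \<subseteq> insert w (C - {u})" if "y \<in> C" for y
  proof
    fix z assume "z \<in> nbrs (X - {u}) y"
    then show "z \<in> insert w (C - {u})" using nbrsD[OF C(4)[OF that], of z] by auto
  qed
  ultimately have "pendant (X - {u}) w (C - {u})"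
    unfolding pendant_def using C u by auto
  then obtain w1 C1 where C1: "C1 \<subseteq> C - {u}" "leaf (X - {u}) w1 C1"
    using ex_leaf[of "X - {u}"] XV by (metis Diff_subset subset_trans)
  then have C1p: "C1 \<noteq> {}" "w1 \<in> X" "w1 \<noteq> u" "w1 \<notin> C1" "\<And>c. c \<in> C1 \<Longrightarrow> nbrs (X - {u}) c \<subseteq> insert w1 C1"
    unfolding leaf_def pendant_def by auto
  have X': "X - {u} \<subseteq> Low" "linked (X - {u})" using X leaf_noncut[OF X(2) lf u(1)] by auto
  have dec: "nbrs (X - {u}) y = nbrs X y - {u}" for y by auto
  obtain c0 where c0: "c0 \<in> C1" "adj c0 u"
  proof -
    have "C1 \<subset> C" using C1(1) u(1) by auto
    then have "\<not> pendant X w1 C1" using lf by (simp add: leaf_def)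
    moreover have "C1 \<subseteq> X" using C1(1) C(1) by blast
    ultimately obtain y where y: "y \<in> C1" "\<not> nbrs X y \<subseteq> insert w1 C1"
      unfolding pendant_def using C1p(1,2,4) by blast
    then obtain z where "z \<in> nbrs X y" "z \<notin> insert w1 C1" by blast
    then have "z \<in> nbrs X y - nbrs (X - {u}) y" using C1p(5)[OF y(1)] by blast
    then have "adj y u" by auto
    then show thesis using that y(1) by blast
  qed
  have "card (nbrs (X - {u}) c0) = s - 1"
  proof -
    have "u \<in> nbrs X c0" using c0(2) uX by simp
    then have "card (nbrs X c0 - {u}) = card (nbrs X c0) - 1" by (simp add: card_Diff_singleton)
    moreover have "card (nbrs X c0) = s" using sC c0(1) C1(1) by auto
    ultimately show ?thesis using dec by simp
  qed
  then have degC1: "card (nbrs (X - {u}) y) = s - 1" if "y \<in> C1" for y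
    using leaf_regular[OF X' C1(2) that c0(1)] by simp
  have adju: "adj y u" if y: "y \<in> C1" for y
  proof (rule ccontr)
    assume "\<not> adj y u"
    then have "nbrs (X - {u}) y = nbrs X y" by auto
    then have "s = s - 1" using degC1[OF y] sC[of y] y C1(1) by auto
    then show False using s3 by simp
  qed
  have finC1: "finite C1" using C1(1) C(1) XV finite_in_V by (metis Diff_subset subset_trans)
  have "adj u y" if "y \<in> C1" for y using adju[OF that] by (rule adj_sym)
  then have sub: "insert w C1 \<subseteq> nbrs X u" using u(2) C1(1) C(1,2) by auto
  have wC1: "w \<notin> C1" using C1(1) C(3) by auto
  have "card (insert w C1) \<le> s" unfolding s_def using sub by (intro card_mono) auto
  then have le: "card C1 + 1 \<le> s" using finC1 wC1 by simp
  have subC1: "nbrs (X - {u}) y \<subseteq> insert w1 (C1 - {y})" if "y \<in> C1" for y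
    using C1p(5)[OF that] adj_irrefl by auto
  have cardC1: "card (insert w1 (C1 - {y})) = card C1" if "y \<in> C1" for y
    using card_exchange[OF finC1 that C1p(4)] .
  have ge: "s - 1 \<le> card C1"
    using card_mono[OF _ subC1[OF c0(1)]] cardC1[OF c0(1)] degC1[OF c0(1)] finC1 by simp
  have eq: "card C1 = s - 1" using le ge by linarith
  have nbu: "nbrs X u = insert w C1"
    using sub wC1 finC1 eq s3 by (intro card_subset_eq[symmetric]) (auto simp: s_def)
  have nbC1: "nbrs (X - {u}) y = insert w1 (C1 - {y})" if "y \<in> C1" for y
    using subC1[OF that] cardC1[OF that] degC1[OF that] eq finC1 by (intro card_subset_eq) auto
  have adjC1: "adj y z" if "y \<in> C1" "z \<in> C1" "y \<noteq> z" for y z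
  proof -
    have "z \<in> nbrs (X - {u}) y" using nbC1[OF that(1)] that by auto
    then show ?thesis by simp
  qed
  have adjw1: "adj y w1" if "y \<in> C1" for y
  proof -
    have "w1 \<in> nbrs (X - {u}) y" using nbC1[OF that(1)] that by auto
    then show ?thesis by simp
  qed
  have C1V: "C1 \<subseteq> V" "C1 \<subseteq> Low" using C1(1) C(1) XV X by auto
  show ?thesis
  proof (cases "w1 = w")
    case True
    have "pendant X w (insert u C1)"
      unfolding pendant_def
    proof (intro conjI ballI)
      show "w \<notin> insert u C1" using wC1 u C by auto
      fix y assume "y \<in> insert u C1"
      then show "nbrs X y \<subseteq> insert w (insert u C1)" using nbu C1p(5)[of y] dec[of y] True by auto
    qed (use uX C1 C in auto)
    moreover have "insert u C1 \<subseteq> C" using C1 u by auto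
    ultimately have Ceq: "C = insert u C1" using lf unfolding leaf_def by (metis psubsetI)
    show ?thesis
      unfolding clique_def
    proof (intro conjI ballI impI)
      show "insert w C \<subseteq> V" using C XV by auto
      fix y z assume "y \<in> insert w C" "z \<in> insert w C" "y \<noteq> z"
      then show "adj y z" using Ceq u(2) adjC1 adjw1 True adju adj_sym
        by (metis insertE)
    qed
  next
    case False
    have clC1: "clique C1" unfolding clique_def using C1V adjC1 by auto
    have "w1 \<notin> nbrs X u" using nbu False C1p(4) by auto
    then have nadj: "\<not> adj u w1" using C1p(2) by simp
    have "adj u y \<and> adj w1 y" if "y \<in> C1" for y using adj_sym[OF adju[OF that]] adj_sym[OF adjw1[OF that]] by simp
    then have e1: "nbrs C1 u = C1" "nbrs C1 w1 = C1" by auto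
    have x0: "excess u = 0" "excess w1 = 0" using X uX C1p(2) excess_low by auto
    have c1: "0 < card C1" using eq s3 by simp
    have "card (nbrs C1 u) + card (nbrs C1 w1) \<le> card C1 + 1 + excess u + excess w1"
    proof (rule two_nonadjacent[OF C1V(2) clC1 c0(1) _ _ _ C1p(4) _ nadj])
      show "adj u c0" "adj w1 c0" using adj_sym[OF c0(2)] adj_sym[OF adjw1[OF c0(1)]] by auto
      show "u \<notin> C1" "u \<noteq> w1" using C1 C1p by auto
    qed (use e1 x0 c1 in auto)
    then show ?thesis using e1 x0 eq s3 by simp
  qed
qed

text \<open>The part of Gallai's theorem on low vertices that the edge counts need. The third case stands for
an end block that is a long cycle.\<close>

lemma low_piece:
  assumes "X \<subseteq> Low" "X \<noteq> {}"
  shows "(\<exists>v\<in>X. nbrs X v = {}) \<or> (\<exists>w C. pendant X w C \<and> clique (insert w C)) \<or>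
    (\<exists>w C. pendant X w C \<and> 3 \<le> card C \<and> (\<forall>c\<in>C. card (nbrs X c) = 2) \<and> card (nbrs C w) \<le> 2)"
proof -
  have XV: "X \<subseteq> V" using assms Low_V by auto
  define closed where "closed Z \<longleftrightarrow> Z \<subseteq> X \<and> Z \<noteq> {} \<and> (\<forall>y\<in>Z. nbrs X y \<subseteq> Z)" for Z
  have "closed X" using assms by (auto simp: closed_def)
  then obtain Z where Z: "closed Z" "\<And>Z'. closed Z' \<Longrightarrow> card Z \<le> card Z'"
    using ex_has_least_nat[of closed X card] by auto
  then have ZX: "Z \<subseteq> X" "Z \<noteq> {}" and cl: "\<And>y. y \<in> Z \<Longrightarrow> nbrs X y \<subseteq> Z" unfolding closed_def by auto
  have ZX: "Z \<subseteq> X" "Z \<noteq> {}" "\<And>y. y \<in> Z \<Longrightarrow> nbrs X y = nbrs Z y" using ZX nbrsD[OF cl] by auto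
  have ZV: "Z \<subseteq> V" and ZLo: "Z \<subseteq> Low" using ZX XV assms by auto
  have finZ: "finite Z" using ZV finite_in_V by auto
  have connZ: "linked Z"
  proof (rule linkedI, rule ccontr)
    fix Y assume Y: "Y \<subseteq> Z" "Y \<noteq> {}" "Y \<noteq> Z" and no: "\<not> (\<exists>y\<in>Y. \<exists>z\<in>Z - Y. adj y z)"
    have "nbrs X y \<subseteq> Y" if y: "y \<in> Y" for y
    proof
      fix z assume "z \<in> nbrs X y"
      then have "z \<in> nbrs Z y" using ZX(3)[of y] y Y(1) by blast
      then show "z \<in> Y" using no y by auto
    qed
    then have "closed Y" unfolding closed_def using Y ZX by auto
    moreover have "card Y < card Z" using Y finZ by (intro psubset_card_mono) auto
    ultimately show False using Z(2) by (metis not_le)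
  qed
  have lift: "pendant X w C" if "pendant Z w C" for w C
    using that ZX unfolding pendant_def by (metis subset_iff)
  obtain w0 where w0: "w0 \<in> Z" using ZX by auto
  show ?thesis
  proof (cases "Z = {w0}")
    case True
    then have "nbrs X w0 = {}" using ZX(3)[OF w0] adj_irrefl by auto
    moreover have "w0 \<in> X" using w0 ZX(1) by blast
    ultimately show ?thesis by blast
  next
    case False
    then have "pendant Z w0 (Z - {w0})" using w0 by (auto simp: pendant_def)
    then obtain w C where lf: "leaf Z w C" using ex_leaf[OF ZV] by metis
    then have pe: "pendant Z w C" by (simp add: leaf_def)
    then have C: "C \<subseteq> Z" "C \<noteq> {}" "w \<in> Z" "w \<notin> C" "\<And>c. c \<in> C \<Longrightarrow> nbrs Z c \<subseteq> insert w C"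
      unfolding pendant_def by auto
    have finC: "finite C" using C(1) finZ finite_subset by auto
    obtain u where u: "u \<in> C" "adj u w" using pendant_attached[OF connZ pe] by auto
    define s where "s = card (nbrs Z u)"
    have sC: "card (nbrs Z y) = s" if "y \<in> C" for y
      unfolding s_def by (rule leaf_regular[OF ZLo connZ lf that u(1)])
    have wnb: "w \<in> nbrs Z u" using u C by auto
    then have "s \<ge> 1" unfolding s_def by (metis One_nat_def Suc_leI card_gt_0_iff empty_iff finite_nbrs)
    then consider "s \<ge> 3" | "s = 1" | "s = 2" by linarith
    then show ?thesis
    proof cases
      case 1
      then have "clique (insert w C)" using leaf_clique[OF ZLo connZ lf u(1)] by (simp add: s_def)
      then show ?thesis using lift[OF pe] by blast
    next
      case 2
      then have nbu: "nbrs Z u = {w}" using wnb unfolding s_def by (metis card_1_singletonE singletonD)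
      have "pendant Z w {u}" unfolding pendant_def using u C nbu by auto
      moreover have "clique (insert w {u})"
        unfolding clique_def using u(1) adj_sym[OF u(2)] u(2) C(1,3) ZV by auto
      ultimately show ?thesis using lift by metis
    next
      case 3
      have nbsub: "nbrs Z c \<subseteq> insert w (C - {c})" if "c \<in> C" for c
        using C(5)[OF that] adj_irrefl by auto
      have cardins: "card (insert w (C - {c})) = card C" if "c \<in> C" for c
        using card_exchange[OF finC that C(4)] .
      show ?thesis
      proof (cases "3 \<le> card C")
        case True
        have split: "card (nbrs Z c) = card (nbrs C c) + card (nbrs (Z - C) c)" for c
          by (rule card_nbrs_split[OF C(1)])
        have "(\<Sum>c\<in>C. card (nbrs Z c)) = degsum C + card (nbrs C w)"
          using pendant_cross[OF pe ZV] by (simp add: split sum.distrib degsum_def)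
        moreover have "(\<Sum>c\<in>C. card (nbrs Z c)) = 2 * card C" using sC 3 by simp
        moreover have "2 * card C \<le> degsum C + 2"
          by (rule linked_degsum[OF _ leaf_linked[OF lf] C(2)]) (use C ZV in auto)
        ultimately have "card (nbrs C w) \<le> 2" by linarith
        moreover have "card (nbrs X c) = 2" if "c \<in> C" for c using sC[OF that] 3 ZX(3) C(1) that by auto
        ultimately have "pendant X w C \<and> 3 \<le> card C \<and> (\<forall>c\<in>C. card (nbrs X c) = 2) \<and> card (nbrs C w) \<le> 2"
          using lift[OF pe] True by simp
        then show ?thesis by blast
      next
        case False
        have "card (nbrs Z c) \<le> card C" if "c \<in> C" for c
          using card_mono[OF _ nbsub[OF that]] cardins[OF that] finC by simp
        then have c2: "card C = 2" using sC[OF u(1)] 3 u(1) False by fastforce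
        have nbeq: "nbrs Z c = insert w (C - {c})" if "c \<in> C" for c
          using nbsub[OF that] cardins[OF that] sC[OF that] 3 c2 finC by (intro card_subset_eq) auto
        have "clique (insert w C)"
          unfolding clique_def
        proof (intro conjI ballI impI)
          show "insert w C \<subseteq> V" using C ZV by auto
          fix y z assume yz: "y \<in> insert w C" "z \<in> insert w C" "y \<noteq> z"
          then have "y \<in> C \<or> z \<in> C" by auto
          moreover have "z \<in> nbrs Z y" if "y \<in> C" using nbeq[OF that] yz by auto
          moreover have "y \<in> nbrs Z z" if "z \<in> C" using nbeq[OF that] yz by auto
          ultimately show "adj y z" using adj_sym[of z y] by auto
        qed
        then show ?thesis using lift[OF pe] by blast
      qed
    qed
  qed
qed

end

section \<open>Counting edges among low vertices\<close>

context critical_cover begin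

lemma cliqueD: "clique K \<Longrightarrow> u \<in> K \<Longrightarrow> v \<in> K \<Longrightarrow> u \<noteq> v \<Longrightarrow> adj u v"
  unfolding clique_def by simp

lemma pendant_clique_deg:
  assumes "pendant X w C" "clique (insert w C)" "X \<subseteq> V" "c \<in> C"
  shows "card (nbrs X c) = card C"
proof -
  have C: "C \<subseteq> X" "w \<in> X" "w \<notin> C" "nbrs X c \<subseteq> insert w C"
    using assms(1,4) unfolding pendant_def by auto
  have fin: "finite C" using C(1) assms(3) finite_in_V by (metis subset_trans)
  have "nbrs X c = insert w (C - {c})"
  proof
    show "nbrs X c \<subseteq> insert w (C - {c})" using C(4) adj_irrefl by (auto simp: subset_iff)
    show "insert w (C - {c}) \<subseteq> nbrs X c"
    proof
      fix z assume "z \<in> insert w (C - {c})"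
      then have "z \<in> X" "z \<in> insert w C" "z \<noteq> c" using C(1-3) assms(4) by auto
      then show "z \<in> nbrs X c" using cliqueD[OF assms(2), of c z] assms(4) by simp
    qed
  qed
  then show ?thesis using card_exchange[OF fin assms(4) C(3)] by simp
qed

lemma degsum_remove_leaf:
  assumes "pendant X w C" "clique (insert w C)" "X \<subseteq> V"
  shows "degsum X = degsum (X - C) + card C * card C + card C"
proof -
  have C: "C \<subseteq> X" "w \<in> X" "w \<notin> C" using assms(1) unfolding pendant_def by auto
  have "nbrs C w = C" using assms(2) C unfolding clique_def by auto
  moreover have "(\<Sum>c\<in>C. card (nbrs X c)) = (\<Sum>c\<in>C. card C)"
    using pendant_clique_deg[OF assms] by (intro sum.cong) auto
  ultimately show ?thesis
    using degsum_split[OF C(1) assms(3)] pendant_cross[OF assms(1,3)] by simp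
qed

text \<open>Removing the attaching vertex too is better for large cliques: it has at most \<open>d - card C\<close> further
neighbors, because it is low.\<close>

lemma degsum_remove_clique:
  assumes pe: "pendant X w C" and cl: "clique (insert w C)" and X: "X \<subseteq> Low"
  shows "degsum X \<le> degsum (X - insert w C) + card C * card C + card C + 2 * (d - card C)"
proof -
  have XV: "X \<subseteq> V" using X Low_V by auto
  let ?B = "insert w C"
  have C: "C \<subseteq> X" "w \<in> X" "w \<notin> C" "\<And>c. c \<in> C \<Longrightarrow> nbrs X c \<subseteq> insert w C"
    using pe unfolding pendant_def by auto
  have fin: "finite C" using C(1) XV finite_in_V by (metis subset_trans)
  have BX: "?B \<subseteq> X" using C by auto
  have e0: "card (nbrs (X - ?B) c) = 0" if "c \<in> C" for c
  proof -
    have "nbrs (X - ?B) c \<subseteq> nbrs X c - ?B" by auto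
    then have "nbrs (X - ?B) c = {}" using C(4)[OF that] by blast
    then show ?thesis by simp
  qed
  have sC: "(\<Sum>c\<in>C. card (nbrs X c)) = card C * card C"
    using pendant_clique_deg[OF pe cl XV] by simp
  have degw: "card (nbrs X w) \<le> d"
    using card_nbrs_mono[OF XV, of w] C(2) X by (auto simp: Low_def)
  have "nbrs ?B w = C" using cl C adj_irrefl unfolding clique_def by auto
  then have "card (nbrs X w) = card C + card (nbrs (X - ?B) w)"
    using card_nbrs_split[OF BX, of w] by simp
  then show ?thesis
    using degsum_split[OF BX XV] fin C(3) sC e0 degw by simp
qed

text \<open>Gallai's bound: the average degree inside the low set is at most \<open>d - 1 + 2/d\<close>. The extremal
pieces are copies of \<open>K\<^sub>d\<close>, whose last vertex has one more low neighbor.\<close>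

lemma low_degsum:
  assumes d3: "3 \<le> d"
  shows "X \<subseteq> Low \<Longrightarrow> d * degsum X + d * card X \<le> (d * d + 2) * card X"
proof (induction "card X" arbitrary: X rule: less_induct)
  case less
  have XV: "X \<subseteq> V" using less.prems Low_V by auto
  have finX: "finite X" using XV finite_in_V by auto
  have step: ?case if C: "C \<subseteq> X" "C \<noteq> {}" "degsum X \<le> degsum (X - C) + k" "d * k + d * card C \<le> (d * d + 2) * card C" for C k
  proof -
    have finC: "finite C" using C(1) finX finite_subset by auto
    have cX: "card X = card (X - C) + card C"
      using card_Diff_subset[OF finC C(1)] card_mono[OF finX C(1)] by simp
    have "card C > 0" using C(2) finC by (simp add: card_gt_0_iff)
    then have "card (X - C) < card X" using cX by simp
    then have IH: "d * degsum (X - C) + d * card (X - C) \<le> (d * d + 2) * card (X - C)"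
      using less.hyps[of "X - C"] less.prems by auto
    have "d * degsum X \<le> d * degsum (X - C) + d * k"
      using mult_le_mono2[OF C(3), of d] by (simp add: algebra_simps)
    moreover have "d * card X = d * card (X - C) + d * card C"
      "(d * d + 2) * card X = (d * d + 2) * card (X - C) + (d * d + 2) * card C"
      unfolding cX by (simp_all add: algebra_simps)
    ultimately show ?thesis using IH C(4) by linarith
  qed
  show ?case
  proof (cases "X = {}")
    case True
    then show ?thesis by (simp add: degsum_def)
  next
    case False
    from low_piece[OF less.prems False] show ?thesis
    proof (elim disjE exE conjE bexE)
      fix v assume v: "v \<in> X" "nbrs X v = {}"
      have "nbrs (X - {v}) v = {}" using v(2) by auto
      then have "degsum X \<le> degsum (X - {v}) + 0" using degsum_split[of "{v}" X] v XV by simp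
      moreover have "d * 0 + d * card {v} \<le> (d * d + 2) * card {v}"
        by simp (use le_square[of d] in linarith)
      ultimately show ?thesis using step[of "{v}" 0] v(1) by blast
    next
      fix w C assume pe: "pendant X w C" and cl: "clique (insert w C)"
      have C: "C \<subseteq> X" "w \<in> X" "w \<notin> C" "C \<noteq> {}" using pe unfolding pendant_def by auto
      have fin: "finite C" using C(1) finX finite_subset by auto
      define s where "s = card C"
      have "card (insert w C) \<le> d" using clique_bound[OF cl] .
      then have sd: "s + 1 \<le> d" using fin C(3) by (simp add: s_def)
      show ?thesis
      proof (cases "s + 2 \<le> d")
        case True
        have "degsum X \<le> degsum (X - C) + (s * s + s)"
          using degsum_remove_leaf[OF pe cl XV] by (simp add: s_def)
        moreover have "d * (s * s + s) + d * s \<le> (d * d + 2) * s"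
        proof -
          have "d * (s + 2) \<le> d * d" using True by (rule mult_le_mono2)
          then have "d * (s + 2) * s \<le> (d * d + 2) * s" by (intro mult_le_mono1) simp
          then show ?thesis by (simp add: algebra_simps)
        qed
        ultimately show ?thesis using step[OF C(1,4)] by (simp add: s_def)
      next
        case False
        then have ds: "d = s + 1" using sd by simp
        have B: "insert w C \<subseteq> X" "insert w C \<noteq> {}" using C by auto
        have cB: "card (insert w C) = d" using fin C(3) ds by (simp add: s_def)
        have "degsum X \<le> degsum (X - insert w C) + (s * s + s + 2)"
          using degsum_remove_clique[OF pe cl less.prems] ds by (simp add: s_def)
        moreover have "d * (s * s + s + 2) + d * card (insert w C) \<le> (d * d + 2) * card (insert w C)"
          unfolding cB unfolding ds by (simp add: algebra_simps)
        ultimately show ?thesis using step[OF B] by blast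
      qed
    next
      fix w C assume pe: "pendant X w C" and C3: "3 \<le> card C" and deg: "\<forall>c\<in>C. card (nbrs X c) = 2"
        and cw: "card (nbrs C w) \<le> 2"
      have C: "C \<subseteq> X" "C \<noteq> {}" using pe unfolding pendant_def by auto
      have "degsum X \<le> degsum (X - C) + (2 * card C + 2)"
        using degsum_split[OF C(1) XV] pendant_cross[OF pe XV] deg cw by simp
      moreover have "d * (2 * card C + 2) + d * card C \<le> (d * d + 2) * card C"
      proof -
        obtain e where e: "d = e + 3" using d3 by (metis add.commute le_Suc_ex)
        have "3 * (d * (2 * card C + 2) + d * card C) \<le> d * (11 * card C)"
          using mult_le_mono2[of "6 * card C + 6 + 3 * card C" "11 * card C" d] C3
          by (simp add: algebra_simps)
        also have "\<dots> = (11 * d) * card C" by simp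
        also have "\<dots> \<le> (3 * (d * d + 2)) * card C"
          by (intro mult_le_mono1) (simp add: e algebra_simps)
        finally have "3 * (d * (2 * card C + 2) + d * card C) \<le> 3 * ((d * d + 2) * card C)"
          by (simp only: mult.assoc)
        then show ?thesis by (rule mult_left_le_imp_le) simp
      qed
      ultimately show ?thesis using step[OF C] by blast
    qed
  qed
qed

definition outer :: "'a set \<Rightarrow> 'a set \<Rightarrow> 'a set" where
  "outer X Q = {q \<in> Q. \<not> nbrs X q \<subseteq> Q}"

text \<open>\<open>QQ\<close> are the large low cliques in the order \<open>f\<close> of their removal, and \<open>p Q\<close> is the vertex by
which \<open>Q\<close> was attached; edges from \<open>Q\<close> to cliques removed later leave from \<open>p Q\<close>. Besides the edges
inside the cliques, the bound on degrees allows \<open>d + 1 - card Q\<close> edges for the attaching vertex of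
each clique and \<open>(5d + 8)/16\<close> edges for every low vertex outside the cliques. The last bound says
that few clique vertices have low neighbors outside their clique. The threshold \<open>5d/8 + 1\<close> balances two needs in the discharging:
vertices outside \<open>\<Union>QQ\<close> must have many high neighbors, and the cliques must be much larger
than \<open>d/8\<close>.\<close>

definition decomp :: "'a set \<Rightarrow> 'a set set \<Rightarrow> ('a set \<Rightarrow> nat) \<Rightarrow> ('a set \<Rightarrow> 'a) \<Rightarrow> bool" where
  "decomp X QQ f p \<longleftrightarrow>
     disjoint QQ \<and>
     (\<forall>Q\<in>QQ. Q \<subseteq> X \<and> clique Q \<and> 5 * d + 8 < 8 * card Q) \<and>
     inj_on f QQ \<and>
     (\<forall>Q\<in>QQ. \<forall>Q'\<in>QQ. f Q < f Q' \<longrightarrow> (\<forall>q\<in>Q. \<forall>q'\<in>Q'. adj q q' \<longrightarrow> q = p Q)) \<and>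
     8 * degsum X \<le> (\<Sum>Q\<in>QQ. 8 * (card Q * (card Q - 1) + 2 * (d + 1 - card Q)))
        + (5 * d + 8) * card (X - \<Union>QQ) \<and>
     (\<Sum>Q\<in>QQ. card (outer X Q)) \<le> card (X - \<Union>QQ) + (\<Sum>Q\<in>QQ. d + 2 - card Q)"

lemma sum_card_disjoint:
  assumes "disjoint QQ" "finite QQ" "finite E"
  shows "(\<Sum>Q\<in>QQ. card (Q \<inter> E)) \<le> card E"
proof -
  have "(\<Sum>Q\<in>QQ. card (Q \<inter> E)) = card (\<Union>Q\<in>QQ. Q \<inter> E)"
    using assms by (intro card_UN_disjoint[symmetric]) (auto simp: disjoint_def)
  also have "\<dots> \<le> card E" using assms(3) by (intro card_mono) auto
  finally show ?thesis .
qed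

lemma outer_grow:
  assumes "disjoint QQ" "finite QQ" "finite E" "\<And>Q. Q \<in> QQ \<Longrightarrow> Q \<subseteq> X - C"
    and E: "\<And>v z. v \<in> X - C \<Longrightarrow> z \<in> C \<Longrightarrow> adj v z \<Longrightarrow> v \<in> E" and finX: "finite X"
  shows "(\<Sum>Q\<in>QQ. card (outer X Q)) \<le> (\<Sum>Q\<in>QQ. card (outer (X - C) Q)) + card E"
proof -
  have "card (outer X Q) \<le> card (outer (X - C) Q) + card (Q \<inter> E)" if Q: "Q \<in> QQ" for Q
  proof -
    have finQ: "finite Q" using assms(4)[OF Q] finX by (meson Diff_subset finite_subset)
    have "outer X Q \<subseteq> outer (X - C) Q \<union> (Q \<inter> E)"
      using E assms(4)[OF Q] unfolding outer_def by (auto simp: subset_iff)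
    then have "card (outer X Q) \<le> card (outer (X - C) Q \<union> (Q \<inter> E))"
      using finQ by (intro card_mono) (auto simp: outer_def)
    also have "\<dots> \<le> card (outer (X - C) Q) + card (Q \<inter> E)" by (rule card_Un_le)
    finally show ?thesis .
  qed
  then have "(\<Sum>Q\<in>QQ. card (outer X Q)) \<le> (\<Sum>Q\<in>QQ. card (outer (X - C) Q) + card (Q \<inter> E))"
    by (rule sum_mono)
  also have "\<dots> \<le> (\<Sum>Q\<in>QQ. card (outer (X - C) Q)) + card E"
    using sum_card_disjoint[OF assms(1-3)] by (simp add: sum.distrib)
  finally show ?thesis .
qed

text \<open>Remove the pieces of \<open>low_piece\<close> one after another: a large clique goes with its attaching vertex
and is collected, a small piece goes without it.\<close>

lemma decomposition:
  assumes d5: "5 \<le> d"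
  shows "X \<subseteq> Low \<Longrightarrow> \<exists>QQ f p. decomp X QQ f p"
proof (induction "card X" arbitrary: X rule: less_induct)
  case less
  have XV: "X \<subseteq> V" using less.prems Low_V by auto
  have finX: "finite X" using XV finite_in_V by auto
  have IH: "\<exists>QQ f p. decomp (X - C) QQ f p" if "C \<subseteq> X" "C \<noteq> {}" for C
  proof -
    have "X - C \<subset> X" using that by auto
    then have "card (X - C) < card X" using finX by (intro psubset_card_mono)
    then show ?thesis using less.hyps[of "X - C"] less.prems by auto
  qed
  have step: ?case if C: "C \<subseteq> X" "C \<noteq> {}" and E: "finite E" "card E \<le> card C"
      "\<And>v z. v \<in> X - C \<Longrightarrow> z \<in> C \<Longrightarrow> adj v z \<Longrightarrow> v \<in> E"
      and deg: "8 * degsum X \<le> 8 * degsum (X - C) + (5 * d + 8) * card C" for C E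
  proof -
    obtain QQ f p where D: "decomp (X - C) QQ f p" using IH[OF C] by blast
    then have Q: "\<And>Q. Q \<in> QQ \<Longrightarrow> Q \<subseteq> X - C" and dis: "disjoint QQ" unfolding decomp_def by auto
    have finQQ: "finite QQ"
    proof (rule finite_subset)
      show "QQ \<subseteq> Pow X" using Q by auto
    qed (use finX in simp)
    have finC: "finite C" using C(1) finX finite_subset by auto
    have "X - \<Union>QQ = (X - C - \<Union>QQ) \<union> C" using C(1) Q by auto
    then have cW: "card (X - \<Union>QQ) = card (X - C - \<Union>QQ) + card C"
      using card_Un_disjoint[of "X - C - \<Union>QQ" C] finX finC by auto
    have og: "(\<Sum>Q\<in>QQ. card (outer X Q)) \<le> (\<Sum>Q\<in>QQ. card (outer (X - C) Q)) + card E"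
      by (rule outer_grow[OF dis finQQ E(1) _ _ finX]) (use Q E(3) in blast)+
    have "decomp X QQ f p"
      unfolding decomp_def
    proof (intro conjI)
      show "disjoint QQ" "inj_on f QQ"
        "\<forall>Q\<in>QQ. \<forall>Q'\<in>QQ. f Q < f Q' \<longrightarrow> (\<forall>q\<in>Q. \<forall>q'\<in>Q'. adj q q' \<longrightarrow> q = p Q)"
        "\<forall>Q\<in>QQ. Q \<subseteq> X \<and> clique Q \<and> 5 * d + 8 < 8 * card Q"
        using D unfolding decomp_def by blast+
      have "8 * degsum (X - C) \<le> (\<Sum>Q\<in>QQ. 8 * (card Q * (card Q - 1) + 2 * (d + 1 - card Q)))
        + (5 * d + 8) * card (X - C - \<Union>QQ)"
        using D unfolding decomp_def by blast
      then show "8 * degsum X \<le> (\<Sum>Q\<in>QQ. 8 * (card Q * (card Q - 1) + 2 * (d + 1 - card Q)))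
        + (5 * d + 8) * card (X - \<Union>QQ)"
        using deg unfolding cW distrib_left by linarith
      have "(\<Sum>Q\<in>QQ. card (outer (X - C) Q)) \<le> card (X - C - \<Union>QQ) + (\<Sum>Q\<in>QQ. d + 2 - card Q)"
        using D unfolding decomp_def by blast
      then show "(\<Sum>Q\<in>QQ. card (outer X Q)) \<le> card (X - \<Union>QQ) + (\<Sum>Q\<in>QQ. d + 2 - card Q)"
        using og E(2) unfolding cW by linarith
    qed
    then show ?thesis by blast
  qed
  show ?case
  proof (cases "X = {}")
    case True
    then have "decomp X {} (\<lambda>_. 0) (\<lambda>_. undefined)" by (simp add: decomp_def degsum_def)
    then show ?thesis by blast
  next
    case False
    from low_piece[OF less.prems False] show ?thesis
    proof (elim disjE exE conjE bexE)
      fix v assume v: "v \<in> X" "nbrs X v = {}"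
      have "nbrs (X - {v}) v = {}" using v(2) by auto
      then have "8 * degsum X \<le> 8 * degsum (X - {v}) + (5 * d + 8) * card {v}"
        using degsum_split[of "{v}" X] v XV by simp
      moreover have "u \<in> {}" if "u \<in> X - {v}" "z \<in> {v}" "adj u z" for u z
        using that v adj_sym[OF that(3)] by auto
      ultimately show ?thesis using step[of "{v}" "{}"] v(1) by auto
    next
      fix w C assume pe: "pendant X w C" and cl: "clique (insert w C)"
      have C: "C \<subseteq> X" "w \<in> X" "w \<notin> C" "C \<noteq> {}" "\<And>c. c \<in> C \<Longrightarrow> nbrs X c \<subseteq> insert w C"
        using pe unfolding pendant_def by auto
      have fin: "finite C" using C(1) finX finite_subset by auto
      have only: "v = w" if "v \<in> X - C" "z \<in> C" "adj v z" for v z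
        using nbrsD[OF C(5)[OF that(2)], of v] that adj_sym[OF that(3)] by auto
      define s where "s = card C"
      have s1: "s \<ge> 1" using C(4) fin by (simp add: s_def Suc_le_eq card_gt_0_iff)
      show ?thesis
      proof (cases "8 * s \<le> 5 * d")
        case True
        have "8 * (s * s + s) = (8 * s + 8) * s" by (simp add: algebra_simps)
        also have "\<dots> \<le> (5 * d + 8) * s" using True by (intro mult_le_mono1) simp
        finally have "8 * degsum X \<le> 8 * degsum (X - C) + (5 * d + 8) * card C"
          using degsum_remove_leaf[OF pe cl XV] by (simp add: s_def)
        then show ?thesis using step[of C "{w}"] C only s1 by (auto simp: s_def)
      next
        case False
        define Q0 where "Q0 = insert w C"
        have Q0: "Q0 \<subseteq> X" "Q0 \<noteq> {}" "clique Q0" using C cl by (auto simp: Q0_def)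
        have cQ0: "card Q0 = s + 1" using fin C(3) by (simp add: Q0_def s_def)
        have sd: "s + 1 \<le> d" using clique_bound[OF Q0(3)] cQ0 by simp
        obtain QQ f p where D: "decomp (X - Q0) QQ f p" using IH[OF Q0(1,2)] by blast
        then have Q: "\<And>Q. Q \<in> QQ \<Longrightarrow> Q \<subseteq> X - Q0" and dis: "disjoint QQ" unfolding decomp_def by auto
        have finQQ: "finite QQ"
        proof (rule finite_subset)
          show "QQ \<subseteq> Pow X" using Q by auto
        qed (use finX in simp)
        have nQ0: "Q0 \<notin> QQ" using Q Q0(2) by auto
        have eW: "X - \<Union>(insert Q0 QQ) = X - Q0 - \<Union>QQ" by auto
        have only0: "q = w" if "q \<in> Q0" "z \<in> X - Q0" "adj q z" for q z
          using only[of z q] that adj_sym[OF that(3)] unfolding Q0_def by auto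
        let ?f = "\<lambda>Q. if Q = Q0 then 0 else Suc (f Q)" and ?p = "\<lambda>Q. if Q = Q0 then w else p Q"
        have "decomp X (insert Q0 QQ) ?f ?p"
          unfolding decomp_def
        proof (intro conjI)
          show "disjoint (insert Q0 QQ)"
            using dis Q unfolding disjoint_def by fastforce
          show "\<forall>Q\<in>insert Q0 QQ. Q \<subseteq> X \<and> clique Q \<and> 5 * d + 8 < 8 * card Q"
            using D Q0 cQ0 False unfolding decomp_def by auto
          have "inj_on f QQ" using D unfolding decomp_def by blast
          then show "inj_on ?f (insert Q0 QQ)" using nQ0 by (auto simp: inj_on_def)
          show "\<forall>Q\<in>insert Q0 QQ. \<forall>Q'\<in>insert Q0 QQ. ?f Q < ?f Q' \<longrightarrow>
            (\<forall>q\<in>Q. \<forall>q'\<in>Q'. adj q q' \<longrightarrow> q = ?p Q)"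
          proof (intro ballI impI)
            fix Q Q' q q' assume a: "Q \<in> insert Q0 QQ" "Q' \<in> insert Q0 QQ" "?f Q < ?f Q'" "q \<in> Q" "q' \<in> Q'" "adj q q'"
            then have Q': "Q' \<in> QQ" "Q' \<noteq> Q0" by (auto split: if_splits)
            show "q = ?p Q"
            proof (cases "Q = Q0")
              case True
              then show ?thesis using only0[of q q'] a Q[OF Q'(1)] by auto
            next
              case False
              then have "Q \<in> QQ" "f Q < f Q'" using a Q' by auto
              moreover have "\<forall>Q\<in>QQ. \<forall>Q'\<in>QQ. f Q < f Q' \<longrightarrow> (\<forall>q\<in>Q. \<forall>q'\<in>Q'. adj q q' \<longrightarrow> q = p Q)"
                using D unfolding decomp_def by blast
              ultimately have "q = p Q" using a(4-6) Q'(1) by blast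
              then show ?thesis using False by simp
            qed
          qed
          let ?S = "\<Sum>Q\<in>QQ. 8 * (card Q * (card Q - 1) + 2 * (d + 1 - card Q))"
          have "8 * degsum (X - Q0) \<le> ?S + (5 * d + 8) * card (X - Q0 - \<Union>QQ)"
            using D unfolding decomp_def by blast
          moreover have "8 * degsum X \<le> 8 * degsum (X - Q0) + 8 * (s * s + s + 2 * (d - s))"
            using mult_le_mono2[OF degsum_remove_clique[OF pe cl less.prems], of 8] unfolding Q0_def s_def
            by (simp only: distrib_left mult.assoc add.assoc)
          moreover have "card Q0 * (card Q0 - 1) + 2 * (d + 1 - card Q0) = s * s + s + 2 * (d - s)"
            unfolding cQ0 by (simp add: algebra_simps)
          ultimately have "8 * degsum X \<le> 8 * (card Q0 * (card Q0 - 1) + 2 * (d + 1 - card Q0))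
            + ?S + (5 * d + 8) * card (X - Q0 - \<Union>QQ)" by simp
          then show "8 * degsum X \<le> (\<Sum>Q\<in>insert Q0 QQ. 8 * (card Q * (card Q - 1) + 2 * (d + 1 - card Q)))
            + (5 * d + 8) * card (X - \<Union>(insert Q0 QQ))"
            unfolding eW sum.insert[OF finQQ nQ0] .
          have o1: "(\<Sum>Q\<in>QQ. card (outer (X - Q0) Q)) \<le> card (X - Q0 - \<Union>QQ) + (\<Sum>Q\<in>QQ. d + 2 - card Q)"
            using D unfolding decomp_def by blast
          let ?E = "nbrs (X - Q0) w"
          have "v \<in> ?E" if "v \<in> X - Q0" "z \<in> Q0" "adj v z" for v z
            using only0[OF that(2,1) adj_sym[OF that(3)]] that adj_sym[OF that(3)] by auto
          then have o2: "(\<Sum>Q\<in>QQ. card (outer X Q)) \<le> (\<Sum>Q\<in>QQ. card (outer (X - Q0) Q)) + card ?E"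
            by (intro outer_grow[OF dis finQQ finite_nbrs _ _ finX] Q) blast+
          have "nbrs Q0 w = C" using clique_nbrs[OF Q0(3), of w] C(3) by (auto simp: Q0_def)
          then have "card (nbrs X w) = s + card ?E" using card_nbrs_split[OF Q0(1), of w] by (simp add: s_def)
          moreover have "card (nbrs X w) \<le> d"
            using card_nbrs_mono[OF XV, of w] C(2) less.prems by (auto simp: Low_def)
          ultimately have o3: "card ?E \<le> d - s" by linarith
          have "outer X Q0 \<subseteq> {w}" unfolding outer_def using only0 by (auto simp: subset_iff)
          then have "card (outer X Q0) \<le> card {w}" by (intro card_mono) auto
          then have o4: "card (outer X Q0) \<le> 1" by simp
          have o5: "d + 2 - card Q0 = d - s + 1" using cQ0 sd by simp
          show "(\<Sum>Q\<in>insert Q0 QQ. card (outer X Q)) \<le> card (X - \<Union>(insert Q0 QQ)) + (\<Sum>Q\<in>insert Q0 QQ. d + 2 - card Q)"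
            unfolding eW sum.insert[OF finQQ nQ0] using o1 o2 o3 o4 o5 by linarith
        qed
        then show ?thesis by blast
      qed
    next
      fix w C assume pe: "pendant X w C" and C3: "3 \<le> card C" and deg: "\<forall>c\<in>C. card (nbrs X c) = 2"
        and cw: "card (nbrs C w) \<le> 2"
      have C: "C \<subseteq> X" "w \<in> X" "C \<noteq> {}" "\<And>c. c \<in> C \<Longrightarrow> nbrs X c \<subseteq> insert w C"
        using pe unfolding pendant_def by auto
      have only: "v \<in> {w}" if "v \<in> X - C" "z \<in> C" "adj v z" for v z
        using nbrsD[OF C(4)[OF that(2)], of v] that adj_sym[OF that(3)] by auto
      have "degsum X \<le> degsum (X - C) + (2 * card C + 2)"
        using degsum_split[OF C(1) XV] pendant_cross[OF pe XV] deg cw by simp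
      then have "8 * degsum X \<le> 8 * degsum (X - C) + 33 * card C" using C3 by linarith
      also have "\<dots> \<le> 8 * degsum (X - C) + (5 * d + 8) * card C"
        using d5 by (intro add_left_mono mult_le_mono1) simp
      finally have "8 * degsum X \<le> 8 * degsum (X - C) + (5 * d + 8) * card C" .
      then show ?thesis using step[of C "{w}"] C only C3 by auto
    qed
  qed
qed

end

section \<open>Discharging\<close>

context critical_cover begin

lemma sum_excess_high: "(\<Sum>v\<in>V - Low. excess v) = (\<Sum>v\<in>V. excess v)"
proof -
  have "(\<Sum>v\<in>V. excess v) = (\<Sum>v\<in>V - Low. excess v) + (\<Sum>v\<in>Low. excess v)"
    using fin_V Low_V by (rule sum.subset_diff[rotated])
  then show ?thesis using excess_low by simp
qed

lemma card_high_le: "card (V - Low) \<le> (\<Sum>v\<in>V. excess v)"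
proof -
  have "card (V - Low) = (\<Sum>v\<in>V - Low. 1)" by simp
  also have "\<dots> \<le> (\<Sum>v\<in>V - Low. excess v)" by (intro sum_mono excess_high)
  finally show ?thesis using sum_excess_high by simp
qed

lemma card_V_split: "card V = card Low + card (V - Low)"
  using card_Diff_subset[of Low V] Low_V fin_V card_mono[OF fin_V Low_V] finite_in_V[OF Low_V] by simp

text \<open>The left side counts the edge ends at low vertices. Those that do not stay inside the low set lie
on edges to high vertices, whose degrees have the sum on the right.\<close>

lemma low_high_edges: "d * card Low \<le> degsum Low + d * card (V - Low) + (\<Sum>v\<in>V. excess v)"
proof -
  have "d * card Low = (\<Sum>v\<in>Low. card (nbrs V v))" by (simp add: Low_def)
  also have "\<dots> = (\<Sum>v\<in>Low. card (nbrs Low v) + card (nbrs (V - Low) v))"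
    using card_nbrs_split[OF Low_V] by simp
  also have "\<dots> = degsum Low + (\<Sum>v\<in>Low. card (nbrs (V - Low) v))"
    by (simp add: sum.distrib degsum_def)
  also have "(\<Sum>v\<in>Low. card (nbrs (V - Low) v)) = (\<Sum>v\<in>V - Low. card (nbrs Low v))"
    using finite_in_V[OF Low_V] fin_V by (intro sum_nbrs_swap) auto
  also have "\<dots> \<le> (\<Sum>v\<in>V - Low. d + excess v)"
    using card_nbrs_mono[OF Low_V] deg_eq by (intro sum_mono) (metis DiffD1)
  also have "\<dots> = d * card (V - Low) + (\<Sum>v\<in>V. excess v)"
    using sum_excess_high by (simp add: sum.distrib)
  finally show ?thesis by simp
qed

text \<open>Low vertices have on average almost one high neighbor by \<open>low_degsum\<close>, but there are at most as many
high vertices as there is excess. This gives an excess of \<open>(d - 2)/(d\<^sup>2 + 2d - 2)\<close> per vertex, which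
exceeds \<open>1/28\<close> exactly for the degrees considered.\<close>

lemma excess_small_degree:
  assumes d: "3 \<le> d" "d \<le> 23" and ne: "V \<noteq> {}"
  shows "card V < 28 * (\<Sum>v\<in>V. excess v)"
proof (rule ccontr)
  assume neg: "\<not> ?thesis"
  define X where "X = real (\<Sum>v\<in>V. excess v)"
  define n h l D where "n = real (card V)" and "h = real (card (V - Low))" and "l = real (card Low)"
    and "D = real (degsum Low)"
  define e where "e = real d"
  have nX: "28 * X \<le> n" using neg unfolding X_def n_def by linarith
  have n0: "n > 0" using ne fin_V by (simp add: n_def card_gt_0_iff)
  have nhl: "n = l + h" using card_V_split by (simp add: n_def l_def h_def)
  have hX: "h \<le> X" using card_high_le unfolding h_def X_def by linarith
  have X0: "X \<ge> 0" and l0: "l \<ge> 0" and e3: "3 \<le> e" "e \<le> 23" using d by (simp_all add: X_def l_def e_def sum_nonneg)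
  have "real (d * card Low) \<le> real (degsum Low + d * card (V - Low) + (\<Sum>v\<in>V. excess v))"
    using low_high_edges by (rule of_nat_mono)
  then have a: "e * l \<le> D + e * h + X" by (simp add: e_def l_def D_def h_def X_def)
  have "real (d * degsum Low + d * card Low) \<le> real ((d * d + 2) * card Low)"
    using low_degsum[OF d(1) order_refl] by (rule of_nat_mono)
  then have b: "e * D + e * l \<le> (e * e + 2) * l" by (simp add: e_def l_def D_def algebra_simps)
  have "e * (e * l) \<le> e * (D + e * h + X)" using a e3 by (intro mult_left_mono) auto
  then have "(e - 2) * l \<le> e * e * h + e * X" using b by (simp add: algebra_simps)
  then have "(e - 2) * n \<le> (e * e + e - 2) * h + e * X" using nhl by (simp add: algebra_simps)
  also have "\<dots> \<le> (e * e + e - 2) * X + e * X"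
  proof -
    have "3 * 3 \<le> e * e" using e3 by (intro mult_mono) auto
    then have "(e * e + e - 2) * h \<le> (e * e + e - 2) * X" using hX e3 by (intro mult_left_mono) auto
    then show ?thesis by simp
  qed
  finally have c: "(e - 2) * n \<le> (e * e + 2 * e - 2) * X" by (simp add: algebra_simps)
  have "(e - 2) * (28 * X) \<le> (e - 2) * n" using nX e3 by (intro mult_left_mono) auto
  then have "0 \<le> (e * e - 26 * e + 54) * X" using c by (simp add: algebra_simps)
  moreover have "(e - 3) * (23 - e) \<ge> 0" using e3 by simp
  then have "e * e - 26 * e + 54 < 0" by (simp add: algebra_simps)
  ultimately have "X = 0" using X0 by (metis linorder_not_less mult_neg_pos order_le_less)
  then have "(e - 2) * n \<le> 0" using c by simp
  then show False using n0 e3 by (simp add: mult_le_0_iff)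
qed

definition lost :: "'a set \<Rightarrow> 'a set \<Rightarrow> 'a set" where
  "lost S Q = {q \<in> Q. \<not> nbrs V q \<subseteq> Q \<union> S}"

lemma decompD:
  assumes "decomp X QQ f p"
  shows "disjoint QQ" "\<And>Q. Q \<in> QQ \<Longrightarrow> Q \<subseteq> X" "\<And>Q. Q \<in> QQ \<Longrightarrow> clique Q"
    "\<And>Q. Q \<in> QQ \<Longrightarrow> 5 * d + 8 < 8 * card Q" "inj_on f QQ"
    "\<And>Q Q' q q'. Q \<in> QQ \<Longrightarrow> Q' \<in> QQ \<Longrightarrow> f Q < f Q' \<Longrightarrow> q \<in> Q \<Longrightarrow> q' \<in> Q' \<Longrightarrow> adj q q' \<Longrightarrow> q = p Q"
    "8 * degsum X \<le> (\<Sum>Q\<in>QQ. 8 * (card Q * (card Q - 1) + 2 * (d + 1 - card Q)))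
        + (5 * d + 8) * card (X - \<Union>QQ)"
    "(\<Sum>Q\<in>QQ. card (outer X Q)) \<le> card (X - \<Union>QQ) + (\<Sum>Q\<in>QQ. d + 2 - card Q)"
  using assms unfolding decomp_def by blast+

text \<open>With little excess, nearly all low vertices lie in the cliques of the decomposition, because the
others have about \<open>3d/8\<close> high neighbors each. So the clique vertices with low neighbors outside
their clique, and those that peeling can lose to high vertices, each dropped with fewer than
\<open>9\<close> times its excess of edges left, are less than two thirds of all clique vertices.\<close>

lemma budget:
  assumes d: "24 \<le> d" and D: "decomp Low QQ f p" and ne: "V \<noteq> {}"
    and n: "24 * (\<Sum>v\<in>V. excess v) \<le> card V"
  shows "3 * (\<Sum>Q\<in>QQ. card (outer Low Q)) + 3 * (\<Sum>v\<in>V - Low. 9 * excess v - 1) < 2 * (\<Sum>Q\<in>QQ. card Q)"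
proof (rule ccontr)
  assume neg: "\<not> ?thesis"
  have finLo: "finite Low" by (rule finite_in_V[OF Low_V])
  have finQQ: "finite QQ"
  proof (rule finite_subset)
    show "QQ \<subseteq> Pow Low" using decompD(2)[OF D] by auto
  qed (use finLo in simp)
  define X where "X = real (\<Sum>v\<in>V. excess v)"
  define h W N e where "h = real (card (V - Low))" and "W = real (card (Low - \<Union>QQ))"
    and "N = (\<Sum>Q\<in>QQ. real (card Q))" and "e = real d"
  define q R where "q = real (card QQ)" and "R = (\<Sum>Q\<in>QQ. e - real (card Q))"
  have e24: "24 \<le> e" using d by (simp add: e_def)
  have t: "card Q \<le> d" "5 * d + 8 < 8 * card Q" "17 \<le> card Q" if "Q \<in> QQ" for Q
    using clique_bound decompD(3,4)[OF D that] d by auto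
  have "card (\<Union>QQ) = (\<Sum>Q\<in>QQ. card Q)"
    using decompD(1)[OF D] finite_subset[OF decompD(2)[OF D] finLo]
    by (intro card_Union_disjoint) (auto simp: disjoint_def pairwise_def disjnt_def)
  moreover have U: "\<Union>QQ \<subseteq> Low" using decompD(2)[OF D] by auto
  then have "card Low = card (\<Union>QQ) + card (Low - \<Union>QQ)"
    using card_Diff_subset[OF finite_subset[OF U finLo] U] card_mono[OF finLo U] by simp
  ultimately have lNW: "real (card Low) = N + W" by (simp add: N_def W_def)
  have nX: "24 * X \<le> N + W + h" using n card_V_split lNW unfolding X_def h_def by linarith
  have n0: "N + W + h > 0" using ne fin_V card_V_split lNW unfolding h_def by (metis card_gt_0_iff of_nat_0_less_iff of_nat_add)
  have hX: "h \<le> X" using card_high_le unfolding h_def X_def by linarith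
  have nonneg: "0 \<le> X" "0 \<le> h" "0 \<le> W" "0 \<le> q" "0 \<le> N" by (simp_all add: X_def h_def W_def q_def N_def sum_nonneg)
  have R0: "0 \<le> R" unfolding R_def e_def using t(1) by (intro sum_nonneg) simp
  have "(\<Sum>Q\<in>QQ. 17) \<le> N" unfolding N_def using t(3) by (intro sum_mono) fastforce
  then have q17: "17 * q \<le> N" by (simp add: q_def)
  have "real (d * card Low) \<le> real (degsum Low + d * card (V - Low) + (\<Sum>v\<in>V. excess v))"
    using low_high_edges by (rule of_nat_mono)
  then have a: "e * (N + W) \<le> real (degsum Low) + e * h + X" using lNW by (simp add: e_def h_def X_def)
  have "real (8 * degsum Low) \<le> real ((\<Sum>Q\<in>QQ. 8 * (card Q * (card Q - 1) + 2 * (d + 1 - card Q)))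
        + (5 * d + 8) * card (Low - \<Union>QQ))"
    using decompD(7)[OF D] by (rule of_nat_mono)
  then have b: "8 * real (degsum Low) \<le> (\<Sum>Q\<in>QQ. real (8 * (card Q * (card Q - 1) + 2 * (d + 1 - card Q))))
        + (5 * e + 8) * W" by (simp add: e_def W_def)
  have "(\<Sum>Q\<in>QQ. real (8 * (card Q * (card Q - 1) + 2 * (d + 1 - card Q))))
     \<le> (\<Sum>Q\<in>QQ. 8 * e * card Q - (8 * real (card Q) - 16) - (3 * e - 8) * (e - real (card Q)))"
  proof (rule sum_mono)
    \<comment> \<open>A clique on \<open>s\<close> vertices sends \<open>s (d + 1 - s)\<close> edges out. About \<open>s\<close> of them are kept to
      count its vertices; the others bound the deficit \<open>R\<close> from size \<open>d\<close> at the rate at which \<open>W\<close> is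
      bounded.\<close>
    fix Q assume Q: "Q \<in> QQ"
    define s where "s = real (card Q)"
    have s: "s \<le> e" "5 * e + 8 \<le> 8 * s" using t[OF Q] by (auto simp: s_def e_def)
    have "real (8 * (card Q * (card Q - 1) + 2 * (d + 1 - card Q))) = 8 * (s * (s - 1) + 2 * (e + 1 - s))"
      using t[OF Q] by (simp add: s_def e_def of_nat_diff)
    also have "\<dots> = 8 * e * s - (8 * s - 16) - (8 * s - 16) * (e - s)" by (simp add: algebra_simps)
    also have "\<dots> \<le> 8 * e * s - (8 * s - 16) - (3 * e - 8) * (e - s)"
    proof -
      have "(3 * e - 8) * (e - s) \<le> (8 * s - 16) * (e - s)" using s e24 by (intro mult_right_mono) auto
      then show ?thesis by linarith
    qed
    finally show "real (8 * (card Q * (card Q - 1) + 2 * (d + 1 - card Q)))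
      \<le> 8 * e * card Q - (8 * real (card Q) - 16) - (3 * e - 8) * (e - real (card Q))"
      by (simp add: s_def)
  qed
  also have "\<dots> = 8 * e * N - 8 * N + 16 * q - (3 * e - 8) * R"
  proof -
    have "(\<Sum>Q\<in>QQ. 8 * e * card Q) = 8 * e * N" by (simp add: N_def sum_distrib_left)
    moreover have "(\<Sum>Q\<in>QQ. 8 * real (card Q) - 16) = 8 * N - 16 * q"
      by (simp add: sum_subtractf sum_distrib_left N_def q_def)
    moreover have "(\<Sum>Q\<in>QQ. (3 * e - 8) * (e - real (card Q))) = (3 * e - 8) * R"
      by (simp only: R_def sum_distrib_left)
    ultimately show ?thesis by (simp only: sum_subtractf)
  qed
  finally have b': "8 * real (degsum Low) \<le> 8 * e * N - 8 * N + 16 * q - (3 * e - 8) * R + (5 * e + 8) * W"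
    using b by linarith
  have "8 * (e * (N + W)) \<le> 8 * real (degsum Low) + 8 * (e * h) + 8 * X" using a by linarith
  then have A: "e * (3 * (W + R) - 8 * h) \<le> 8 * (W + R) + 8 * X - 8 * N + 16 * q"
    using b' by (simp add: algebra_simps)
  have "real (2 * (\<Sum>Q\<in>QQ. card Q)) \<le> real (3 * (\<Sum>Q\<in>QQ. card (outer Low Q)) + 3 * (\<Sum>v\<in>V - Low. 9 * excess v - 1))"
    using neg by (intro of_nat_mono) linarith
  moreover have "real (\<Sum>Q\<in>QQ. card (outer Low Q)) \<le> W + R + 2 * q"
  proof -
    have "real (\<Sum>Q\<in>QQ. card (outer Low Q)) \<le> real (card (Low - \<Union>QQ) + (\<Sum>Q\<in>QQ. d + 2 - card Q))"
      using decompD(8)[OF D] by (rule of_nat_mono)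
    also have "\<dots> = W + (\<Sum>Q\<in>QQ. (e - real (card Q)) + 2)"
    proof -
      have "real (d + 2 - card Q) = (e - real (card Q)) + 2" if "Q \<in> QQ" for Q
        using t(1)[OF that] by (simp add: e_def of_nat_diff)
      then show ?thesis by (simp add: W_def)
    qed
    also have "\<dots> = W + R + 2 * q" by (simp add: sum.distrib R_def q_def)
    finally show ?thesis .
  qed
  moreover have "real (\<Sum>v\<in>V - Low. 9 * excess v - 1) = 9 * X - h"
  proof -
    have "real (9 * excess v - 1) = 9 * real (excess v) - 1" if "v \<in> V - Low" for v
      using excess_high[OF that] by (simp add: of_nat_diff)
    then have "real (\<Sum>v\<in>V - Low. 9 * excess v - 1) = (\<Sum>v\<in>V - Low. 9 * real (excess v) - 1)" by simp
    also have "\<dots> = 9 * real (\<Sum>v\<in>V - Low. excess v) - h" by (simp add: sum_subtractf sum_distrib_left h_def)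
    finally show ?thesis unfolding sum_excess_high X_def .
  qed
  ultimately have B: "2 * N \<le> 3 * (W + R) + 6 * q + 27 * X - 3 * h" by (simp add: N_def)
  show False
  proof (cases "3 * (W + R) \<le> 8 * h")
    \<comment> \<open>The main case: \<open>W + R \<le> 8 h / 3\<close>, so the loss per unit of excess stays below
      \<open>1940 / 84 < 24\<close>. In the other case the inequality \<open>A\<close> makes \<open>N\<close> small.\<close>
    case True
    then have "28 * N \<le> 85 * h + 459 * X" using B q17 by linarith
    moreover have "3 * W + 3 * R \<le> 8 * h" using True by simp
    ultimately have "84 * N + 84 * W + 84 * h \<le> 1940 * X" using R0 hX by linarith
    then have "N + W + h \<le> 0" using nX nonneg(1) by linarith
    then show False using n0 by linarith
  next
    case False
    then have "24 * (3 * (W + R) - 8 * h) \<le> e * (3 * (W + R) - 8 * h)"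
      using e24 by (intro mult_right_mono) auto
    then have C: "64 * W + 64 * R + 8 * N - 16 * q \<le> 200 * X" using A hX by (simp add: algebra_simps)
    have "28 * N \<le> 51 * W + 51 * R + 459 * X" using B q17 nonneg(2) by (simp add: algebra_simps)
    then have "N + W + h \<le> 23 * X" using C q17 hX R0 nonneg by linarith
    then have "N + W + h \<le> 0" using nX nonneg(1) by linarith
    then show False using n0 by linarith
  qed
qed

text \<open>Repeatedly drop high vertices with too few edges to the surviving cliques and cliques that have lost
two thirds of their vertices, where a vertex is lost once it has an outside neighbor that is not a
surviving high vertex. The inequality in \<open>good\<close> survives each step, but contradicts \<open>budget\<close> once
nothing is left. A minimal pair satisfying it is therefore nonempty and stable.\<close>

lemma peeling:
  assumes d: "24 \<le> d" and D: "decomp Low QQ f p" and ne: "V \<noteq> {}"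
    and n: "24 * (\<Sum>v\<in>V. excess v) \<le> card V"
  shows "\<exists>S F. S \<subseteq> V - Low \<and> F \<subseteq> QQ \<and> F \<noteq> {} \<and> (\<forall>v\<in>S. 9 * excess v \<le> card (nbrs (\<Union>F) v)) \<and>
    (\<forall>Q\<in>F. 3 * card (lost S Q) < 2 * card Q)"
proof -
  have finLo: "finite Low" by (rule finite_in_V[OF Low_V])
  have finQQ: "finite QQ"
  proof (rule finite_subset)
    show "QQ \<subseteq> Pow Low" using decompD(2)[OF D] by auto
  qed (use finLo in simp)
  have finQ: "finite Q" if "Q \<in> QQ" for Q by (rule finite_subset[OF decompD(2)[OF D that] finLo])
  let ?H = "V - Low"
  have finH: "finite ?H" using fin_V by simp
  define good where "good = (\<lambda>(S, F). S \<subseteq> ?H \<and> F \<subseteq> QQ \<and>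
    2 * (\<Sum>Q\<in>QQ - F. card Q) + 3 * (\<Sum>Q\<in>F. card (lost S Q))
      \<le> 3 * (\<Sum>Q\<in>QQ. card (outer Low Q)) + 3 * (\<Sum>v\<in>?H - S. 9 * excess v - 1))"
  have "lost ?H Q = outer Low Q" if "Q \<in> QQ" for Q
  proof -
    have "nbrs V q \<subseteq> Q \<union> ?H \<longleftrightarrow> nbrs Low q \<subseteq> Q" for q
      using decompD(2)[OF D that] Low_V unfolding nbrs_def by blast
    then show ?thesis by (simp add: lost_def outer_def)
  qed
  then have "good (?H, QQ)" by (simp add: good_def)
  then obtain T where T: "good T" "\<And>T'. good T' \<Longrightarrow> card (fst T) + card (snd T) \<le> card (fst T') + card (snd T')"
    using ex_has_least_nat[of good "(?H, QQ)" "\<lambda>T. card (fst T) + card (snd T)"] by blast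
  obtain S F where "T = (S, F)" by (cases T)
  then have SF: "good (S, F)" "\<And>S' F'. good (S', F') \<Longrightarrow> card S + card F \<le> card S' + card F'"
    using T(1) T(2)[of "(S', F')" for S' F'] by simp_all
  have S: "S \<subseteq> ?H" and F: "F \<subseteq> QQ" and inv: "2 * (\<Sum>Q\<in>QQ - F. card Q) + 3 * (\<Sum>Q\<in>F. card (lost S Q))
      \<le> 3 * (\<Sum>Q\<in>QQ. card (outer Low Q)) + 3 * (\<Sum>v\<in>?H - S. 9 * excess v - 1)"
    using SF(1) unfolding good_def by auto
  have finS: "finite S" and finF: "finite F" using finite_subset[OF S finH] finite_subset[OF F finQQ] by auto
  have disF: "disjoint F" using decompD(1)[OF D] F by (auto simp: disjoint_def)
  have vS: "9 * excess v \<le> card (nbrs (\<Union>F) v)" if v: "v \<in> S" for v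
  proof (rule ccontr)
    assume neg: "\<not> ?thesis"
    have l: "card (lost (S - {v}) Q) \<le> card (lost S Q) + card (Q \<inter> nbrs (\<Union>F) v)" if Q: "Q \<in> F" for Q
    proof -
      have fQ: "finite Q" using finQ Q F by auto
      have "lost (S - {v}) Q \<subseteq> lost S Q \<union> (Q \<inter> nbrs (\<Union>F) v)"
      proof
        fix q assume "q \<in> lost (S - {v}) Q"
        then obtain z where z: "q \<in> Q" "z \<in> nbrs V q" "z \<notin> Q \<union> (S - {v})" unfolding lost_def by blast
        show "q \<in> lost S Q \<union> (Q \<inter> nbrs (\<Union>F) v)"
        proof (cases "z = v")
          case True
          then have "adj v q" using z(2) adj_sym by simp
          then show ?thesis using z(1) Q by auto
        next
          case False
          then show ?thesis using z unfolding lost_def by blast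
        qed
      qed
      then have "card (lost (S - {v}) Q) \<le> card (lost S Q \<union> (Q \<inter> nbrs (\<Union>F) v))"
        using fQ by (intro card_mono) (auto simp: lost_def)
      also have "\<dots> \<le> card (lost S Q) + card (Q \<inter> nbrs (\<Union>F) v)" by (rule card_Un_le)
      finally show ?thesis .
    qed
    have "(\<Sum>Q\<in>F. card (lost (S - {v}) Q)) \<le> (\<Sum>Q\<in>F. card (lost S Q) + card (Q \<inter> nbrs (\<Union>F) v))"
      using l by (rule sum_mono)
    also have "\<dots> \<le> (\<Sum>Q\<in>F. card (lost S Q)) + card (nbrs (\<Union>F) v)"
      using sum_card_disjoint[OF disF finF, of "nbrs (\<Union>F) v"] by (simp add: sum.distrib)
    finally have s1: "(\<Sum>Q\<in>F. card (lost (S - {v}) Q)) \<le> (\<Sum>Q\<in>F. card (lost S Q)) + (9 * excess v - 1)"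
      using neg by linarith
    have "?H - (S - {v}) = insert v (?H - S)" using v S by auto
    then have s2: "(\<Sum>v\<in>?H - (S - {v}). 9 * excess v - 1) = (9 * excess v - 1) + (\<Sum>v\<in>?H - S. 9 * excess v - 1)"
      using finH v by simp
    have "good (S - {v}, F)" unfolding good_def using inv s1 s2 S F by auto
    then have "card S + card F \<le> card (S - {v}) + card F" by (rule SF(2))
    then show False using card_Diff1_less[OF finS v] by linarith
  qed
  have vF: "3 * card (lost S Q) < 2 * card Q" if Q: "Q \<in> F" for Q
  proof (rule ccontr)
    assume neg: "\<not> ?thesis"
    have "(\<Sum>Q\<in>F. card (lost S Q)) = card (lost S Q) + (\<Sum>Q\<in>F - {Q}. card (lost S Q))"
      by (rule sum.remove[OF finF Q])
    moreover have "QQ - (F - {Q}) = insert Q (QQ - F)" using Q F by auto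
    then have "(\<Sum>Q\<in>QQ - (F - {Q}). card Q) = card Q + (\<Sum>Q\<in>QQ - F. card Q)"
      using finQQ Q by simp
    ultimately have "good (S, F - {Q})" unfolding good_def using inv S F neg by auto
    then have "card S + card F \<le> card S + card (F - {Q})" by (rule SF(2))
    then show False using card_Diff1_less[OF finF Q] by linarith
  qed
  have "F \<noteq> {}"
  proof
    assume F0: "F = {}"
    have "S = {}"
    proof (rule ccontr)
      assume "S \<noteq> {}"
      then obtain v where v: "v \<in> S" by auto
      have "nbrs (\<Union>F) v = {}" using F0 by auto
      then have "excess v = 0" using vS[OF v] by simp
      then show False using excess_high[of v] v S by auto
    qed
    then show False using inv budget[OF d D ne n] F0 by simp
  qed
  then show ?thesis using S F vS vF by (intro exI[of _ S] exI[of _ F]) simp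
qed

end

section \<open>Breaking the alignment of a clique\<close>

text \<open>Every multigraph has an orientation in which each vertex receives at most half of its edges, rounded
up. If two edges share a vertex \<open>v\<close>, replace them by one edge joining their other ends and route the
orientation of the new edge through \<open>v\<close>; otherwise the edges are disjoint.\<close>

lemma balanced_orientation:
  fixes a b :: "'e \<Rightarrow> 'v"
  assumes "finite E"
  shows "\<exists>g. (\<forall>e\<in>E. g e = a e \<or> g e = b e) \<and>
    (\<forall>v. 2 * (\<Sum>e\<in>E. of_bool (g e = v)) \<le> (\<Sum>e\<in>E. of_bool (a e = v) + of_bool (b e = v)) + (1::nat))"
  using assms
proof (induction "card E" arbitrary: E a b rule: less_induct)
  case less
  show ?case
  proof (cases "\<exists>e1\<in>E. \<exists>e2\<in>E. e1 \<noteq> e2 \<and> {a e1, b e1} \<inter> {a e2, b e2} \<noteq> {}")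
    case True
    then obtain e1 e2 where e12: "e1 \<in> E" "e2 \<in> E" "e1 \<noteq> e2" "{a e1, b e1} \<inter> {a e2, b e2} \<noteq> {}"
      by metis
    then obtain v where "v \<in> {a e1, b e1} \<inter> {a e2, b e2}" by (meson ex_in_conv)
    then have e: "e1 \<in> E" "e2 \<in> E" "e1 \<noteq> e2" "v \<in> {a e1, b e1}" "v \<in> {a e2, b e2}"
      using e12(1-3) by simp_all
    define y z where "y = (if a e1 = v then b e1 else a e1)" and "z = (if a e2 = v then b e2 else a e2)"
    have yz: "of_bool (a e1 = u) + of_bool (b e1 = u) = (of_bool (v = u) + of_bool (y = u) :: nat)"
      "of_bool (a e2 = u) + of_bool (b e2 = u) = (of_bool (v = u) + of_bool (z = u) :: nat)" for u
      using e(4,5) by (auto simp: y_def z_def)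
    let ?E = "E - {e2}" and ?a = "a(e1 := y)" and ?b = "b(e1 := z)"
    have "card ?E < card E" using less.prems e(2) by (rule card_Diff1_less)
    then obtain g where g: "\<forall>e\<in>?E. g e = ?a e \<or> g e = ?b e"
      "\<And>u. 2 * (\<Sum>e\<in>?E. of_bool (g e = u)) \<le> (\<Sum>e\<in>?E. of_bool (?a e = u) + of_bool (?b e = u)) + (1::nat)"
      using less.hyps[of ?E ?a ?b] less.prems by auto
    define g' where "g' = (if g e1 = z then g(e1 := v, e2 := z) else g(e1 := y, e2 := v))"
    let ?R = "E - {e2} - {e1}"
    have fin: "finite ?R" using less.prems by simp
    have sE: "(\<Sum>e\<in>E. F e) = F e2 + (F e1 + (\<Sum>e\<in>?R. F e))" for F :: "'e \<Rightarrow> nat"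
      using less.prems e by (simp add: sum.remove[of E e2] sum.remove[of ?E e1])
    have s'E: "(\<Sum>e\<in>?E. F e) = F e1 + (\<Sum>e\<in>?R. F e)" for F :: "'e \<Rightarrow> nat"
      using less.prems e by (simp add: sum.remove[of ?E e1])
    have ge1: "g e1 = y \<or> g e1 = z" using bspec[OF g(1), of e1] e(1,3) by simp
    have same: "(\<Sum>e\<in>?R. of_bool (g' e = u)) = (\<Sum>e\<in>?R. of_bool (g e = u) :: nat)" for u
      by (intro sum.cong refl) (auto simp: g'_def)
    have two: "of_bool (g' e2 = u) + of_bool (g' e1 = u) = (of_bool (g e1 = u) + of_bool (v = u) :: nat)" for u
      using ge1 e(3) by (auto simp: g'_def)
    have sameab: "(\<Sum>e\<in>?R. of_bool (?a e = u) + of_bool (?b e = u)) = (\<Sum>e\<in>?R. of_bool (a e = u) + of_bool (b e = u) :: nat)" for u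
      by (intro sum.cong refl) auto
    have "2 * (\<Sum>e\<in>E. of_bool (g' e = u)) \<le> (\<Sum>e\<in>E. of_bool (a e = u) + of_bool (b e = u)) + (1::nat)" for u
    proof -
      have "(\<Sum>e\<in>E. of_bool (g' e = u)) = of_bool (v = u) + (\<Sum>e\<in>?E. of_bool (g e = u) :: nat)"
        unfolding sE s'E same using two[of u] by linarith
      moreover have "(\<Sum>e\<in>E. of_bool (a e = u) + of_bool (b e = u))
        = 2 * of_bool (v = u) + (\<Sum>e\<in>?E. of_bool (?a e = u) + of_bool (?b e = u) :: nat)"
        unfolding sE s'E sameab yz by simp
      ultimately show ?thesis using g(2)[of u] by linarith
    qed
    moreover have "g' e = a e \<or> g' e = b e" if eE: "e \<in> E" for e
    proof -
      consider "e = e1" | "e = e2" | "e \<in> ?R" using eE by blast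
      then show ?thesis
      proof cases
        case 1
        then show ?thesis using e(3,4) by (auto simp: g'_def y_def)
      next
        case 2
        then show ?thesis using e(5) by (auto simp: g'_def z_def)
      next
        case 3
        then show ?thesis using bspec[OF g(1), of e] by (auto simp: g'_def)
      qed
    qed
    ultimately show ?thesis by blast
  next
    case False
    have "2 * (\<Sum>e\<in>E. of_bool (a e = v)) \<le> (\<Sum>e\<in>E. of_bool (a e = v) + of_bool (b e = v)) + (1::nat)" for v
    proof -
      have "(\<Sum>e\<in>E. of_bool (a e = v)) \<le> (1::nat)"
      proof (cases "\<exists>e\<in>E. a e = v")
        case True
        then obtain e where e: "e \<in> E" "a e = v" by blast
        have "(\<Sum>e\<in>E. of_bool (a e = v)) = (\<Sum>e'\<in>E. if e' = e then 1 else (0::nat))"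
          using False e by (intro sum.cong refl) auto
        then show ?thesis using less.prems e by simp
      next
        case False
        then have "(\<Sum>e\<in>E. of_bool (a e = v)) = (\<Sum>e\<in>E. (0::nat))" by (intro sum.cong refl) auto
        then show ?thesis by simp
      qed
      then show ?thesis by (simp add: sum.distrib)
    qed
    then show ?thesis by (intro exI[of _ a]) simp
  qed
qed

context critical_cover begin

text \<open>A low clique that cannot be completed has no surplus at any vertex, and the remaining lists of any
two of its vertices are matched perfectly by the conflicts. A pair is loose if it refutes this. The
point is that looseness can be created early and kept: each later vertex has at most one color that
destroys it.\<close>

definition surplus :: "'a set \<Rightarrow> ('a \<Rightarrow> 'b) \<Rightarrow> 'a \<Rightarrow> bool" where
  "surplus A \<phi> q \<longleftrightarrow> card (nbrs (V - A) q) < card (avail A \<phi> q)"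

definition aligned :: "'a set \<Rightarrow> ('a \<Rightarrow> 'b) \<Rightarrow> 'a \<Rightarrow> 'a \<Rightarrow> bool" where
  "aligned A \<phi> q q' \<longleftrightarrow> (\<forall>b\<in>avail A \<phi> q. \<exists>b'\<in>avail A \<phi> q'. cf q b q' b') \<and>
     (\<forall>b'\<in>avail A \<phi> q'. \<exists>b\<in>avail A \<phi> q. cf q' b' q b)"

definition loose :: "'a set \<Rightarrow> ('a \<Rightarrow> 'b) \<Rightarrow> 'a \<Rightarrow> 'a \<Rightarrow> bool" where
  "loose A \<phi> q q' \<longleftrightarrow> surplus A \<phi> q \<or> surplus A \<phi> q' \<or> \<not> aligned A \<phi> q q'"

lemma aligned_sym: "aligned A \<phi> q q' = aligned A \<phi> q' q"
  unfolding aligned_def by (rule conj_commute)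

lemma loose_sym: "loose A \<phi> q q' = loose A \<phi> q' q"
  unfolding loose_def aligned_sym[of A \<phi> q q'] by (rule disj_left_commute)

lemma nbrs_insert_adj:
  assumes "v \<in> V - A" "adj v q"
  shows "card (nbrs (V - A) q) = Suc (card (nbrs (V - insert v A) q))"
proof -
  have "nbrs (V - A) q = insert v (nbrs (V - insert v A) q)" using assms adj_sym[OF assms(2)] by auto
  then show ?thesis by (simp add: card_insert_disjoint)
qed

lemma nbrs_insert_nonadj:
  assumes "\<not> adj v q"
  shows "nbrs (V - insert v A) q = nbrs (V - A) q"
  using assms adj_sym[of q v] by auto

lemma avail_insert_nonadj:
  assumes "v \<notin> A" "\<not> adj v q"
  shows "avail (insert v A) (\<phi>(v := b)) q = avail A \<phi> q"
  using avail_insert[OF assms(1)] assms(2) by simp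

lemma avail_insert_adj:
  assumes "v \<notin> A" "adj v q"
  shows "avail (insert v A) (\<phi>(v := b)) q = avail A \<phi> q - {c. cf v b q c}"
  using avail_insert[OF assms(1)] assms(2) by simp

lemma surplus_insert:
  assumes v: "v \<in> V - A" and b: "b \<in> avail A \<phi> v" and q: "q \<in> V" and s: "surplus A \<phi> q"
  shows "surplus (insert v A) (\<phi>(v := b)) q"
proof (cases "adj v q")
  case True
  have vA: "v \<notin> A" using v by simp
  have "card {c \<in> Lst q. cf v b q c} \<le> 1" using b by (intro card_conflict_le True) (simp add: avail_def)
  moreover have "avail A \<phi> q - {c. cf v b q c} = avail A \<phi> q - {c \<in> Lst q. cf v b q c}" by (auto simp: avail_def)
  moreover have "card (avail A \<phi> q) - card {c \<in> Lst q. cf v b q c} \<le> card (avail A \<phi> q - {c \<in> Lst q. cf v b q c})"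
    using fin_Lst[OF q] by (intro diff_card_le_card_Diff) simp
  ultimately have "card (avail A \<phi> q) \<le> Suc (card (avail (insert v A) (\<phi>(v := b)) q))"
    unfolding avail_insert_adj[OF vA True] by simp
  then show ?thesis using s nbrs_insert_adj[OF v True] unfolding surplus_def by simp
next
  case False
  have vA: "v \<notin> A" using v by simp
  show ?thesis
    using s unfolding surplus_def avail_insert_nonadj[OF vA False] nbrs_insert_nonadj[OF False] .
qed

lemma loose_insert_nonadj:
  assumes "v \<in> V - A" "\<not> adj v q" "\<not> adj v q'" "loose A \<phi> q q'"
  shows "loose (insert v A) (\<phi>(v := b)) q q'"
proof -
  have vA: "v \<notin> A" using assms(1) by simp
  have "avail (insert v A) (\<phi>(v := b)) q = avail A \<phi> q" "avail (insert v A) (\<phi>(v := b)) q' = avail A \<phi> q'"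
    using avail_insert_nonadj[OF vA assms(2)] avail_insert_nonadj[OF vA assms(3)] by simp_all
  moreover have "nbrs (V - insert v A) q = nbrs (V - A) q" "nbrs (V - insert v A) q' = nbrs (V - A) q'"
    using nbrs_insert_nonadj[OF assms(2)] nbrs_insert_nonadj[OF assms(3)] by simp_all
  ultimately show ?thesis using assms(4) by (simp only: loose_def surplus_def aligned_def)
qed

text \<open>Without surplus each bad color of \<open>v\<close> removes a color of \<open>q'\<close>, and what remains of \<open>q'\<close> must be
exactly the set of partners of the list of \<open>q\<close>, which \<open>v\<close> does not touch. So the removed color is
determined, and with it the color of \<open>v\<close>.\<close>

lemma bad_unique_one:
  assumes q: "q \<in> Low" "q' \<in> Low" "adj q q'" and A: "A \<subseteq> V" "colors A \<phi>"
    and v: "v \<in> V - A" "adj v q'" "\<not> adj v q"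
    and b: "b1 \<in> avail A \<phi> v" "\<not> loose (insert v A) (\<phi>(v := b1)) q q'"
      "b2 \<in> avail A \<phi> v" "\<not> loose (insert v A) (\<phi>(v := b2)) q q'"
  shows "b1 = b2"
proof (rule ccontr)
  assume ne: "b1 \<noteq> b2"
  have vA: "v \<notin> A" using v by simp
  have qV: "q \<in> V" "q' \<in> V" using q Low_V by auto
  have conf: "\<exists>c\<in>avail A \<phi> q'. cf v b q' c" if "\<not> loose (insert v A) (\<phi>(v := b)) q q'" for b
  proof (rule ccontr)
    assume "\<not> ?thesis"
    then have "avail (insert v A) (\<phi>(v := b)) q' = avail A \<phi> q'" using avail_insert_adj[OF vA v(2)] by auto
    moreover have "V - (V - A) = A" using A(1) by auto
    then have "card (nbrs (V - A) q') \<le> card (avail A \<phi> q')"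
      using card_avail_low[of "V - A" \<phi> q'] A(2) q(2) by auto
    ultimately have "surplus (insert v A) (\<phi>(v := b)) q'"
      using nbrs_insert_adj[OF v(1,2)] unfolding surplus_def by simp
    then show False using that unfolding loose_def by simp
  qed
  obtain c1 where c1: "c1 \<in> avail A \<phi> q'" "cf v b1 q' c1" using conf[OF b(2)] by blast
  obtain c2 where c2: "c2 \<in> avail A \<phi> q'" "cf v b2 q' c2" using conf[OF b(4)] by blast
  have L: "b1 \<in> Lst v" "b2 \<in> Lst v" "c1 \<in> Lst q'" "c2 \<in> Lst q'" using b(1,3) c1(1) c2(1) by (auto simp: avail_def)
  have "\<not> cf v b1 q' c2"
  proof
    assume "cf v b1 q' c2"
    then have "b1 = b2"
      using cf_unique[OF adj_sym[OF v(2)] L(4) L(1,2) cf_sym cf_sym] c2(2) by blast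
    then show False using ne by simp
  qed
  then have "c2 \<in> avail (insert v A) (\<phi>(v := b1)) q'" using avail_insert_adj[OF vA v(2)] c2(1) by simp
  moreover have "aligned (insert v A) (\<phi>(v := b1)) q q'" using b(2) unfolding loose_def by simp
  ultimately obtain a where a: "a \<in> avail A \<phi> q" "cf q' c2 q a"
    using avail_insert_nonadj[OF vA v(3)] unfolding aligned_def by metis
  have "aligned (insert v A) (\<phi>(v := b2)) q q'" using b(4) unfolding loose_def by simp
  then obtain c where c: "c \<in> avail (insert v A) (\<phi>(v := b2)) q'" "cf q a q' c"
    using a(1) avail_insert_nonadj[OF vA v(3)] unfolding aligned_def by metis
  have cL: "c \<in> Lst q'" "a \<in> Lst q" using c(1) a(1) by (auto simp: avail_def)
  have "c = c2" by (rule cf_unique[OF q(3) cL(2,1) L(4) c(2) cf_sym[OF a(2)]])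
  then show False using c(1) c2(2) avail_insert_adj[OF vA v(2)] by simp
qed

text \<open>A loose pair without surplus has a color with no partner at the other vertex. Only the color of
\<open>v\<close> that removes this color can align the pair.\<close>

lemma bad_unique_both:
  assumes q: "q \<in> Low" "q' \<in> Low" and v: "v \<in> V - A" "adj v q" "adj v q'"
    and g: "loose A \<phi> q q'"
    and b: "b1 \<in> avail A \<phi> v" "\<not> loose (insert v A) (\<phi>(v := b1)) q q'"
      "b2 \<in> avail A \<phi> v" "\<not> loose (insert v A) (\<phi>(v := b2)) q q'"
  shows "b1 = b2"
proof -
  have vA: "v \<notin> A" using v by simp
  have qV: "q \<in> V" "q' \<in> V" using q Low_V by auto
  have main: "b1 = b2" if p: "p \<in> {q, q'}" "p' \<in> {q, q'}" "c \<in> avail A \<phi> p" "\<forall>c'\<in>avail A \<phi> p'. \<not> cf p c p' c'"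
    and al: "\<And>\<psi>. \<not> loose (insert v A) \<psi> q q' \<Longrightarrow> \<forall>c\<in>avail (insert v A) \<psi> p. \<exists>c'\<in>avail (insert v A) \<psi> p'. cf p c p' c'"
    for p p' c
  proof -
    have adjp: "adj v p" "adj v p'" using p(1,2) v(2,3) by auto
    have "cf v b p c" if ng: "\<not> loose (insert v A) (\<phi>(v := b)) q q'" for b
    proof (rule ccontr)
      assume "\<not> cf v b p c"
      then have "c \<in> avail (insert v A) (\<phi>(v := b)) p" using p(3) avail_insert_adj[OF vA adjp(1)] by simp
      then obtain c' where "c' \<in> avail (insert v A) (\<phi>(v := b)) p'" "cf p c p' c'" using al[OF ng] by blast
      then show False using p(4) avail_insert_adj[OF vA adjp(2)] by auto
    qed
    then have "cf v b1 p c" "cf v b2 p c" using b by auto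
    moreover have "b1 \<in> Lst v" "b2 \<in> Lst v" "c \<in> Lst p" using b(1,3) p(3) by (auto simp: avail_def)
    ultimately show ?thesis using cf_unique[OF adj_sym[OF adjp(1)]] cf_sym by blast
  qed
  have "\<not> surplus A \<phi> q" "\<not> surplus A \<phi> q'"
    using surplus_insert[OF v(1) b(1)] qV b(2) unfolding loose_def by auto
  then have "\<not> aligned A \<phi> q q'" using g unfolding loose_def by simp
  then consider c where "c \<in> avail A \<phi> q" "\<forall>c'\<in>avail A \<phi> q'. \<not> cf q c q' c'"
    | c where "c \<in> avail A \<phi> q'" "\<forall>c'\<in>avail A \<phi> q. \<not> cf q' c q c'"
    unfolding aligned_def by blast
  then show ?thesis
  proof cases
    case 1
    then show ?thesis by (intro main[of q q' c]) (auto simp: loose_def aligned_def)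
  next
    case 2
    then show ?thesis by (intro main[of q' q c]) (auto simp: loose_def aligned_def)
  qed
qed

end

section \<open>Coloring high vertices and the remaining cliques\<close>

context critical_cover begin

text \<open>The set in \<open>cap\<close> collects the pairs that \<open>v\<close> has to care for: those for which \<open>v\<close> is the last
vertex distinguishing \<open>q r\<close> from \<open>q' r\<close>, where looseness is created, or a later common neighbor,
where it is kept. Each of them excludes one color of \<open>v\<close>, and \<open>v\<close> has at least as many colors as
neighbors still uncolored in \<open>V - A0 - S\<close>, minus its excess.\<close>

lemma color_in_order:
  fixes pos :: "'a \<Rightarrow> nat" and q q' :: "'r \<Rightarrow> 'a"
  assumes S: "S \<subseteq> V" "A0 \<subseteq> V" "A0 \<inter> S = {}" and col0: "colors A0 \<phi>0" and inj: "inj_on pos S" and finR: "finite R"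
    and pair: "\<And>r. r \<in> R \<Longrightarrow> q r \<in> Low \<and> q' r \<in> Low \<and> adj (q r) (q' r)"
    and diff: "\<And>r. r \<in> R \<Longrightarrow> \<exists>u\<in>S. adj u (q r) \<noteq> adj u (q' r)"
    and cap: "\<And>v. v \<in> S \<Longrightarrow> card {r \<in> R. (adj v (q r) \<or> adj v (q' r)) \<and>
        (\<forall>u\<in>S. adj u (q r) \<noteq> adj u (q' r) \<longrightarrow> pos u \<le> pos v)} + excess v + 1 \<le> card (nbrs (V - A0 - S) v)"
  shows "\<exists>\<phi>. colors (A0 \<union> S) \<phi> \<and> (\<forall>r\<in>R. loose (A0 \<union> S) \<phi> (q r) (q' r))"
proof -
  let ?A = "\<lambda>n. A0 \<union> {v \<in> S. pos v < n}"
  have finS: "finite S" using S(1) finite_in_V by auto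
  have main: "\<exists>\<phi>. colors (?A n) \<phi> \<and>
    (\<forall>r\<in>R. (\<forall>u\<in>S. adj u (q r) \<noteq> adj u (q' r) \<longrightarrow> pos u < n) \<longrightarrow> loose (?A n) \<phi> (q r) (q' r))" for n
  proof (induction n)
    case 0
    have "colors (?A 0) \<phi>0" using col0 by simp
    moreover have False if "r \<in> R" "\<forall>u\<in>S. adj u (q r) \<noteq> adj u (q' r) \<longrightarrow> pos u < 0" for r
      using diff[OF that(1)] that(2) by auto
    ultimately show ?case by (intro exI[of _ \<phi>0] conjI ballI impI) auto
  next
    case (Suc n)
    from Suc.IH obtain \<phi> where \<phi>: "colors (?A n) \<phi>"
      "\<And>r. r \<in> R \<Longrightarrow> (\<forall>u\<in>S. adj u (q r) \<noteq> adj u (q' r) \<longrightarrow> pos u < n) \<Longrightarrow> loose (?A n) \<phi> (q r) (q' r)"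
      by blast
    show ?case
    proof (cases "\<exists>v\<in>S. pos v = n")
      case False
      have "pos v < Suc n \<longleftrightarrow> pos v < n" if "v \<in> S" for v using False that by (auto simp: less_Suc_eq)
      then have "?A (Suc n) = ?A n" "\<And>r. (\<forall>u\<in>S. adj u (q r) \<noteq> adj u (q' r) \<longrightarrow> pos u < Suc n)
        = (\<forall>u\<in>S. adj u (q r) \<noteq> adj u (q' r) \<longrightarrow> pos u < n)" by auto
      then show ?thesis using \<phi> by (intro exI[of _ \<phi>]) simp
    next
      case True
      then obtain v where v: "v \<in> S" "pos v = n" by blast
      have ltn: "pos u < n" if "u \<in> S" "pos u \<le> n" "u \<noteq> v" for u
        using inj_onD[OF inj, of u v] that v by (auto simp: le_less)
      have AV: "?A n \<subseteq> V" using S by auto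
      have vA: "v \<in> V - ?A n" using v S by auto
      have eA: "?A (Suc n) = insert v (?A n)" using v ltn by (auto simp: less_Suc_eq_le)
      define ch where "ch = {r \<in> R. (adj v (q r) \<or> adj v (q' r)) \<and>
        (\<forall>u\<in>S. adj u (q r) \<noteq> adj u (q' r) \<longrightarrow> pos u \<le> pos v)}"
      have finch: "finite ch" using finR by (simp add: ch_def)
      let ?bad = "\<lambda>r. {b \<in> avail (?A n) \<phi> v. \<not> loose (insert v (?A n)) (\<phi>(v := b)) (q r) (q' r)}"
      have finav: "finite (avail (?A n) \<phi> v)" using vA by (intro finite_avail) simp
      have bad1: "card (?bad r) \<le> 1" if r: "r \<in> ch" for r
      proof -
        have rR: "r \<in> R" using r by (simp add: ch_def)
        have p: "q r \<in> Low" "q' r \<in> Low" "adj (q r) (q' r)" using pair[OF rR] by auto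
        have "b1 = b2" if b: "b1 \<in> ?bad r" "b2 \<in> ?bad r" for b1 b2
        proof -
          have b': "b1 \<in> avail (?A n) \<phi> v" "\<not> loose (insert v (?A n)) (\<phi>(v := b1)) (q r) (q' r)"
            "b2 \<in> avail (?A n) \<phi> v" "\<not> loose (insert v (?A n)) (\<phi>(v := b2)) (q r) (q' r)" using b by auto
          consider "adj v (q' r)" "\<not> adj v (q r)" | "adj v (q r)" "\<not> adj v (q' r)"
            | "adj v (q r)" "adj v (q' r)" using r unfolding ch_def by blast
          then show ?thesis
          proof cases
            case 1
            then show ?thesis by (rule bad_unique_one[OF p AV \<phi>(1) vA _ _ b'])
          next
            case 2
            have gs: "loose (insert v (?A n)) \<psi> (q r) (q' r) = loose (insert v (?A n)) \<psi> (q' r) (q r)" for \<psi>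
              by (rule loose_sym)
            show ?thesis
              by (rule bad_unique_one[OF p(2,1) adj_sym[OF p(3)] AV \<phi>(1) vA 2 b'(1) _ b'(3)])
                (use b'(2,4) in \<open>simp_all only: gs not_False_eq_True\<close>)
          next
            case 3
            have "\<forall>u\<in>S. adj u (q r) \<noteq> adj u (q' r) \<longrightarrow> pos u < n"
            proof (intro ballI impI)
              fix u assume u: "u \<in> S" "adj u (q r) \<noteq> adj u (q' r)"
              have "pos u \<le> n" using r u v(2) unfolding ch_def by blast
              moreover have "u \<noteq> v" using u(2) 3 by metis
              ultimately show "pos u < n" using ltn u(1) by blast
            qed
            then have "loose (?A n) \<phi> (q r) (q' r)" by (rule \<phi>(2)[OF rR])
            then show ?thesis by (rule bad_unique_both[OF p(1,2) vA 3 _ b'])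
          qed
        qed
        then have "\<forall>b1\<in>?bad r. \<forall>b2\<in>?bad r. b1 = b2" by (intro ballI)
        moreover have "finite (?bad r)" using finav by simp
        ultimately show ?thesis unfolding One_nat_def by (simp only: card_le_Suc0_iff_eq)
      qed
      have "card (\<Union>r\<in>ch. ?bad r) \<le> (\<Sum>r\<in>ch. card (?bad r))" by (rule card_UN_le[OF finch])
      also have "\<dots> \<le> (\<Sum>r\<in>ch. 1)" using bad1 by (rule sum_mono)
      finally have "card (\<Union>r\<in>ch. ?bad r) \<le> card ch" by simp
      moreover have "card ch + excess v + 1 \<le> card (nbrs (V - A0 - S) v)" using cap[OF v(1)] unfolding ch_def .
      moreover have "d \<le> card (avail (?A n) \<phi> v) + card (nbrs (?A n) v)"
        using \<phi>(1) vA by (intro card_avail_ge) (auto simp: colors_def)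
      moreover have "card (nbrs (?A n) v) + card (nbrs (V - A0 - S) v) \<le> card (nbrs V v)"
      proof -
        have "?A n \<inter> (V - A0 - S) = {}" by auto
        then have "card (nbrs (?A n) v) + card (nbrs (V - A0 - S) v) = card (nbrs (?A n \<union> (V - A0 - S)) v)"
          by (rule card_nbrs_Un[symmetric])
        also have "\<dots> \<le> card (nbrs V v)" using AV by (intro card_nbrs_mono) auto
        finally show ?thesis .
      qed
      moreover have "card (nbrs V v) = d + excess v" using vA by (intro deg_eq) simp
      ultimately have lt: "card (\<Union>r\<in>ch. ?bad r) < card (avail (?A n) \<phi> v)" by linarith
      have "\<not> avail (?A n) \<phi> v \<subseteq> (\<Union>r\<in>ch. ?bad r)"
      proof
        assume "avail (?A n) \<phi> v \<subseteq> (\<Union>r\<in>ch. ?bad r)"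
        moreover have "finite (\<Union>r\<in>ch. ?bad r)" using finch finav by simp
        ultimately have "card (avail (?A n) \<phi> v) \<le> card (\<Union>r\<in>ch. ?bad r)" by (intro card_mono)
        then show False using lt by simp
      qed
      then obtain b where b: "b \<in> avail (?A n) \<phi> v" "b \<notin> (\<Union>r\<in>ch. ?bad r)" by blast
      let ?\<psi> = "\<phi>(v := b)"
      have "colors (?A (Suc n)) ?\<psi>" unfolding eA using vA by (intro colors_insert[OF \<phi>(1) _ b(1)]) simp
      moreover have "loose (?A (Suc n)) ?\<psi> (q r) (q' r)"
        if r: "r \<in> R" "\<forall>u\<in>S. adj u (q r) \<noteq> adj u (q' r) \<longrightarrow> pos u < Suc n" for r
      proof (cases "r \<in> ch")
        case True
        then show ?thesis unfolding eA using b by blast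
      next
        case False
        have le: "\<forall>u\<in>S. adj u (q r) \<noteq> adj u (q' r) \<longrightarrow> pos u \<le> pos v" using r(2) v(2) by (simp add: less_Suc_eq_le)
        then have na: "\<not> adj v (q r)" "\<not> adj v (q' r)" using False r(1) unfolding ch_def by auto
        have "\<forall>u\<in>S. adj u (q r) \<noteq> adj u (q' r) \<longrightarrow> pos u < n"
        proof (intro ballI impI)
          fix u assume u: "u \<in> S" "adj u (q r) \<noteq> adj u (q' r)"
          have "u \<noteq> v" using u(2) na by metis
          then show "pos u < n" using ltn u le v(2) by blast
        qed
        then have "loose (?A n) \<phi> (q r) (q' r)" by (rule \<phi>(2)[OF r(1)])
        then show ?thesis unfolding eA by (rule loose_insert_nonadj[OF vA na])
      qed
      ultimately show ?thesis by blast
    qed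
  qed
  obtain N where N: "\<And>v. v \<in> S \<Longrightarrow> pos v < N"
    using finS by (metis finite_imageI finite_nat_set_iff_bounded image_eqI)
  then have AN: "?A N = A0 \<union> S" by auto
  with main[of N, unfolded AN] obtain \<phi> where "colors (A0 \<union> S) \<phi>"
    "\<forall>r\<in>R. (\<forall>u\<in>S. adj u (q r) \<noteq> adj u (q' r) \<longrightarrow> pos u < N) \<longrightarrow> loose (A0 \<union> S) \<phi> (q r) (q' r)"
    by metis
  then show ?thesis using N by (intro exI[of _ \<phi>]) simp
qed

text \<open>With surplus color \<open>Q\<close> greedily. Otherwise give one vertex of the pair a color without partner at the
other one, which then has a color to spare.\<close>

lemma color_clique:
  assumes Q: "Q \<subseteq> Low" "clique Q" and A: "A \<subseteq> V" "A \<inter> Q = {}" "colors A \<phi>"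
    and iso: "\<And>q. q \<in> Q \<Longrightarrow> nbrs (V - A) q \<subseteq> Q"
    and q: "q1 \<in> Q" "q2 \<in> Q" "q1 \<noteq> q2" "loose A \<phi> q1 q2"
  shows "\<exists>\<psi>. colors (A \<union> Q) \<psi> \<and> (\<forall>a\<in>A. \<psi> a = \<phi> a)"
proof -
  have QV: "Q \<subseteq> V" using Q Low_V by auto
  have finQ: "finite Q" using QV finite_in_V by auto
  have nbQ: "nbrs (V - A) y = nbrs Q y" if "y \<in> Q" for y
    using iso[OF that] QV A(2) unfolding nbrs_def by blast
  have cQ: "card (nbrs Q y) = card Q - 1" if "y \<in> Q" for y
    using clique_nbrs[OF Q(2) that] that by (simp add: card_Diff_singleton)
  have VA: "V - (V - A) = A" using A(1) by auto
  have ge: "card (nbrs Q y) \<le> card (avail A \<phi> y)" if "y \<in> Q" for y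
    using card_avail_low[of "V - A" \<phi> y] VA A(3) nbQ[OF that] Q(1) that by auto
  have sur: ?thesis if "z \<in> Q" "surplus A \<phi> z" for z
    using that nbQ[OF that(1)] unfolding surplus_def
    by (intro greedy_linked[OF QV A(2,3) clique_linked[OF Q(2)] ge that(1)]) simp_all
  have main: ?thesis if p: "p \<in> Q" "p' \<in> Q" "p \<noteq> p'" and b: "b \<in> avail A \<phi> p" "\<forall>c\<in>avail A \<phi> p'. \<not> cf p b p' c" for p p' b
  proof -
    let ?A = "insert p A" and ?Q = "Q - {p}"
    have pA: "p \<notin> A" using A(2) p(1) by auto
    have c1: "colors ?A (\<phi>(p := b))" by (rule colors_insert[OF A(3) pA b(1)])
    have clQ: "clique ?Q" by (rule clique_subset[OF Q(2)]) auto
    have cQ': "card (nbrs ?Q y) = card Q - 2" if "y \<in> ?Q" for y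
    proof -
      have "card (nbrs ?Q y) = card ?Q - 1" using clique_nbrs[OF clQ that] that by (simp add: card_Diff_singleton)
      then show ?thesis using p(1) by (simp add: card_Diff_singleton)
    qed
    have c2: "2 \<le> card Q" using card_mono[OF finQ, of "{p, p'}"] p by simp
    have ge': "card (nbrs ?Q y) \<le> card (avail ?A (\<phi>(p := b)) y)" if y: "y \<in> ?Q" for y
    proof -
      have "card (avail A \<phi> y) \<le> card (avail (A \<union> {p}) (\<phi>(p := b)) y) + card (nbrs {p} y)"
        using b(1) pA y QV by (intro card_avail_Un) (auto simp: avail_def)
      moreover have "card (nbrs {p} y) \<le> card {p}" unfolding nbrs_def by (rule card_mono) auto
      ultimately show ?thesis using ge[of y] cQ[of y] cQ'[OF y] y by simp
    qed
    have "avail ?A (\<phi>(p := b)) p' = avail A \<phi> p'" using avail_insert[OF pA] b(2) by auto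
    then have gt: "card (nbrs ?Q p') < card (avail ?A (\<phi>(p := b)) p')"
      using ge[OF p(2)] cQ[OF p(2)] cQ'[of p'] p c2 by simp
    have "\<exists>\<psi>. colors (?A \<union> ?Q) \<psi> \<and> (\<forall>a\<in>?A. \<psi> a = (\<phi>(p := b)) a)"
      using QV A(2) p by (intro greedy_linked[OF _ _ c1 clique_linked[OF clQ] ge' _ gt]) auto
    moreover have "?A \<union> ?Q = A \<union> Q" using p(1) by auto
    ultimately obtain \<psi> where "colors (A \<union> Q) \<psi>" "\<forall>a\<in>?A. \<psi> a = (\<phi>(p := b)) a" by auto
    moreover have "\<psi> a = \<phi> a" if "a \<in> A" for a
    proof -
      have "a \<noteq> p" using that pA by metis
      then show ?thesis using \<open>\<forall>a\<in>?A. \<psi> a = (\<phi>(p := b)) a\<close> that by simp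
    qed
    ultimately show ?thesis by blast
  qed
  consider "surplus A \<phi> q1" | "surplus A \<phi> q2"
    | b where "b \<in> avail A \<phi> q1" "\<forall>c\<in>avail A \<phi> q2. \<not> cf q1 b q2 c"
    | b where "b \<in> avail A \<phi> q2" "\<forall>c\<in>avail A \<phi> q1. \<not> cf q2 b q1 c"
    using q(4) unfolding loose_def aligned_def by blast
  then show ?thesis
  proof cases
    case 1 then show ?thesis by (rule sur[OF q(1)])
  next
    case 2 then show ?thesis by (rule sur[OF q(2)])
  next
    case 3 then show ?thesis by (rule main[OF q(1,2,3)])
  next
    case 4 then show ?thesis using q(3) by (intro main[OF q(2,1)]) auto
  qed
qed

lemma color_isolated_cliques:
  assumes "finite R" and "\<And>Q. Q \<in> R \<Longrightarrow> Q \<subseteq> Low \<and> clique Q \<and> q1 Q \<in> Q \<and> q2 Q \<in> Q \<and> q1 Q \<noteq> q2 Q"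
    and "disjoint R" and A: "A \<subseteq> V" "colors A \<phi>" "V - A = \<Union>R"
    and "\<And>Q y. Q \<in> R \<Longrightarrow> y \<in> Q \<Longrightarrow> nbrs (V - A) y \<subseteq> Q"
    and "\<And>Q. Q \<in> R \<Longrightarrow> loose A \<phi> (q1 Q) (q2 Q)"
  shows False
  using assms
proof (induction "card R" arbitrary: R A \<phi>)
  case 0
  then have "V - A = {}" by simp
  then have "A = V" using 0 by auto
  then show ?case using 0 uncolorable by auto
next
  case (Suc n)
  then obtain Q where Q: "Q \<in> R" by (metis card.empty ex_in_conv nat.distinct(1))
  have Qp: "Q \<subseteq> Low" "clique Q" "q1 Q \<in> Q" "q2 Q \<in> Q" "q1 Q \<noteq> q2 Q" using Suc.prems(2)[OF Q] by auto
  have AQ: "A \<inter> Q = {}" using Suc.prems(6) Q by auto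
  obtain \<psi> where \<psi>: "colors (A \<union> Q) \<psi>" "\<forall>a\<in>A. \<psi> a = \<phi> a"
    using color_clique[OF Qp(1,2) Suc.prems(4) AQ Suc.prems(5) Suc.prems(7)[OF Q] Qp(3,4,5) Suc.prems(8)[OF Q]]
    by blast
  let ?R = "R - {Q}"
  have disj: "Q' \<inter> Q = {}" if "Q' \<in> ?R" for Q' using Suc.prems(3) Q that unfolding disjoint_def by auto
  have eV: "V - (A \<union> Q) = \<Union>?R"
    using Suc.prems(6) disj by auto
  have nba: "\<not> adj y z" if Q': "Q' \<in> ?R" "y \<in> Q'" "z \<in> Q" for Q' y z
  proof
    assume "adj y z"
    moreover have "z \<in> V - A" using Q Q'(3) Suc.prems(6) by auto
    ultimately have "z \<in> Q'" using Suc.prems(7)[of Q' y] Q' by auto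
    then show False using disj[OF Q'(1)] Q'(3) by auto
  qed
  have nbe: "nbrs (V - (A \<union> Q)) y = nbrs (V - A) y" if "Q' \<in> ?R" "y \<in> Q'" for Q' y
    using nba[OF that] by auto
  have ave: "avail (A \<union> Q) \<psi> y = avail A \<phi> y" if "Q' \<in> ?R" "y \<in> Q'" for Q' y
  proof -
    have "\<not> adj z y" if "z \<in> Q" for z using nba[OF \<open>Q' \<in> ?R\<close> \<open>y \<in> Q'\<close> that] adj_sym by metis
    then show ?thesis using \<psi>(2) unfolding avail_def by auto
  qed
  show ?case
  proof (rule Suc.hyps(1)[of ?R "A \<union> Q" \<psi>])
    show "n = card ?R" using Suc.hyps(2) Suc.prems(1) Q by simp
    show "finite ?R" using Suc.prems(1) by simp
    show "Q' \<subseteq> Low \<and> clique Q' \<and> q1 Q' \<in> Q' \<and> q2 Q' \<in> Q' \<and> q1 Q' \<noteq> q2 Q'" if "Q' \<in> ?R" for Q'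
      using Suc.prems(2) that by blast
    show "disjoint ?R" using Suc.prems(3) unfolding disjoint_def by blast
    show "A \<union> Q \<subseteq> V" using Suc.prems(4) Qp(1) Low_V by auto
    show "nbrs (V - (A \<union> Q)) y \<subseteq> Q'" if "Q' \<in> ?R" "y \<in> Q'" for Q' y
      using nbe[OF that] Suc.prems(7)[of Q' y] that by simp
    show "loose (A \<union> Q) \<psi> (q1 Q') (q2 Q')" if Q': "Q' \<in> ?R" for Q'
    proof -
      have "q1 Q' \<in> Q'" "q2 Q' \<in> Q'" "loose A \<phi> (q1 Q') (q2 Q')" using Suc.prems(2,8) Q' by auto
      then show ?thesis using nbe[OF Q'] ave[OF Q'] unfolding loose_def surplus_def aligned_def by metis
    qed
  qed (use \<psi> eV in auto)
qed

end

section \<open>The excess for large degree\<close>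

context critical_cover begin

lemma excess_le_eighth:
  assumes "v \<in> V" "9 * excess v \<le> card (nbrs X v)" "X \<subseteq> V"
  shows "8 * excess v \<le> d"
  using card_nbrs_mono[OF assms(3), of v] deg_eq[OF assms(1)] assms(2) by simp

text \<open>The obstruction to finding two vertices of \<open>Q\<close> told apart by a high neighbor: all outside
neighbors of \<open>q\<close> are complete to \<open>K\<close>, where \<open>K\<close> misses at most one vertex of \<open>Q\<close>. By
\<open>two_nonadjacent\<close> they are pairwise adjacent and complete to \<open>Q\<close>. Since \<open>q\<close> is low, they form
with \<open>Q\<close> a clique on \<open>d + 1\<close> vertices.\<close>

lemma whole_clique_neighbourhood:
  assumes d: "8 \<le> d" and Q: "Q \<subseteq> Low" "clique Q" "5 * d + 8 < 8 * card Q"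
    and K: "K \<subseteq> Q" "Q - {p} \<subseteq> K"
    and q: "q \<in> K" and out: "\<And>v. v \<in> nbrs V q - Q \<Longrightarrow> 8 * excess v \<le> d"
    and all: "\<And>v y. v \<in> nbrs V q - Q \<Longrightarrow> y \<in> K \<Longrightarrow> adj v y"
  shows False
proof -
  let ?D = "nbrs V q - Q"
  have qQ: "q \<in> Q" using q K by auto
  have QV: "Q \<subseteq> V" and finQ: "finite Q" using Q(1) Low_V finite_in_V by auto
  have clK: "clique K" by (rule clique_subset[OF Q(2) K(1)])
  have KLo: "K \<subseteq> Low" using K Q by auto
  have DV: "?D \<subseteq> V" by auto
  have finD: "finite ?D" by simp
  have "Q \<subseteq> insert p K" using K(2) by auto
  then have "card Q \<le> card (insert p K)" using K(1) finQ by (intro card_mono) (auto intro: finite_subset)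
  also have "\<dots> \<le> card K + 1" using card_insert_le_m1[of "card K + 1" K p] by simp
  finally have cK: "card Q \<le> card K + 1" .
  have "nbrs V q \<inter> Q = Q - {q}"
    using clique_nbrs[OF Q(2) qQ] QV unfolding nbrs_def by auto
  then have "card (nbrs V q) = card (Q - {q}) + card ?D"
    using card_Int_Diff[of "nbrs V q" Q] by simp
  moreover have "card (nbrs V q) = d" using q KLo by (auto simp: Low_def)
  moreover have "card (Q - {q}) + 1 = card Q" using card_Suc_Diff1[OF finQ qQ] by linarith
  ultimately have QD: "card Q + card ?D = d + 1" by linarith
  have nbK: "nbrs K v = K" if "v \<in> ?D" for v using all[OF that] by auto
  have large: "3 * d \<ge> 24" "5 * d \<le> 8 * card K" using d cK Q(3) by linarith+
  have adjD: "adj v w" if v: "v \<in> ?D" and w: "w \<in> ?D" and ne: "v \<noteq> w" for v w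
  proof (rule ccontr)
    assume na: "\<not> adj v w"
    have xs: "8 * excess v \<le> d" "8 * excess w \<le> d" using out v w by auto
    have vK: "v \<notin> K" "w \<notin> K" using v w K(1) by auto
    have "excess v < card (nbrs K v)" "excess w < card (nbrs K w)"
      using xs large unfolding nbK[OF v] nbK[OF w] by linarith+
    then have "card (nbrs K v) + card (nbrs K w) \<le> card K + 1 + excess v + excess w"
      by (rule two_nonadjacent[OF KLo clK q all[OF v q] all[OF w q] vK ne na])
    then show False using xs large unfolding nbK[OF v] nbK[OF w] by linarith
  qed
  have adjQ: "adj v y" if v: "v \<in> ?D" and y: "y \<in> Q" for v y
  proof (rule ccontr)
    assume na: "\<not> adj v y"
    then have yK: "y \<notin> K" using all[OF v] by auto
    have Ky: "K = Q - {y}" using K y yK by auto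
    have xs: "8 * excess v \<le> d" "excess y = 0" using out[OF v] excess_low[of y] y Q(1) by auto
    have nby: "nbrs K y = K" using clique_nbrs[OF Q(2) y] Ky unfolding nbrs_def by auto
    have yq: "adj y q" using cliqueD[OF Q(2) y qQ] yK q by auto
    have vK: "v \<notin> K" "v \<noteq> y" using v y K(1) by auto
    have "excess v < card (nbrs K v)" "excess y < card (nbrs K y)"
      using xs large unfolding nbK[OF v] nby by linarith+
    then have "card (nbrs K v) + card (nbrs K y) \<le> card K + 1 + excess v + excess y"
      by (rule two_nonadjacent[OF KLo clK q all[OF v q] yq vK(1) yK vK(2) na])
    then show False using xs large unfolding nbK[OF v] nby by linarith
  qed
  have "clique (Q \<union> ?D)"
    unfolding clique_def
  proof (intro conjI ballI impI)
    show "Q \<union> ?D \<subseteq> V" using QV DV by auto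
    fix u w assume u: "u \<in> Q \<union> ?D" and w: "w \<in> Q \<union> ?D" and ne: "u \<noteq> w"
    consider "u \<in> Q" "w \<in> Q" | "u \<in> ?D" "w \<in> Q" | "u \<in> Q" "w \<in> ?D" | "u \<in> ?D" "w \<in> ?D"
      using u w by blast
    then show "adj u w"
    proof cases
      case 1 then show ?thesis using cliqueD[OF Q(2)] ne by blast
    next
      case 2 then show ?thesis by (rule adjQ)
    next
      case 3 show ?thesis by (rule adj_sym[OF adjQ[OF 3(2,1)]])
    next
      case 4 then show ?thesis using adjD ne by blast
    qed
  qed
  then have "card (Q \<union> ?D) \<le> d" by (rule clique_bound)
  moreover have "card (Q \<union> ?D) = card Q + card ?D" using finQ finD by (intro card_Un_disjoint) auto
  ultimately show False using QD by simp
qed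

lemma sum_nbrs_disjoint:
  assumes "disjoint F" "finite F"
  shows "(\<Sum>Q\<in>F. card (nbrs Q v)) = card (nbrs (\<Union>F) v)"
proof -
  have "nbrs (\<Union>F) v = (\<Union>Q\<in>F. nbrs Q v)" by (auto simp: nbrs_def)
  moreover have "card (\<Union>Q\<in>F. nbrs Q v) = (\<Sum>Q\<in>F. card (nbrs Q v))"
  proof (intro card_UN_disjoint ballI impI)
    fix Q Q' assume "Q \<in> F" "Q' \<in> F" "Q \<noteq> Q'"
    then have "Q \<inter> Q' = {}" using assms(1) unfolding disjoint_def by blast
    moreover have "nbrs Q v \<subseteq> Q" "nbrs Q' v \<subseteq> Q'" by (auto simp: nbrs_def)
    ultimately show "nbrs Q v \<inter> nbrs Q' v = {}" by blast
  qed (use assms(2) in simp_all)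
  ultimately show ?thesis by simp
qed

text \<open>A light vertex, for which almost every edge goes to a clique of its own, has few edges to any single
clique.\<close>

lemma light_multiplicity:
  assumes F: "disjoint F" "finite F" and Q: "Q \<in> F"
    and light: "card (nbrs (\<Union>F) v) \<le> card {Q \<in> F. nbrs Q v \<noteq> {}} + excess v"
  shows "card (nbrs Q v) \<le> excess v + 1"
proof (cases "nbrs Q v = {}")
  case False
  let ?N = "{Q \<in> F. nbrs Q v \<noteq> {}}"
  have QN: "Q \<in> ?N" using Q False by simp
  have finN: "finite ?N" using F(2) by simp
  have "card ?N - 1 = (\<Sum>Q\<in>?N - {Q}. 1)" using QN by (simp add: card_Diff_singleton)
  also have "\<dots> \<le> (\<Sum>Q\<in>?N - {Q}. card (nbrs Q v))"
    by (intro sum_mono) (auto simp: Suc_le_eq card_gt_0_iff)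
  finally have "card (nbrs Q v) + (card ?N - 1) \<le> (\<Sum>Q\<in>?N. card (nbrs Q v))"
    using sum.remove[OF finN QN, of "\<lambda>Q. card (nbrs Q v)"] by simp
  also have "\<dots> \<le> (\<Sum>Q\<in>F. card (nbrs Q v))" using F(2) by (intro sum_mono2) auto
  also have "\<dots> = card (nbrs (\<Union>F) v)" by (rule sum_nbrs_disjoint[OF F])
  finally have "card (nbrs Q v) + (card ?N - 1) \<le> card ?N + excess v" using light by simp
  moreover have "card ?N \<ge> 1" using QN finN by (auto simp: Suc_le_eq card_gt_0_iff)
  ultimately show ?thesis by linarith
qed simp

text \<open>Apply \<open>peeling\<close>, color everything except \<open>S\<close> and \<open>\<Union>F\<close> by criticality, then \<open>S\<close>, then the
cliques. A clique with a neighbor in a clique of smaller rank can be colored before that one, and then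
has a color to spare. Only the other cliques, the roots, need a loose pair; roots are pairwise
nonadjacent.

A heavy vertex of \<open>S\<close> has enough colors to care for every clique it meets, so heavy vertices come
last in the order. A root that has two vertices told apart by a heavy vertex uses such a pair. In any
other root every vertex of \<open>Qp Q\<close> has a light neighbor by \<open>whole_clique_neighbourhood\<close>, and the last
light neighbor of one vertex of the pair is the only light vertex that must care for the pair. Each
root has two candidates for this vertex, and \<open>balanced_orientation\<close> chooses among them such that a
light vertex cares for about half as many roots as it has edges to cliques.\<close>

lemma excess_large_degree:
  assumes d: "24 \<le> d" and ne: "V \<noteq> {}"
  shows "card V < 24 * (\<Sum>v\<in>V. excess v)"
proof (rule ccontr)
  assume "\<not> ?thesis"
  then have n: "24 * (\<Sum>v\<in>V. excess v) \<le> card V" by simp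
  have "5 \<le> d" using d by simp
  then obtain QQ f p where D: "decomp Low QQ f p" using decomposition[of Low] by blast
  obtain S F where S: "S \<subseteq> V - Low" and F: "F \<subseteq> QQ" "F \<noteq> {}"
    and Sx: "\<And>v. v \<in> S \<Longrightarrow> 9 * excess v \<le> card (nbrs (\<Union>F) v)"
    and Fl: "\<And>Q. Q \<in> F \<Longrightarrow> 3 * card (lost S Q) < 2 * card Q"
    using peeling[OF d D ne n] by blast
  define X where "X = \<Union>F"
  have FQ: "Q \<subseteq> Low" "clique Q" "5 * d + 8 < 8 * card Q" if "Q \<in> F" for Q
    using decompD(2-4)[OF D] F that by auto
  have rank: "q = p Q" if "Q \<in> F" "Q' \<in> F" "f Q < f Q'" "q \<in> Q" "q' \<in> Q'" "adj q q'" for Q Q' q q'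
    using decompD(6)[OF D] F that by blast
  have injf: "inj_on f F" using decompD(5)[OF D] F inj_on_subset by blast
  have disF: "disjoint F" using decompD(1)[OF D] F by (auto simp: disjoint_def)
  have XLo: "X \<subseteq> Low" using FQ(1) by (auto simp: X_def)
  have XV: "X \<subseteq> V" using XLo Low_V by auto
  have SV: "S \<subseteq> V" and SX: "S \<inter> X = {}" using S XLo by auto
  have finS: "finite S" and finX: "finite X" using SV XV finite_in_V by auto
  have finF: "finite F"
  proof (rule finite_subset)
    show "F \<subseteq> Pow X" by (auto simp: X_def)
  qed (use finX in simp)
  have finQ: "finite Q" if "Q \<in> F" for Q using that finX by (auto simp: X_def intro: finite_subset)
  have x1: "1 \<le> excess v" if "v \<in> S" for v using excess_high S that by auto
  have x8: "8 * excess v \<le> d" if "v \<in> S" for v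
    using excess_le_eighth[of v "\<Union>F"] Sx[OF that] SV XV that unfolding X_def by auto
  define c where "c v = card {Q \<in> F. nbrs Q v \<noteq> {}}" for v
  define heavy where "heavy v \<longleftrightarrow> c v + excess v + 1 \<le> card (nbrs X v)" for v
  have lightm: "card (nbrs Q v) \<le> excess v + 1" if "Q \<in> F" "\<not> heavy v" for Q v
    using light_multiplicity[OF disF finF that(1), of v] that(2) unfolding heavy_def c_def X_def by linarith
  \<comment> \<open>Light vertices precede heavy ones in the order \<open>pos\<close>.\<close>
  obtain h :: "'a \<Rightarrow> nat" where h: "inj_on h S" using finite_imp_inj_to_nat_seg[OF finS] by blast
  obtain M where M: "\<And>v. v \<in> S \<Longrightarrow> h v < M"
    using finS by (metis finite_imageI finite_nat_set_iff_bounded image_eqI)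
  define pos where "pos v = (if heavy v then M + h v else h v)" for v
  have inj: "inj_on pos S"
  proof (rule inj_onI)
    fix u v assume "u \<in> S" "v \<in> S" "pos u = pos v"
    then show "u = v" using M[of u] M[of v] inj_onD[OF h, of u v] by (auto simp: pos_def split: if_splits)
  qed
  have pos_heavy: "heavy v" if "u \<in> S" "v \<in> S" "heavy u" "pos u \<le> pos v" for u v
    using M[OF that(2)] that by (auto simp: pos_def split: if_splits)
  \<comment> \<open>Vertices of \<open>Q0 Q\<close> have no neighbor in other cliques of \<open>F\<close>; in a root only the attaching
    vertex can have one. All outside neighbors of vertices of \<open>Qp Q\<close> are in \<open>S\<close>.\<close>
  define R where "R = {Q \<in> F. \<forall>Q'\<in>F. f Q' < f Q \<longrightarrow> (\<forall>q\<in>Q. \<forall>q'\<in>Q'. \<not> adj q q')}"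
  have RF: "R \<subseteq> F" by (auto simp: R_def)
  define Q0 where "Q0 Q = {q \<in> Q. nbrs X q \<subseteq> Q}" for Q
  have Q0p: "Q - {p Q} \<subseteq> Q0 Q" if Q: "Q \<in> R" for Q
  proof
    fix q assume q: "q \<in> Q - {p Q}"
    have "z \<in> Q" if z: "z \<in> nbrs X q" for z
    proof (rule ccontr)
      assume zQ: "z \<notin> Q"
      obtain Q' where Q': "Q' \<in> F" "z \<in> Q'" using z by (auto simp: X_def)
      have QF: "Q \<in> F" using Q RF by auto
      have "f Q \<noteq> f Q'" using inj_onD[OF injf _ QF Q'(1)] zQ Q'(2) by auto
      then consider "f Q < f Q'" | "f Q' < f Q" by linarith
      then show False
      proof cases
        case 1
        then show False using rank[OF QF Q'(1) 1, of q z] q z Q' by auto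
      next
        case 2
        then show False using Q q z Q' unfolding R_def by auto
      qed
    qed
    then show "q \<in> Q0 Q" using q by (auto simp: Q0_def)
  qed
  define Qp where "Qp Q = Q - lost S Q" for Q
  have Qp_nb: "q \<in> Q" "nbrs V q \<subseteq> Q \<union> S" if "q \<in> Qp Q" for q Q
    using that by (auto simp: Qp_def lost_def)
  have QpQ0: "Qp Q \<subseteq> Q0 Q" for Q
  proof
    fix q assume "q \<in> Qp Q"
    then have "q \<in> Q" "nbrs V q \<subseteq> Q \<union> S" by (rule Qp_nb)+
    moreover have "nbrs X q \<subseteq> nbrs V q \<inter> X" using XV by auto
    ultimately show "q \<in> Q0 Q" using SX unfolding Q0_def by blast
  qed
  have Qp_card: "card Q < 3 * card (Qp Q)" if "Q \<in> F" for Q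
  proof -
    have "lost S Q \<subseteq> Q" by (auto simp: lost_def)
    then have "card (Qp Q) + card (lost S Q) = card Q"
      using finQ[OF that] card_mono[OF finQ[OF that], of "lost S Q"]
      by (simp add: Qp_def card_Diff_subset finite_subset)
    then show ?thesis using Fl[OF that] by linarith
  qed
  define splits where "splits Q q q' \<longleftrightarrow> q \<in> Q0 Q \<and> q' \<in> Q0 Q \<and> (\<exists>u\<in>S. heavy u \<and> adj u q \<noteq> adj u q')" for Q q q'
  define RH where "RH = {Q \<in> R. \<exists>q q'. splits Q q q'}"
  have "\<forall>Q\<in>RH. \<exists>q q'. splits Q q q'" by (simp add: RH_def)
  then obtain hq hq' where hq: "\<And>Q. Q \<in> RH \<Longrightarrow> splits Q (hq Q) (hq' Q)" by metis
  \<comment> \<open>From here on, the roots in \<open>R - RH\<close>, with \<open>L q\<close> the last light neighbor of \<open>q\<close>.\<close>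
  define N where "N q = {u \<in> S. \<not> heavy u \<and> adj u q}" for q
  have finN: "finite (N q)" for q using finS by (simp add: N_def)
  have N_ne: "N q \<noteq> {}" if Q: "Q \<in> R" "Q \<notin> RH" and q: "q \<in> Qp Q" for Q q
  proof
    assume N0: "N q = {}"
    have QF: "Q \<in> F" using Q RF by auto
    have hv: "v \<in> S" "heavy v" if "v \<in> nbrs V q - Q" for v
    proof -
      show "v \<in> S" using Qp_nb[OF q] that by auto
      then show "heavy v" using N0 that adj_sym[of q v] by (auto simp: N_def)
    qed
    have "adj v y" if v: "v \<in> nbrs V q - Q" and y: "y \<in> Q0 Q" for v y
    proof (rule ccontr)
      assume na: "\<not> adj v y"
      have "adj v q" using v adj_sym by auto
      then have "splits Q q y" unfolding splits_def using hv[OF v] na y q QpQ0 by blast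
      then show False using Q unfolding RH_def by blast
    qed
    moreover have "8 * excess v \<le> d" if "v \<in> nbrs V q - Q" for v using hv[OF that] x8 by blast
    moreover have "Q0 Q \<subseteq> Q" by (auto simp: Q0_def)
    moreover have "q \<in> Q0 Q" using q QpQ0 by blast
    moreover have "8 \<le> d" using d by simp
    ultimately show False using whole_clique_neighbourhood[OF _ FQ[OF QF] _ Q0p[OF Q(1)]] by blast
  qed
  define L where "L q = (ARG_MAX pos u. u \<in> N q)" for q
  have L: "L q \<in> N q" "\<And>u. u \<in> N q \<Longrightarrow> pos u \<le> pos (L q)" if Nq: "N q \<noteq> {}" for q
  proof -
    have "finite (pos ` N q)" using finN by simp
    moreover obtain u0 where "u0 \<in> N q" using Nq by (meson ex_in_conv)
    ultimately have "L q \<in> N q \<and> (\<forall>u. u \<in> N q \<longrightarrow> pos u \<le> pos (L q))"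
      unfolding L_def
      by (intro arg_max_nat_lemma[of "\<lambda>u. u \<in> N q" u0 pos "Suc (Max (pos ` N q))"]) (auto simp: less_Suc_eq_le)
    then show "L q \<in> N q" "\<And>u. u \<in> N q \<Longrightarrow> pos u \<le> pos (L q)" by auto
  qed
  have ex: "\<exists>q0 e1 e2. q0 \<in> Qp Q \<and> e1 \<in> Qp Q \<and> e2 \<in> Qp Q \<and> e1 \<noteq> e2 \<and>
      pos (L q0) < pos (L e1) \<and> pos (L q0) < pos (L e2)" if Q: "Q \<in> R" "Q \<notin> RH" for Q
  proof -
    have QF: "Q \<in> F" using Q RF by auto
    have fQp: "finite (Qp Q)" using finQ[OF QF] by (simp add: Qp_def)
    have "Qp Q \<noteq> {}" using Qp_card[OF QF] by auto
    \<comment> \<open>At most \<open>d/8 + 1\<close> of the more than \<open>5d/24\<close> vertices of \<open>Qp Q\<close> have the same last light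
      neighbor as \<open>q0\<close>, and the last light neighbors of at least two others come later.\<close>
    then obtain q0 where q0: "q0 \<in> Qp Q" "\<And>q. q \<in> Qp Q \<Longrightarrow> pos (L q0) \<le> pos (L q)"
      using ex_has_least_nat[of "\<lambda>q. q \<in> Qp Q" _ "\<lambda>q. pos (L q)"] by blast
    define v0 where "v0 = L q0"
    have "v0 \<in> N q0" unfolding v0_def by (rule L(1)[OF N_ne[OF Q q0(1)]])
    then have v0: "v0 \<in> S" "\<not> heavy v0" by (auto simp: N_def)
    define B where "B = {q \<in> Qp Q. L q = v0}"
    have "B \<subseteq> nbrs Q v0"
    proof
      fix q assume "q \<in> B"
      then have q: "q \<in> Qp Q" "L q = v0" by (auto simp: B_def)
      then have "v0 \<in> N q" using L(1)[OF N_ne[OF Q q(1)]] by simp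
      then show "q \<in> nbrs Q v0" using Qp_nb(1)[OF q(1)] by (simp add: N_def)
    qed
    then have "card B \<le> card (nbrs Q v0)" by (intro card_mono) auto
    also have "\<dots> \<le> excess v0 + 1" by (rule lightm[OF QF v0(2)])
    finally have "8 * card B \<le> d + 8" using x8[OF v0(1)] by linarith
    moreover have "BB": "card (Qp Q - B) = card (Qp Q) - card B"
      using fQp by (intro card_Diff_subset) (auto simp: B_def)
    ultimately have "2 \<le> card (Qp Q - B)" using Qp_card[OF QF] FQ(3)[OF QF] d by linarith
    then obtain T where "T \<subseteq> Qp Q - B" "card T = 2" by (meson obtain_subset_with_card_n)
    then obtain e1 e2 where e: "e1 \<in> Qp Q - B" "e2 \<in> Qp Q - B" "e1 \<noteq> e2"
      by (metis card_2_iff insert_subset)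
    have lt: "pos (L q0) < pos (L e)" if "e \<in> Qp Q - B" for e
    proof -
      have e: "e \<in> Qp Q" "L e \<noteq> v0" using that by (auto simp: B_def)
      have "L e \<in> S" using L(1)[OF N_ne[OF Q e(1)]] by (simp add: N_def)
      then have "pos (L e) \<noteq> pos v0" using inj_onD[OF inj, of "L e" v0] v0(1) e(2) by auto
      then show ?thesis using q0(2)[OF e(1)] unfolding v0_def by simp
    qed
    show ?thesis using q0(1) e lt by blast
  qed
  then obtain l0 l1 l2 where l: "\<And>Q. Q \<in> R \<Longrightarrow> Q \<notin> RH \<Longrightarrow> l0 Q \<in> Qp Q \<and> l1 Q \<in> Qp Q \<and> l2 Q \<in> Qp Q \<and> l1 Q \<noteq> l2 Q \<and>
      pos (L (l0 Q)) < pos (L (l1 Q)) \<and> pos (L (l0 Q)) < pos (L (l2 Q))" by metis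
  have finRL: "finite (R - RH)" using finF RF finite_subset by blast
  obtain g where g: "\<And>Q. Q \<in> R - RH \<Longrightarrow> g Q = L (l1 Q) \<or> g Q = L (l2 Q)"
    "\<And>v. 2 * (\<Sum>Q\<in>R - RH. of_bool (g Q = v)) \<le>
      (\<Sum>Q\<in>R - RH. of_bool (L (l1 Q) = v) + of_bool (L (l2 Q) = v)) + (1::nat)"
    using balanced_orientation[OF finRL, of "\<lambda>Q. L (l1 Q)" "\<lambda>Q. L (l2 Q)"] by blast
  define q1 where "q1 Q = (if Q \<in> RH then hq Q else l0 Q)" for Q
  define q2 where "q2 Q = (if Q \<in> RH then hq' Q else if g Q = L (l1 Q) then l1 Q else l2 Q)" for Q
  have light: "q1 Q \<in> Qp Q" "q2 Q \<in> Qp Q" "pos (L (q1 Q)) < pos (L (q2 Q))" "L (q2 Q) = g Q"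
    if "Q \<in> R - RH" for Q
    using l[of Q] g(1)[OF that] that unfolding q1_def q2_def by auto
  have heavyp: "splits Q (q1 Q) (q2 Q)" if "Q \<in> RH" for Q
    using hq[OF that] that by (simp add: q1_def q2_def)
  have inQ0: "q1 Q \<in> Q0 Q \<and> q2 Q \<in> Q0 Q" if "Q \<in> R" for Q
    using heavyp[of Q] light(1,2)[of Q] QpQ0[of Q] that unfolding splits_def by (cases "Q \<in> RH") auto
  have gN: "g Q \<in> S" "\<not> heavy (g Q)" "adj (g Q) (q2 Q)" "\<not> adj (g Q) (q1 Q)" if Q: "Q \<in> R - RH" for Q
  proof -
    have "g Q \<in> N (q2 Q)" using L(1)[OF N_ne[OF _ _ light(2)[OF Q]]] light(4)[OF Q] Q by auto
    then show gs: "g Q \<in> S" "\<not> heavy (g Q)" "adj (g Q) (q2 Q)" by (auto simp: N_def)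
    show "\<not> adj (g Q) (q1 Q)"
    proof
      assume "adj (g Q) (q1 Q)"
      then have "g Q \<in> N (q1 Q)" using gs by (simp add: N_def)
      then have "pos (g Q) \<le> pos (L (q1 Q))" using L(2)[of "q1 Q"] by blast
      then show False using light(3,4)[OF Q] by simp
    qed
  qed
  have diff: "\<exists>u\<in>S. adj u (q1 Q) \<noteq> adj u (q2 Q)" if "Q \<in> R" for Q
    using heavyp[of Q] gN[of Q] that unfolding splits_def by (cases "Q \<in> RH") blast+
  have pair: "q1 Q \<in> Q \<and> q2 Q \<in> Q \<and> q1 Q \<noteq> q2 Q" if "Q \<in> R" for Q
    using inQ0[OF that] diff[OF that] unfolding Q0_def by auto
  define A0 where "A0 = V - S - X"
  have VAS: "V - A0 - S = X" using XV SX by (auto simp: A0_def)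
  obtain Q where Q: "Q \<in> F" using F by blast
  then have "Q \<noteq> {}" using FQ(3)[OF Q] by auto
  then obtain y where y: "y \<in> X" using Q by (auto simp: X_def)
  have "A0 = V - (S \<union> X)" by (auto simp: A0_def)
  then obtain \<phi>0 where \<phi>0: "colors A0 \<phi>0" using critical_rest[of "S \<union> X" y] SV XV y by auto
  have "\<exists>\<phi>. colors (A0 \<union> S) \<phi> \<and> (\<forall>Q\<in>R. loose (A0 \<union> S) \<phi> (q1 Q) (q2 Q))"
  proof (rule color_in_order[where pos = pos and q = q1 and q' = q2])
    show "S \<subseteq> V" "A0 \<subseteq> V" "A0 \<inter> S = {}" "colors A0 \<phi>0" "inj_on pos S" "finite R"
      using SV \<phi>0 inj finF RF finite_subset by (auto simp: A0_def)
    show "q1 Q \<in> Low \<and> q2 Q \<in> Low \<and> adj (q1 Q) (q2 Q)" if "Q \<in> R" for Q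
      using pair[OF that] FQ(1,2)[of Q] RF that cliqueD[of Q "q1 Q" "q2 Q"] by blast
    show "\<exists>u\<in>S. adj u (q1 Q) \<noteq> adj u (q2 Q)" if "Q \<in> R" for Q by (rule diff[OF that])
    fix v assume v: "v \<in> S"
    let ?ch = "{r \<in> R. (adj v (q1 r) \<or> adj v (q2 r)) \<and> (\<forall>u\<in>S. adj u (q1 r) \<noteq> adj u (q2 r) \<longrightarrow> pos u \<le> pos v)}"
    show "card ?ch + excess v + 1 \<le> card (nbrs (V - A0 - S) v)"
      unfolding VAS
    proof (cases "heavy v")
      case True
      have "r \<in> {Q \<in> F. nbrs Q v \<noteq> {}}" if "r \<in> ?ch" for r
      proof -
        have r: "r \<in> R" "adj v (q1 r) \<or> adj v (q2 r)" using that by auto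
        then have "q1 r \<in> nbrs r v \<or> q2 r \<in> nbrs r v" using pair[OF r(1)] by auto
        then show ?thesis using r(1) RF by auto
      qed
      then have "card ?ch \<le> c v" unfolding c_def using finF by (intro card_mono) auto
      then show "card ?ch + excess v + 1 \<le> card (nbrs X v)" using True by (simp add: heavy_def)
    next
      case False
      have "?ch \<subseteq> {Q \<in> R - RH. g Q = v}"
      proof
        fix r assume "r \<in> ?ch"
        then have r: "r \<in> R" "adj v (q1 r) \<or> adj v (q2 r)"
          "\<And>u. u \<in> S \<Longrightarrow> adj u (q1 r) \<noteq> adj u (q2 r) \<Longrightarrow> pos u \<le> pos v" by auto
        have rH: "r \<notin> RH"
        proof
          assume "r \<in> RH"
          then obtain u where "u \<in> S" "heavy u" "adj u (q1 r) \<noteq> adj u (q2 r)"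
            using heavyp[of r] unfolding splits_def by blast
          then show False using pos_heavy[of u v] r(3)[of u] v False by blast
        qed
        then have rL: "r \<in> R - RH" using r(1) by simp
        have gv: "pos (g r) \<le> pos v" using r(3)[of "g r"] gN[OF rL] by blast
        have "\<not> adj v (q1 r)"
        proof
          assume "adj v (q1 r)"
          then have "v \<in> N (q1 r)" using v False by (simp add: N_def)
          then have "pos v \<le> pos (L (q1 r))" using L(2)[of "q1 r"] by blast
          then show False using gv light(3,4)[OF rL] by simp
        qed
        then have "v \<in> N (q2 r)" using r(2) v False by (simp add: N_def)
        then have "pos v \<le> pos (g r)" using L(2)[of "q2 r" v] light(4)[OF rL] by force
        then have "g r = v" using gv inj_onD[OF inj, of "g r" v] gN(1)[OF rL] v by simp
        then show "r \<in> {Q \<in> R - RH. g Q = v}" using rL by simp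
      qed
      moreover have "finite {Q \<in> R - RH. g Q = v}" by (rule finite_subset[OF _ finRL]) blast
      ultimately have "card ?ch \<le> card {Q \<in> R - RH. g Q = v}" by (intro card_mono)
      also have "\<dots> = (\<Sum>Q\<in>R - RH. of_bool (g Q = v))"
        using finRL by (simp add: sum_of_bool_eq Int_def)
      finally have load: "2 * card ?ch \<le> (\<Sum>Q\<in>R - RH. of_bool (L (l1 Q) = v) + of_bool (L (l2 Q) = v)) + 1"
        using g(2)[of v] by linarith
      have "(\<Sum>Q\<in>R - RH. of_bool (L (l1 Q) = v) + of_bool (L (l2 Q) = v)) \<le> (\<Sum>Q\<in>R - RH. card (nbrs Q v))"
      proof (rule sum_mono)
        fix Q assume Q: "Q \<in> R - RH"
        have lQ: "l1 Q \<in> Qp Q" "l2 Q \<in> Qp Q" "l1 Q \<noteq> l2 Q" using l[of Q] Q by auto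
        have mem: "q \<in> nbrs Q v" if "q \<in> Qp Q" "L q = v" for q
          using L(1)[OF N_ne[OF _ _ that(1)]] that Q Qp_nb(1)[OF that(1)] by (auto simp: N_def)
        have "{q \<in> {l1 Q, l2 Q}. L q = v} \<subseteq> nbrs Q v" using mem lQ by auto
        then have "card {q \<in> {l1 Q, l2 Q}. L q = v} \<le> card (nbrs Q v)" by (intro card_mono) auto
        moreover have "card {q \<in> {l1 Q, l2 Q}. L q = v} = of_bool (L (l1 Q) = v) + of_bool (L (l2 Q) = v)"
        proof -
          have "{q \<in> {l1 Q, l2 Q}. L q = v} = (if L (l1 Q) = v then {l1 Q} else {}) \<union> (if L (l2 Q) = v then {l2 Q} else {})"
            by auto
          then show ?thesis using lQ(3) by auto
        qed
        ultimately show "of_bool (L (l1 Q) = v) + of_bool (L (l2 Q) = v) \<le> card (nbrs Q v)" by simp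
      qed
      also have "\<dots> \<le> (\<Sum>Q\<in>F. card (nbrs Q v))" using finF RF by (intro sum_mono2) auto
      also have "\<dots> = card (nbrs X v)" unfolding X_def by (rule sum_nbrs_disjoint[OF disF finF])
      finally have "2 * card ?ch \<le> card (nbrs X v) + 1" using load by linarith
      then show "card ?ch + excess v + 1 \<le> card (nbrs X v)"
        using Sx[OF v] x1[OF v] unfolding X_def by linarith
    qed
  qed
  then obtain \<phi> where \<phi>: "colors (A0 \<union> S) \<phi>" "\<And>Q. Q \<in> R \<Longrightarrow> loose (A0 \<union> S) \<phi> (q1 Q) (q2 Q)" by blast
  let ?A = "A0 \<union> S"
  have VA: "V - ?A = X" using VAS by auto
  define X1 where "X1 = \<Union>(F - R)"
  have X1X: "X1 \<subseteq> X" by (auto simp: X1_def X_def)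
  have "\<exists>\<psi>. colors (?A \<union> X1) \<psi> \<and> (\<forall>a\<in>?A. \<psi> a = \<phi> a)"
  proof (rule greedy_degenerate)
    show "X1 \<subseteq> V" "?A \<inter> X1 = {}" "colors ?A \<phi>" using X1X XV VA \<phi>(1) by auto
    fix Y assume Y: "Y \<subseteq> X1" "Y \<noteq> {}"
    have "\<exists>Q. Q \<in> F - R \<and> Q \<inter> Y \<noteq> {}" using Y unfolding X1_def by blast
    then obtain Q where Q: "Q \<in> F - R" "Q \<inter> Y \<noteq> {}"
      and min: "\<And>Q'. Q' \<in> F - R \<Longrightarrow> Q' \<inter> Y \<noteq> {} \<Longrightarrow> f Q \<le> f Q'"
      using ex_has_least_nat[of "\<lambda>Q. Q \<in> F - R \<and> Q \<inter> Y \<noteq> {}" _ f] by blast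
    have QF: "Q \<in> F" using Q by simp
    obtain y z where yz: "y \<in> Y" "z \<in> X" "z \<notin> Y" "adj y z"
    proof (cases "Q \<subseteq> Y")
      case False
      then obtain z y where "z \<in> Q" "z \<notin> Y" "y \<in> Q" "y \<in> Y" using Q(2) by blast
      moreover from this have "adj y z" using cliqueD[OF FQ(2)[OF QF], of y z] by metis
      ultimately show ?thesis using that QF by (auto simp: X_def)
    next
      case True
      obtain Q' y z where Q': "Q' \<in> F" "f Q' < f Q" "y \<in> Q" "z \<in> Q'" "adj y z"
        using Q unfolding R_def by blast
      have "z \<notin> Y"
      proof
        assume zY: "z \<in> Y"
        then obtain Q'' where Q'': "Q'' \<in> F - R" "z \<in> Q''" using Y(1) unfolding X1_def by blast
        then have "Q'' = Q'" using disF Q'(1,4) unfolding disjoint_def by blast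
        then have "f Q \<le> f Q'" using min[of Q'] Q'' zY Q'(4) by blast
        then show False using Q'(2) by simp
      qed
      then show ?thesis using that[of y z] True Q' by (auto simp: X_def)
    qed
    have yLo: "y \<in> Low" using yz(1) Y(1) X1X XLo by blast
    have "nbrs Y y \<subseteq> nbrs X y" using Y(1) X1X by (intro nbrs_mono) (rule order_trans)
    moreover have "z \<in> nbrs X y" "z \<notin> nbrs Y y" using yz by simp_all
    ultimately have "nbrs Y y \<subset> nbrs X y" by blast
    then have "card (nbrs Y y) < card (nbrs X y)" by (intro psubset_card_mono) auto
    moreover have "card (nbrs X y) \<le> card (avail ?A \<phi> y)"
    proof -
      have "V - X = ?A" using VA SV by (auto simp: A0_def)
      then show ?thesis using card_avail_low[OF XV, of \<phi> y] \<phi>(1) yLo by simp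
    qed
    ultimately have "card (nbrs Y y) < card (avail ?A \<phi> y)" by linarith
    then show "\<exists>y\<in>Y. card (nbrs Y y) < card (avail ?A \<phi> y)" using yz(1) by (rule bexI)
  qed
  then obtain \<psi> where \<psi>: "colors (?A \<union> X1) \<psi>" "\<forall>a\<in>?A. \<psi> a = \<phi> a" by blast
  let ?B = "?A \<union> X1"
  have disR: "Q \<inter> X1 = {}" if "Q \<in> R" for Q
  proof -
    have "Q \<inter> Q' = {}" if Q': "Q' \<in> F - R" for Q'
    proof -
      have "Q \<in> F" "Q' \<in> F" "Q \<noteq> Q'" using \<open>Q \<in> R\<close> Q' RF by auto
      then show ?thesis by (rule disjointD[OF disF])
    qed
    then show ?thesis unfolding X1_def disjoint_iff by (metis UnionE)
  qed
  have VB: "V - ?B = \<Union>R"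
  proof (rule set_eqI)
    fix z
    have "z \<in> V - ?B \<longleftrightarrow> z \<in> V - ?A \<and> z \<notin> X1" by simp
    also have "\<dots> \<longleftrightarrow> z \<in> X \<and> z \<notin> X1" unfolding VA ..
    also have "\<dots> \<longleftrightarrow> z \<in> \<Union>R"
    proof
      assume "z \<in> X \<and> z \<notin> X1"
      then obtain Q where "Q \<in> F" "z \<in> Q" "z \<notin> X1" by (auto simp: X_def)
      then show "z \<in> \<Union>R" unfolding X1_def by (metis DiffI UnionI)
    next
      assume "z \<in> \<Union>R"
      then obtain Q where Q: "Q \<in> R" "z \<in> Q" by (rule UnionE)
      then have "z \<in> X" using RF unfolding X_def by (metis UnionI subsetD)
      moreover have "z \<notin> X1" using disR[OF Q(1)] Q(2) by (metis disjoint_iff)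
      ultimately show "z \<in> X \<and> z \<notin> X1" ..
    qed
    finally show "z \<in> V - ?B \<longleftrightarrow> z \<in> \<Union>R" .
  qed
  show False
  proof (rule color_isolated_cliques[of R q1 q2 ?B \<psi>])
    show "finite R" using finF RF finite_subset by blast
    show "Q \<subseteq> Low \<and> clique Q \<and> q1 Q \<in> Q \<and> q2 Q \<in> Q \<and> q1 Q \<noteq> q2 Q" if "Q \<in> R" for Q
      using FQ(1,2)[of Q] RF pair[OF that] that by blast
    show "disjoint R" using disF RF unfolding disjoint_def by blast
    show "?B \<subseteq> V" using SV X1X XV by (auto simp: A0_def)
    show "nbrs (V - ?B) y \<subseteq> Q" if Q: "Q \<in> R" "y \<in> Q" for Q y
    proof
      fix z assume z: "z \<in> nbrs (V - ?B) y"
      then obtain Q' where Q': "Q' \<in> R" "z \<in> Q'" using VB by auto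
      have adj: "adj y z" using z by simp
      show "z \<in> Q"
      proof (cases "f Q = f Q'")
        case True
        then have "Q = Q'" using inj_onD[OF injf, of Q Q'] Q(1) Q'(1) RF by blast
        then show ?thesis using Q'(2) by simp
      next
        case False
        then consider "f Q' < f Q" | "f Q < f Q'" by linarith
        then show ?thesis
        proof cases
          case 1
          then show ?thesis using Q Q' adj RF unfolding R_def by blast
        next
          case 2
          then show ?thesis using Q Q' adj_sym[OF adj] RF unfolding R_def by blast
        qed
      qed
    qed
    show "loose ?B \<psi> (q1 Q) (q2 Q)" if Q: "Q \<in> R" for Q
    proof -
      have same: "nbrs (V - ?B) y = nbrs (V - ?A) y \<and> avail ?B \<psi> y = avail ?A \<phi> y" if y: "y \<in> Q0 Q" for y
      proof -
        have na: "\<not> adj y z" if z: "z \<in> X1" for z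
        proof
          assume a: "adj y z"
          have zX: "z \<in> X" using X1X z by blast
          have "nbrs X y \<subseteq> Q" using y by (simp add: Q0_def)
          then have "z \<in> Q" using zX a by (rule nbrsD)
          then show False using disR[OF Q] z by blast
        qed
        have na': "\<not> adj z y" if "z \<in> X1" for z
        proof
          assume "adj z y"
          then show False using na[OF that] adj_sym by blast
        qed
        have "u \<in> nbrs (V - ?B) y \<longleftrightarrow> u \<in> nbrs (V - ?A) y" for u using na[of u] by (simp, metis)
        then have "nbrs (V - ?B) y = nbrs (V - ?A) y" by (rule set_eqI)
        moreover have "avail ?B \<psi> y = avail ?A \<phi> y"
        proof -
          have "(\<forall>u\<in>?B. adj u y \<longrightarrow> \<not> cf u (\<psi> u) y b) = (\<forall>u\<in>?A. adj u y \<longrightarrow> \<not> cf u (\<phi> u) y b)" for b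
          proof -
            have e1: "(\<forall>u\<in>?A. adj u y \<longrightarrow> \<not> cf u (\<psi> u) y b) = (\<forall>u\<in>?A. adj u y \<longrightarrow> \<not> cf u (\<phi> u) y b)"
              using \<psi>(2) by (intro ball_cong refl) simp
            have e2: "\<forall>u\<in>X1. adj u y \<longrightarrow> \<not> cf u (\<psi> u) y b" using na' by blast
            show ?thesis unfolding ball_Un[of ?A X1] e1 by (rule iffI[OF conjunct1 conjI[OF _ e2]])
          qed
          then show ?thesis unfolding avail_def by (intro Collect_cong) simp
        qed
        ultimately show ?thesis by simp
      qed
      have "nbrs (V - ?B) (q1 Q) = nbrs (V - ?A) (q1 Q) \<and> avail ?B \<psi> (q1 Q) = avail ?A \<phi> (q1 Q)"
        "nbrs (V - ?B) (q2 Q) = nbrs (V - ?A) (q2 Q) \<and> avail ?B \<psi> (q2 Q) = avail ?A \<phi> (q2 Q)"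
        using same inQ0[OF Q] by blast+
      then show ?thesis using \<phi>(2)[OF Q] unfolding loose_def surplus_def aligned_def by simp
    qed
  qed (use \<psi>(1) VB in auto)
qed

end

section \<open>List and correspondence colorings\<close>

context critical_cover begin

lemma V_nonempty: "V \<noteq> {}"
proof
  assume "V = {}"
  then have "colors V undefined" by (simp add: colors_def)
  then show False using uncolorable by blast
qed

lemma excess_bound:
  assumes "3 \<le> d"
  shows "card V < 28 * (\<Sum>v\<in>V. excess v)"
proof (cases "d \<le> 23")
  case True
  then show ?thesis using excess_small_degree[OF assms _ V_nonempty] by blast
next
  case False
  then have "card V < 24 * (\<Sum>v\<in>V. excess v)" using excess_large_degree V_nonempty by simp
  then show ?thesis by linarith
qed

lemma degree_total: "(\<Sum>v\<in>V. card (nbrs V v)) = d * card V + (\<Sum>v\<in>V. excess v)"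
proof -
  have "(\<Sum>v\<in>V. card (nbrs V v)) = (\<Sum>v\<in>V. d + excess v)" by (rule sum.cong[OF refl deg_eq])
  then show ?thesis by (simp add: sum.distrib)
qed

end

abbreviation adjacent :: "'a graph \<Rightarrow> 'a \<Rightarrow> 'a \<Rightarrow> bool" where
  "adjacent G u v \<equiv> {u, v} \<in> edges G"

definition induced :: "'a graph \<Rightarrow> 'a set \<Rightarrow> 'a graph" where
  "induced G A = \<lparr>verts = A, edges = {e \<in> edges G. e \<subseteq> A}\<rparr>"

lemma finite_edges: "simple_graph G \<Longrightarrow> finite (edges G)"
  unfolding simple_graph_def by (rule finite_subset[of _ "Pow (verts G)"]) auto

lemma adjacentD:
  assumes "simple_graph G" "adjacent G u v"
  shows "u \<in> verts G" "v \<in> verts G" "u \<noteq> v"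
proof -
  have e: "{u, v} \<subseteq> verts G" "card {u, v} = 2" using assms unfolding simple_graph_def by blast+
  show "u \<in> verts G" "v \<in> verts G" using e(1) by auto
  show "u \<noteq> v" using e(2) by auto
qed

lemma induced_proper:
  assumes "simple_graph G" "A \<subset> verts G"
  shows "proper_subgraph (induced G A) G"
proof -
  have "finite A" using assms unfolding simple_graph_def by (meson finite_subset psubset_imp_subset)
  moreover have "verts (induced G A) = A" by (simp add: induced_def)
  then have "induced G A \<noteq> G" using assms(2) by (metis psubset_eq)
  ultimately show ?thesis
    using assms unfolding proper_subgraph_def simple_graph_def by (simp add: induced_def psubset_imp_subset)
qed

lemma handshake:
  assumes G: "simple_graph G"
  shows "(\<Sum>v\<in>verts G. card {u \<in> verts G. adjacent G v u}) = 2 * card (edges G)"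
proof -
  have finV: "finite (verts G)" using G by (simp add: simple_graph_def)
  have "card {u \<in> verts G. adjacent G v u} = card {e \<in> edges G. v \<in> e}" for v
  proof (rule bij_betw_same_card[of "\<lambda>u. {v, u}"], rule bij_betwI')
    fix u w assume "u \<in> {u \<in> verts G. adjacent G v u}" "w \<in> {u \<in> verts G. adjacent G v u}"
    then show "({v, u} = {v, w}) = (u = w)" by (auto simp: doubleton_eq_iff)
  next
    fix e assume "e \<in> {e \<in> edges G. v \<in> e}"
    then have e: "e \<in> edges G" "v \<in> e" "card e = 2" "e \<subseteq> verts G" using G by (auto simp: simple_graph_def)
    then obtain a b where ab: "e = {a, b}" by (meson card_2_iff)
    then obtain u where "e = {v, u}" using e(2) by (metis insertE insert_commute singletonD)
    then show "\<exists>u\<in>{u \<in> verts G. adjacent G v u}. e = {v, u}" using e by blast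
  qed simp
  then have "(\<Sum>v\<in>verts G. card {u \<in> verts G. adjacent G v u})
      = (\<Sum>v\<in>verts G. \<Sum>e\<in>edges G. if v \<in> e then 1 else 0)"
    using finite_edges[OF G] by (simp add: sum.If_cases Int_def)
  also have "\<dots> = (\<Sum>e\<in>edges G. \<Sum>v\<in>verts G. if v \<in> e then 1 else 0)" by (rule sum.swap)
  also have "\<dots> = (\<Sum>e\<in>edges G. 2)"
  proof (rule sum.cong[OF refl])
    fix e assume "e \<in> edges G"
    then have e: "card e = 2" "e \<subseteq> verts G" using G by (auto simp: simple_graph_def)
    have "(\<Sum>v\<in>verts G. if v \<in> e then 1 else 0) = card (verts G \<inter> e)"
      using finV by (simp add: sum.If_cases Int_def)
    then show "(\<Sum>v\<in>verts G. if v \<in> e then 1 else 0) = (2::nat)" using e by (simp add: Int_absorb1)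
  qed
  finally show ?thesis by simp
qed

text \<open>Twice the number of edges is \<open>d\<close> times the number of vertices plus the total excess.\<close>

lemma edge_bound:
  assumes G: "simple_graph G" and c: "critical_cover (verts G) (adjacent G) Lst cf d"
  shows "3 \<le> d \<Longrightarrow> (real d + 1 / 28) * (real (card (verts G)) / 2) < real (card (edges G))"
    and "24 \<le> d \<Longrightarrow> (real d + 1 / 24) * (real (card (verts G)) / 2) < real (card (edges G))"
proof -
  interpret critical_cover "verts G" "adjacent G" Lst cf d by (rule c)
  define X where "X = (\<Sum>v\<in>verts G. excess v)"
  have "2 * card (edges G) = d * card (verts G) + X"
    using handshake[OF G] degree_total by (simp add: nbrs_def X_def)
  then have "real (2 * card (edges G)) = real (d * card (verts G) + X)" by (rule arg_cong)
  then have e: "2 * real (card (edges G)) = real d * real (card (verts G)) + real X" by simp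
  have bound: "(real d + 1 / c) * (real (card (verts G)) / 2) < real (card (edges G))"
    if "real (card (verts G)) < c * real X" "0 < c" for c
  proof -
    have "real (card (verts G)) / c < real X" using that by (simp add: pos_divide_less_eq mult.commute)
    then show ?thesis using e by (simp add: distrib_right)
  qed
  show "(real d + 1 / 28) * (real (card (verts G)) / 2) < real (card (edges G))" if "3 \<le> d"
    using excess_bound[OF that] by (intro bound) (simp_all add: X_def[symmetric])
  show "(real d + 1 / 24) * (real (card (verts G)) / 2) < real (card (edges G))" if "24 \<le> d"
    using excess_large_degree[OF that V_nonempty] by (intro bound) (simp_all add: X_def[symmetric])
qed

lemma cover_intro:
  assumes G: "simple_graph G"
    and "\<And>v. v \<in> verts G \<Longrightarrow> finite (Lst v) \<and> card (Lst v) = d"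
    and "\<And>u v a b. cf u a v b \<Longrightarrow> cf v b u a"
    and "\<And>u v a b b'. adjacent G u v \<Longrightarrow> a \<in> Lst u \<Longrightarrow> b \<in> Lst v \<Longrightarrow> b' \<in> Lst v \<Longrightarrow>
      cf u a v b \<Longrightarrow> cf u a v b' \<Longrightarrow> b = b'"
  shows "cover (verts G) (adjacent G) Lst cf d"
proof
  show "finite (verts G)" using G by (simp add: simple_graph_def)
  show "adjacent G v u" if "adjacent G u v" for u v using that by (simp add: insert_commute)
  show "\<not> adjacent G v v" for v using adjacentD(3)[OF G] by blast
  show "u \<in> verts G" if "adjacent G u v" for u v by (rule adjacentD(1)[OF G that])
  show "finite (Lst v)" "card (Lst v) = d" if "v \<in> verts G" for v using assms(2)[OF that] by simp_all
  show "cf v b u a" if "cf u a v b" for u a v b by (rule assms(3)[OF that])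
  show "b = b'" if "adjacent G u v" "a \<in> Lst u" "b \<in> Lst v" "b' \<in> Lst v" "cf u a v b" "cf u a v b'"
    for u v a b b' by (rule assms(4)[OF that])
qed

definition complete_on :: "'a set \<Rightarrow> 'a graph" where
  "complete_on K = \<lparr>verts = K, edges = {{u, v} | u v. u \<in> K \<and> v \<in> K \<and> u \<noteq> v}\<rparr>"

lemma complete_on_proper:
  assumes G: "simple_graph G" and K: "K \<subset> verts G" "\<And>u v. u \<in> K \<Longrightarrow> v \<in> K \<Longrightarrow> u \<noteq> v \<Longrightarrow> adjacent G u v"
  shows "proper_subgraph (complete_on K) G"
proof -
  have "finite K" using K(1) G unfolding simple_graph_def by (meson finite_subset psubset_imp_subset)
  moreover have "card e = 2 \<and> e \<subseteq> K \<and> e \<in> edges G" if "e \<in> edges (complete_on K)" for e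
    using that K(2) by (auto simp: complete_on_def)
  moreover have vK: "verts (complete_on K) = K" by (simp add: complete_on_def)
  moreover have "complete_on K \<noteq> G" using K(1) vK by (metis psubset_eq)
  ultimately show ?thesis
    using psubset_imp_subset[OF K(1)] unfolding proper_subgraph_def simple_graph_def by (simp add: subset_iff)
qed

text \<open>\<open>P\<close> is colorability with \<open>d\<close> colors, in either sense.\<close>

lemma clique_bound_intro:
  assumes c: "cover (verts G) (adjacent G) Lst cf d" and G: "simple_graph G"
    and n: "d + 1 < card (verts G)"
    and crit: "\<And>G'. proper_subgraph G' G \<Longrightarrow> P G'"
    and noK: "\<And>K. finite K \<Longrightarrow> card K = d + 1 \<Longrightarrow> \<not> P (complete_on K)"
    and K: "cover.clique (verts G) (adjacent G) K"
  shows "card K \<le> d"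
proof (rule ccontr)
  assume "\<not> card K \<le> d"
  then have "d + 1 \<le> card K" by simp
  then obtain J where J: "J \<subseteq> K" "card J = d + 1" by (meson obtain_subset_with_card_n)
  have KV: "K \<subseteq> verts G" "\<And>u v. u \<in> K \<Longrightarrow> v \<in> K \<Longrightarrow> u \<noteq> v \<Longrightarrow> adjacent G u v"
    using K unfolding cover.clique_def[OF c] by auto
  have "J \<noteq> verts G" using J(2) n by auto
  then have "proper_subgraph (complete_on J) G"
  proof (intro complete_on_proper[OF G])
    show "J \<subset> verts G" using J(1) KV(1) \<open>J \<noteq> verts G\<close> by blast
    show "adjacent G u v" if "u \<in> J" "v \<in> J" "u \<noteq> v" for u v using KV(2)[of u v] J(1) that by blast
  qed
  then have "P (complete_on J)" by (rule crit)
  moreover have "finite J" using J(2) by (intro card_ge_0_finite) simp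
  ultimately show False using noK J(2) by blast
qed

lemma complete_not_list_colorable:
  assumes "finite K" "card K = d + 1"
  shows "\<not> list_colorable d (complete_on K)"
proof
  assume "list_colorable d (complete_on K)"
  then obtain \<phi> where \<phi>: "list_coloring (complete_on K) (\<lambda>_. {..<d}) \<phi>"
    unfolding list_colorable_def by (metis card_lessThan order_refl)
  then have "inj_on \<phi> K" "\<phi> ` K \<subseteq> {..<d}"
    unfolding list_coloring_def proper_coloring_def complete_on_def inj_on_def by auto
  then have "card K \<le> d" using card_inj_on_le[of \<phi> K "{..<d}"] by simp
  then show False using assms(2) by simp
qed

lemma list_critical_cover:
  assumes crit: "list_critical k G" and k: "1 \<le> k" and n: "k < card (verts G)"
  shows "\<exists>Lst. critical_cover (verts G) (adjacent G) Lst (\<lambda>u a v b. a = (b::nat)) (k - 1)"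
proof -
  have G: "simple_graph G" and sub: "\<And>G'. proper_subgraph G' G \<Longrightarrow> list_colorable (k - 1) G'"
    using crit unfolding list_critical_def by auto
  have "\<not> list_colorable (k - 1) G" using crit unfolding list_critical_def by blast
  then obtain L where L: "\<forall>v\<in>verts G. infinite (L v) \<or> k - 1 \<le> card (L v)" "\<not> (\<exists>\<phi>. list_coloring G L \<phi>)"
    unfolding list_colorable_def not_all not_imp by (elim exE conjE)
  have "\<exists>T. T \<subseteq> L v \<and> finite T \<and> card T = k - 1" if v: "v \<in> verts G" for v
  proof (cases "infinite (L v)")
    case True
    then obtain T where "finite T" "card T = k - 1" "T \<subseteq> L v" 
      using infinite_arbitrarily_large[OF True, of "k - 1"] by (elim exE conjE)
    then show ?thesis by (intro exI[of _ T]) simp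
  next
    case False
    then have "k - 1 \<le> card (L v)" using L(1) v by simp
    then obtain T where "T \<subseteq> L v" "card T = k - 1" "finite T" by (rule obtain_subset_with_card_n)
    then show ?thesis by (intro exI[of _ T]) simp
  qed
  then obtain T where T: "\<And>v. v \<in> verts G \<Longrightarrow> T v \<subseteq> L v \<and> finite (T v) \<and> card (T v) = k - 1" by metis
  let ?cf = "\<lambda>u a v b. a = (b::nat)"
  have c: "cover (verts G) (adjacent G) T ?cf (k - 1)"
  proof (rule cover_intro[OF G])
    show "finite (T v) \<and> card (T v) = k - 1" if "v \<in> verts G" for v using T[OF that] by simp
  qed simp_all
  have "critical_cover (verts G) (adjacent G) T ?cf (k - 1)"
  proof (intro critical_cover.intro critical_cover_axioms.intro c)
    fix \<phi> show "\<not> cover.colors (adjacent G) T ?cf (verts G) \<phi>"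
    proof
      assume co: "cover.colors (adjacent G) T ?cf (verts G) \<phi>"
      have "\<phi> v \<in> L v" if "v \<in> verts G" for v
        using co T[OF that] that unfolding cover.colors_def[OF c] by (meson subsetD)
      then have "list_coloring G L \<phi>"
        using co unfolding cover.colors_def[OF c] list_coloring_def proper_coloring_def by simp
      then show False using L(2) by simp
    qed
  next
    fix A assume A: "A \<subset> verts G"
    have "list_colorable (k - 1) (induced G A)" by (rule sub[OF induced_proper[OF G A]])
    moreover have "\<forall>v\<in>verts (induced G A). infinite (T v) \<or> k - 1 \<le> card (T v)"
    proof
      fix v assume "v \<in> verts (induced G A)"
      then have "v \<in> verts G" using A by (auto simp: induced_def)
      then show "infinite (T v) \<or> k - 1 \<le> card (T v)" using T by simp
    qed
    ultimately obtain \<phi> where "list_coloring (induced G A) T \<phi>" unfolding list_colorable_def by metis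
    then have "cover.colors (adjacent G) T ?cf A \<phi>"
      unfolding cover.colors_def[OF c] list_coloring_def proper_coloring_def induced_def by auto
    then show "\<exists>\<phi>. cover.colors (adjacent G) T ?cf A \<phi>" by blast
  next
    fix K assume K: "cover.clique (verts G) (adjacent G) K"
    have n': "k - 1 + 1 < card (verts G)" using k n by simp
    show "card K \<le> k - 1"
      by (rule clique_bound_intro[where P = "list_colorable (k - 1)", OF c G n' sub complete_not_list_colorable K])
  qed
  then show ?thesis by blast
qed

text \<open>The cover that imitates \<open>d\<close> common colors: color \<open>c\<close> of vertex \<open>v\<close> is the number
\<open>h v * d + c\<close>, where \<open>h\<close> numbers the vertices, and equal colors of different vertices are joined.\<close>

lemma complete_not_correspondence_colorable:
  assumes K: "finite K" "card K = d + 1"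
  shows "\<not> correspondence_colorable d (complete_on K)"
proof
  assume cc: "correspondence_colorable d (complete_on K)"
  obtain h where h: "inj_on h K" "h ` K \<subseteq> {..<d + 1}"
    using K by (metis ex_bij_betw_finite_nat bij_betw_def atLeast0LessThan order_refl)
  define m where "m v c = h v * d + c" for v c
  have m_inj: "v = w \<and> b = c" if "v \<in> K" "w \<in> K" "b < d" "c < d" "m v b = m w c" for v w b c
  proof -
    have "(h v * d + b) div d = (h w * d + c) div d" "(h v * d + b) mod d = (h w * d + c) mod d"
      using that(5) by (simp_all add: m_def)
    then have "h v = h w" "b = c" using that(3,4) by (simp_all add: mult.commute)
    then show ?thesis using h(1) that(1,2) by (auto dest: inj_onD)
  qed
  define L where "L v = m v ` {..<d}" for v
  define H where "H = \<lparr>verts = (\<Union>v\<in>K. L v), edges = {{m v c, m w c} | v w c. v \<in> K \<and> w \<in> K \<and> v \<noteq> w \<and> c < d}\<rparr>"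
  have vH: "verts H = (\<Union>v\<in>K. L v)" by (simp add: H_def)
  have eH: "edges H = {{m v c, m w c} | v w c. v \<in> K \<and> w \<in> K \<and> v \<noteq> w \<and> c < d}" by (simp add: H_def)
  have edgeH: "\<exists>c<d. (a = m v c \<and> b = m w c) \<and> v \<noteq> w"
    if ab: "{a, b} \<in> edges H" "a \<in> L v" "b \<in> L w" "v \<in> K" "w \<in> K" for a b v w
  proof -
    obtain v' w' c where e: "{a, b} = {m v' c, m w' c}" "v' \<in> K" "w' \<in> K" "v' \<noteq> w'" "c < d"
      using ab(1) unfolding eH by blast
    obtain i j where ij: "a = m v i" "i < d" "b = m w j" "j < d" using ab(2,3) by (auto simp: L_def)
    from e(1) consider "a = m v' c" "b = m w' c" | "a = m w' c" "b = m v' c" by (auto simp: doubleton_eq_iff)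
    then show ?thesis
    proof cases
      case 1
      then have "v = v' \<and> i = c" "w = w' \<and> j = c" using m_inj ij e ab(4,5) by metis+
      then show ?thesis using ij e by blast
    next
      case 2
      then have "v = w' \<and> i = c" "w = v' \<and> j = c" using m_inj ij e ab(4,5) by metis+
      then show ?thesis using ij e by blast
    qed
  qed
  have cover: "correspondence_cover (complete_on K) H L"
    unfolding correspondence_cover_def
  proof (intro conjI ballI impI)
    have "e \<subseteq> verts H \<and> card e = 2" if eE: "e \<in> edges H" for e
    proof -
      obtain v w c where e: "e = {m v c, m w c}" "v \<in> K" "w \<in> K" "v \<noteq> w" "c < d" using eE unfolding eH by blast
      then have "m v c \<noteq> m w c" using m_inj by blast
      moreover have "m v c \<in> verts H" "m w c \<in> verts H" using e by (auto simp: vH L_def)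
      ultimately show ?thesis using e(1) by simp
    qed
    moreover have "finite (verts H)" using K(1) by (auto simp: vH L_def)
    ultimately show "simple_graph H" unfolding simple_graph_def by blast
    show "disjoint_family_on L (verts (complete_on K))"
      unfolding disjoint_family_on_def
    proof (intro ballI impI)
      fix v w assume vw: "v \<in> verts (complete_on K)" "w \<in> verts (complete_on K)" "v \<noteq> w"
      show "L v \<inter> L w = {}"
      proof (rule ccontr)
        assume "L v \<inter> L w \<noteq> {}"
        then obtain b c where "b < d" "c < d" "m v b = m w c" by (auto simp: L_def)
        then show False using m_inj[of v w b c] vw by (simp add: complete_on_def)
      qed
    qed
    show "(\<Union>v\<in>verts (complete_on K). L v) = verts H" by (simp add: complete_on_def vH)
    fix v assume v: "v \<in> verts (complete_on K)"
    then have vK: "v \<in> K" by (simp add: complete_on_def)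
    show "independent_in H (L v)"
      unfolding independent_in_def
    proof (intro conjI ballI notI)
      show "L v \<subseteq> verts H" using vK by (auto simp: vH)
      fix a b assume "a \<in> L v" "b \<in> L v" "{a, b} \<in> edges H"
      then show False using edgeH[of a b v v] vK by blast
    qed
    fix w assume w: "w \<in> verts (complete_on K)" and vw: "v \<noteq> w"
    then have wK: "w \<in> K" by (simp add: complete_on_def)
    have adj: "{v, w} \<in> edges (complete_on K)" using vK wK vw by (auto simp: complete_on_def)
    have M: "\<exists>c<d. e = {m v c, m w c}" if e: "e \<in> edges_between H (L v) (L w)" for e
    proof -
      obtain a b where ab: "e = {a, b}" "{a, b} \<in> edges H" "a \<in> L v" "b \<in> L w"
        using e unfolding edges_between_def by blast
      then show ?thesis using edgeH[OF ab(2-4) vK wK] by blast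
    qed
    have "matching (edges_between H (L v) (L w))"
      unfolding matching_def disjoint_def
    proof (intro ballI impI)
      fix e e' assume ee: "e \<in> edges_between H (L v) (L w)" "e' \<in> edges_between H (L v) (L w)" "e \<noteq> e'"
      obtain c where c: "c < d" "e = {m v c, m w c}" using M[OF ee(1)] by blast
      obtain c' where c': "c' < d" "e' = {m v c', m w c'}" using M[OF ee(2)] by blast
      have "c \<noteq> c'" using c c' ee(3) by blast
      then have "m v c \<noteq> m v c'" "m v c \<noteq> m w c'" "m w c \<noteq> m v c'" "m w c \<noteq> m w c'"
        using m_inj vK wK c(1) c'(1) by blast+
      then show "e \<inter> e' = {}" using c c' by auto
    qed
    then show "if {v, w} \<in> edges (complete_on K) then matching (edges_between H (L v) (L w))
       else edges_between H (L v) (L w) = {}" using adj by simp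
  qed
  have "card (L v) = d" if "v \<in> K" for v
  proof -
    have "inj_on (m v) {..<d}" using m_inj[OF that that] by (intro inj_onI) auto
    then show ?thesis unfolding L_def by (simp add: card_image)
  qed
  then have "\<forall>v\<in>verts (complete_on K). d \<le> card (L v)" by (simp add: complete_on_def)
  then obtain \<phi> where \<phi>: "cover_coloring (complete_on K) H L \<phi>"
    using cc cover unfolding correspondence_colorable_def by blast
  have "\<exists>c<d. \<phi> v = m v c" if "v \<in> K" for v
    using \<phi> that unfolding cover_coloring_def L_def complete_on_def by auto
  then obtain g where g: "\<And>v. v \<in> K \<Longrightarrow> g v < d \<and> \<phi> v = m v (g v)" by metis
  have "inj_on g K"
  proof (rule inj_onI, rule ccontr)
    fix v w assume vw: "v \<in> K" "w \<in> K" "g v = g w" "v \<noteq> w"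
    then have "{\<phi> v, \<phi> w} \<in> edges H" using g[OF vw(1)] g[OF vw(2)] unfolding eH by force
    then show False using \<phi> vw(1,2) unfolding cover_coloring_def independent_in_def complete_on_def by auto
  qed
  then have "card K \<le> card {..<d}" using g by (intro card_inj_on_le[of g]) auto
  then show False using K(2) by simp
qed

text \<open>Sublists of size \<open>k - 1\<close> of an uncolorable cover stay uncolorable, and the subgraph of the cover
graph that they induce is a cover of each induced subgraph.\<close>

lemma correspondence_critical_cover:
  assumes crit: "correspondence_critical k G" and k: "1 \<le> k" and n: "k < card (verts G)"
  shows "\<exists>(Lst :: 'a \<Rightarrow> nat set) cf. critical_cover (verts G) (adjacent G) Lst cf (k - 1)"
proof -
  have G: "simple_graph G" and sub: "\<And>G'. proper_subgraph G' G \<Longrightarrow> correspondence_colorable (k - 1) G'"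
    using crit unfolding correspondence_critical_def by auto
  have "\<not> correspondence_colorable (k - 1) G" using crit unfolding correspondence_critical_def by blast
  then obtain H :: "nat graph" and L where HL: "correspondence_cover G H L"
    "\<forall>v\<in>verts G. k - 1 \<le> card (L v)" "\<not> (\<exists>\<phi>. cover_coloring G H L \<phi>)"
    unfolding correspondence_colorable_def not_all not_imp by (elim exE conjE)
  note parts = HL(1)[unfolded correspondence_cover_def]
  have H: "simple_graph H" by (rule parts[THEN conjunct1])
  have ind': "\<forall>v\<in>verts G. independent_in H (L v)" by (rule parts[THEN conjunct2, THEN conjunct1])
  have dis: "disjoint_family_on L (verts G)"
    by (rule parts[THEN conjunct2, THEN conjunct2, THEN conjunct1])
  have un: "(\<Union>v\<in>verts G. L v) = verts H"
    by (rule parts[THEN conjunct2, THEN conjunct2, THEN conjunct2, THEN conjunct1])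
  have uv: "\<forall>u\<in>verts G. \<forall>v\<in>verts G. u \<noteq> v \<longrightarrow> (if {u, v} \<in> edges G
      then matching (edges_between H (L u) (L v)) else edges_between H (L u) (L v) = {})"
    by (rule parts[THEN conjunct2, THEN conjunct2, THEN conjunct2, THEN conjunct2])
  have ind: "independent_in H (L v)" if "v \<in> verts G" for v using ind' that by (rule bspec)
  have mat: "matching (edges_between H (L u) (L v))"
    if "u \<in> verts G" "v \<in> verts G" "u \<noteq> v" "adjacent G u v" for u v using uv that by simp
  have emp: "edges_between H (L u) (L v) = {}"
    if "u \<in> verts G" "v \<in> verts G" "u \<noteq> v" "\<not> adjacent G u v" for u v using uv that by simp
  have finL: "finite (L v)" if "v \<in> verts G" for v
  proof (rule finite_subset)
    show "L v \<subseteq> verts H" using ind[OF that] by (simp add: independent_in_def)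
    show "finite (verts H)" using H by (simp add: simple_graph_def)
  qed
  have "\<exists>T. T \<subseteq> L v \<and> finite T \<and> card T = k - 1" if v: "v \<in> verts G" for v
  proof -
    obtain T where "T \<subseteq> L v" "card T = k - 1" "finite T"
      by (rule obtain_subset_with_card_n[OF bspec[OF HL(2) v]])
    then show ?thesis by (intro exI[of _ T]) simp
  qed
  then obtain T where T: "\<And>v. v \<in> verts G \<Longrightarrow> T v \<subseteq> L v \<and> finite (T v) \<and> card (T v) = k - 1" by metis
  let ?cf = "\<lambda>(u::'a) a (v::'a) b. {a, b} \<in> edges H"
  have c: "cover (verts G) (adjacent G) T ?cf (k - 1)"
  proof (rule cover_intro[OF G])
    show "finite (T v) \<and> card (T v) = k - 1" if "v \<in> verts G" for v using T[OF that] by simp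
    show "{b, a} \<in> edges H" if "{a, b} \<in> edges H" for a b using that by (simp add: insert_commute)
    fix u v a b b' assume a: "adjacent G u v" "a \<in> T u" "b \<in> T v" "b' \<in> T v" "{a, b} \<in> edges H" "{a, b'} \<in> edges H"
    have uv: "u \<in> verts G" "v \<in> verts G" "u \<noteq> v" by (rule adjacentD[OF G a(1)])+
    have "{a, b} \<in> edges_between H (L u) (L v)" "{a, b'} \<in> edges_between H (L u) (L v)"
    proof -
      have "a \<in> L u" "b \<in> L v" "b' \<in> L v" using a T[OF uv(1)] T[OF uv(2)] by auto
      then show "{a, b} \<in> edges_between H (L u) (L v)" "{a, b'} \<in> edges_between H (L u) (L v)"
        using a(5,6) unfolding edges_between_def by auto
    qed
    moreover have "{a, b} \<inter> {a, b'} \<noteq> {}" by simp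
    ultimately have "{a, b} = {a, b'}"
      using disjointD[OF mat[OF uv a(1), unfolded matching_def]] by metis
    then show "b = b'" by (auto simp: doubleton_eq_iff)
  qed
  have "critical_cover (verts G) (adjacent G) T ?cf (k - 1)"
  proof (intro critical_cover.intro critical_cover_axioms.intro c)
    fix \<phi> show "\<not> cover.colors (adjacent G) T ?cf (verts G) \<phi>"
    proof
      assume co: "cover.colors (adjacent G) T ?cf (verts G) \<phi>"
      have inL: "\<phi> v \<in> L v" if "v \<in> verts G" for v
        using co T[OF that] that unfolding cover.colors_def[OF c] by blast
      have "{\<phi> u, \<phi> v} \<notin> edges H" if uv: "u \<in> verts G" "v \<in> verts G" for u v
      proof
        assume e: "{\<phi> u, \<phi> v} \<in> edges H"
        have "u \<noteq> v" using adjacentD(3)[OF H e] by blast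
        moreover have "\<not> adjacent G u v" using co e uv unfolding cover.colors_def[OF c] by blast
        moreover have "{\<phi> u, \<phi> v} \<in> edges_between H (L u) (L v)"
          using e inL uv unfolding edges_between_def by blast
        ultimately show False using emp[OF uv] by blast
      qed
      then have "cover_coloring G H L \<phi>"
        using inL un unfolding cover_coloring_def independent_in_def by blast
      then show False using HL(3) by blast
    qed
  next
    fix A assume A: "A \<subset> verts G"
    let ?G = "induced G A" and ?H = "induced H (\<Union>v\<in>A. T v)"
    have vA: "verts ?G = A" by (simp add: induced_def)
    have AG: "v \<in> verts G" if "v \<in> A" for v using A that by blast
    have between: "edges_between ?H (T u) (T v) \<subseteq> edges_between H (L u) (L v)" if "u \<in> A" "v \<in> A" for u v
      using T[OF AG[OF that(1)]] T[OF AG[OF that(2)]] unfolding edges_between_def induced_def by auto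
    have "correspondence_cover ?G ?H T"
      unfolding correspondence_cover_def vA
    proof (intro conjI ballI impI)
      have "finite A" using A G unfolding simple_graph_def by (meson finite_subset psubset_imp_subset)
      then show "simple_graph ?H" using H T AG unfolding simple_graph_def induced_def by auto
      show "disjoint_family_on T A"
        using dis T AG unfolding disjoint_family_on_def by (meson disjoint_iff subsetD)
      show "(\<Union>v\<in>A. T v) = verts ?H" by (simp add: induced_def)
      show "independent_in ?H (T v)" if "v \<in> A" for v
        using ind[OF AG[OF that]] T[OF AG[OF that]] that unfolding independent_in_def induced_def by auto
      fix u v assume uv: "u \<in> A" "v \<in> A" "u \<noteq> v"
      show "if {u, v} \<in> edges ?G then matching (edges_between ?H (T u) (T v)) else edges_between ?H (T u) (T v) = {}"
      proof (cases "adjacent G u v")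
        case True
        then have "{u, v} \<in> edges ?G" using uv by (simp add: induced_def)
        moreover have "matching (edges_between ?H (T u) (T v))"
          using mat[OF AG[OF uv(1)] AG[OF uv(2)] uv(3) True] between[OF uv(1,2)]
          unfolding matching_def by (meson disjoint_def subsetD)
        ultimately show ?thesis by simp
      next
        case False
        then have "{u, v} \<notin> edges ?G" by (simp add: induced_def)
        moreover have "edges_between ?H (T u) (T v) = {}"
          using emp[OF AG[OF uv(1)] AG[OF uv(2)] uv(3) False] between[OF uv(1,2)] by simp
        ultimately show ?thesis by simp
      qed
    qed
    moreover have "\<forall>v\<in>verts ?G. k - 1 \<le> card (T v)" using T AG vA by simp
    moreover have "correspondence_colorable (k - 1) ?G" by (rule sub[OF induced_proper[OF G A]])
    ultimately obtain \<phi> where \<phi>: "cover_coloring ?G ?H T \<phi>" unfolding correspondence_colorable_def by blast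
    have inT: "\<phi> v \<in> T v" if "v \<in> A" for v using \<phi> that vA unfolding cover_coloring_def by simp
    have "{\<phi> u, \<phi> v} \<notin> edges H" if "u \<in> A" "v \<in> A" for u v
    proof
      assume "{\<phi> u, \<phi> v} \<in> edges H"
      then have "{\<phi> u, \<phi> v} \<in> edges ?H" using inT that by (auto simp: induced_def)
      then show False using \<phi> that vA unfolding cover_coloring_def independent_in_def by auto
    qed
    then have "cover.colors (adjacent G) T ?cf A \<phi>" using inT unfolding cover.colors_def[OF c] by blast
    then show "\<exists>\<phi>. cover.colors (adjacent G) T ?cf A \<phi>" by blast
  next
    fix K assume K: "cover.clique (verts G) (adjacent G) K"
    have n': "k - 1 + 1 < card (verts G)" using k n by simp
    show "card K \<le> k - 1"
      by (rule clique_bound_intro[where P = "correspondence_colorable (k - 1)", OF c G n' sub complete_not_correspondence_colorable K])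
  qed
  then show ?thesis by blast
qed

lemma list_critical_edges:
  assumes "list_critical k G" "4 \<le> k" "k + 2 \<le> card (verts G)"
  shows "(real k - 1 + 1 / 28) * (real (card (verts G)) / 2) < real (card (edges G))"
    and "25 \<le> k \<Longrightarrow> (real k - 1 + 1 / 24) * (real (card (verts G)) / 2) < real (card (edges G))"
proof -
  have k: "real (k - 1) = real k - 1" using assms(2) by simp
  have k1: "1 \<le> k" and kn: "k < card (verts G)" using assms(2,3) by simp_all
  obtain Lst where c: "critical_cover (verts G) (adjacent G) Lst (\<lambda>u a v b. a = (b::nat)) (k - 1)"
    using list_critical_cover[OF assms(1) k1 kn] by (elim exE)
  have G: "simple_graph G" using assms(1) by (simp add: list_critical_def)
  show "(real k - 1 + 1 / 28) * (real (card (verts G)) / 2) < real (card (edges G))"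
    using edge_bound(1)[OF G c] assms(2) by (simp only: k)
  show "(real k - 1 + 1 / 24) * (real (card (verts G)) / 2) < real (card (edges G))" if "25 \<le> k"
    using edge_bound(2)[OF G c] that unfolding k by simp
qed

lemma correspondence_critical_edges:
  assumes "correspondence_critical k G" "4 \<le> k" "k + 2 \<le> card (verts G)"
  shows "(real k - 1 + 1 / 28) * (real (card (verts G)) / 2) < real (card (edges G))"
    and "25 \<le> k \<Longrightarrow> (real k - 1 + 1 / 24) * (real (card (verts G)) / 2) < real (card (edges G))"
proof -
  have k: "real (k - 1) = real k - 1" using assms(2) by simp
  have k1: "1 \<le> k" and kn: "k < card (verts G)" using assms(2,3) by simp_all
  obtain Lst :: "'a \<Rightarrow> nat set" and cf where c: "critical_cover (verts G) (adjacent G) Lst cf (k - 1)"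
    using correspondence_critical_cover[OF assms(1) k1 kn] by (elim exE)
  have G: "simple_graph G" using assms(1) by (simp add: correspondence_critical_def)
  show "(real k - 1 + 1 / 28) * (real (card (verts G)) / 2) < real (card (edges G))"
    using edge_bound(1)[OF G c] assms(2) by (simp only: k)
  show "(real k - 1 + 1 / 24) * (real (card (verts G)) / 2) < real (card (edges G))" if "25 \<le> k"
    using edge_bound(2)[OF G c] that unfolding k by simp
qed

text \<open>The infimum is attained if there are critical graphs on \<open>n\<close> vertices, and is \<open>\<infinity>\<close> otherwise.\<close>

lemma liminf_excess:
  fixes P :: "nat graph \<Rightarrow> bool"
  assumes "\<And>G. P G \<Longrightarrow> k + 2 \<le> card (verts G) \<Longrightarrow>
      (real k - 1 + \<epsilon>) * (real (card (verts G)) / 2) < real (card (edges G))"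
  shows "ereal \<epsilon> \<le> liminf (\<lambda>n. ereal (2 / real n) *
      ereal_of_enat (Inf {enat (card (edges G)) | G. P G \<and> card (verts G) = n}) - ereal (real k) + 1)"
proof (rule Liminf_bounded)
  show "\<forall>\<^sub>F n in sequentially. ereal \<epsilon> \<le> ereal (2 / real n) *
      ereal_of_enat (Inf {enat (card (edges G)) | G. P G \<and> card (verts G) = n}) - ereal (real k) + 1"
  proof (rule eventually_sequentiallyI[of "k + 2"])
    fix n assume n: "k + 2 \<le> n"
    let ?A = "{enat (card (edges G)) | G. P G \<and> card (verts G) = n}"
    show "ereal \<epsilon> \<le> ereal (2 / real n) * ereal_of_enat (Inf ?A) - ereal (real k) + 1"
    proof (cases "?A = {}")
      case True
      have "Inf ?A = Inf {}" by (rule arg_cong[OF True])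
      then have I: "Inf ?A = \<infinity>" by (simp add: Inf_enat_def)
      show ?thesis unfolding I using n by simp
    next
      case False
      then obtain a where "a \<in> ?A" by (meson ex_in_conv)
      then have "Inf ?A \<in> ?A" by (rule wellorder_InfI)
      then obtain G where G: "Inf ?A = enat (card (edges G))" "P G" "card (verts G) = n"
        unfolding mem_Collect_eq by (elim exE conjE)
      have "(real k - 1 + \<epsilon>) * (real n / 2) < real (card (edges G))" using assms[OF G(2)] G(3) n by simp
      then have "\<epsilon> \<le> 2 / real n * real (card (edges G)) - real k + 1" using n by (simp add: field_simps)
      then have "ereal \<epsilon> \<le> ereal (2 / real n * real (card (edges G)) - real k + 1)" by simp
      also have "\<dots> = ereal (2 / real n) * ereal_of_enat (Inf ?A) - ereal (real k) + 1"
        unfolding G(1) by (simp add: one_ereal_def)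
      finally show ?thesis .
    qed
  qed
qed

theorem mainTheorem4:
  shows "(\<forall>k n :: nat. k \<ge> 4 \<longrightarrow> n \<ge> k + 2 \<longrightarrow>
            (\<forall>G :: 'a graph. list_critical k G \<and> card (verts G) = n \<longrightarrow>
               real (card (edges G)) > (real k - 1 + 1 / 28) * (real n / 2)) \<and>
            (\<forall>G :: 'a graph. correspondence_critical k G \<and> card (verts G) = n \<longrightarrow>
               real (card (edges G)) > (real k - 1 + 1 / 28) * (real n / 2)))
       \<and> (\<forall>k :: nat. k \<ge> 4 \<longrightarrow> g_list k \<ge> ereal (1 / 28) \<and> g_DP k \<ge> ereal (1 / 28))
       \<and> (\<forall>k :: nat. k \<ge> 352 \<longrightarrow> g_list k \<ge> ereal (1 / 24) \<and> g_DP k \<ge> ereal (1 / 24))"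
proof (intro conjI allI impI)
  fix k n :: nat and G :: "'a graph"
  assume k: "4 \<le> k" "k + 2 \<le> n"
  show "(real k - 1 + 1 / 28) * (real n / 2) < real (card (edges G))"
    if "list_critical k G \<and> card (verts G) = n"
    using list_critical_edges(1)[of k G] k that by simp
  show "(real k - 1 + 1 / 28) * (real n / 2) < real (card (edges G))"
    if "correspondence_critical k G \<and> card (verts G) = n"
    using correspondence_critical_edges(1)[of k G] k that by simp
next
  fix k :: nat assume k: "4 \<le> k"
  show "ereal (1 / 28) \<le> g_list k" unfolding g_list_def f_list_def
    by (rule liminf_excess) (rule list_critical_edges(1)[OF _ k])
  show "ereal (1 / 28) \<le> g_DP k" unfolding g_DP_def f_DP_def
    by (rule liminf_excess) (rule correspondence_critical_edges(1)[OF _ k])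
next
  fix k :: nat assume k: "352 \<le> k"
  then have k': "4 \<le> k" "25 \<le> k" by simp_all
  show "ereal (1 / 24) \<le> g_list k" unfolding g_list_def f_list_def
    by (rule liminf_excess) (rule list_critical_edges(2)[OF _ k'(1) _ k'(2)])
  show "ereal (1 / 24) \<le> g_DP k" unfolding g_DP_def f_DP_def
    by (rule liminf_excess) (rule correspondence_critical_edges(2)[OF _ k'(1) _ k'(2)])
qed

end
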